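(* A $\star$-autonomous category induces a $\dagger$-Frobenius pseudomonoid in $\mathsf{Prof}$.
   Context: Categories are taken to be small here, since the objects of $\mathsf{Prof}$ are small categories. For a category $\mathcal{C}$, $\mathcal{C}^{\mathrm{op}}$ denotes the category with reversed morphisms. A $\star$-autonomous category is a monoidal category $(\mathcal{C}, \otimes, \mathbb{1})$ together with an equivalence of categories $D: \mathcal{C}^{\mathrm{op}} \to \mathcal{C}$ and isomorphisms $\mathrm{Hom}_{\mathcal{C}}(x \otimes y, Dz) \cong \mathrm{Hom}_{\mathcal{C}}(x, D(y \otimes z))$ natural in $x,y,z \in \mathcal{C}$. $\mathsf{Prof}$ is the monoidal bicategory whose objects are small categories, whose $1$-cells $F: \mathcal{A} \nrightarrow \mathcal{B}$ (profunctors) are functors $F: \mathcal{B}^{\mathrm{op}} \times \mathcal{A} \to \mathsf{Set}$, and whose $2$-cells are natural transformations. The composite of $F: \mathcal{A} \nrightarrow \mathcal{B}$ and $G: \mathcal{B} \nrightarrow \mathcal{E}$ is the coend $(G \circ F)(e,a) = \int^{b \in \mathcal{B}} F(b,a) \times G(e,b)$; the tensor product is the cartesian product of categories, with unit the category with one object and one morphism. A pseudomonoid $(A, \mu, \eta)$ in a monoidal bicategory with tensor product $\otimes$ and unit $\mathbb{1}$ consists of an object $A$, $1$-cells $\mu: A \otimes A \to A$ and $\eta: \mathbb{1} \to A$, an invertible associator $2$-cell $\mu(\mu \otimes \mathrm{id}) \cong \mu(\mathrm{id} \otimes \mu)$ and invertible unitor $2$-cells $\mu(\eta \otimes \mathrm{id})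 \cong \mathrm{id} \cong \mu(\mathrm{id} \otimes \eta)$ satisfying the pentagon and triangle axioms. It is Frobenius if there is a $1$-cell $\sigma: A \otimes A \to \mathbb{1}$ that is the evaluation of a biexact pairing $A \dashv A$, together with an invertible $2$-cell $\sigma \circ (\mu \otimes \mathrm{id}_A) \cong \sigma \circ (\mathrm{id}_A \otimes \mu)$. Here a biexact pairing $x \dashv y$ consists of $1$-cells $\varepsilon_1: x \otimes y \to \mathbb{1}$ (evaluation) and $\eta_1: \mathbb{1} \to y \otimes x$ (coevaluation) and invertible $2$-cells $(\mathrm{id}_y \otimes \varepsilon_1)(\eta_1 \otimes \mathrm{id}_y) \cong \mathrm{id}_y$ and $\mathrm{id}_x \cong (\varepsilon_1 \otimes \mathrm{id}_x)(\mathrm{id}_x \otimes \eta_1)$. A Frobenius pseudomonoid is a $\dagger$-Frobenius pseudomonoid if $\mu$ and $\eta$ have right adjoints in the bicategory. *)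

theory Defs
  imports Main
begin

section \<open>Categories, functors, natural isomorphisms\<close>

text \<open>
  A small category is given by a set of objects and a set of arrows. All structure maps are total
  functions that are only meaningful on these sets. \<open>Cmp C g f\<close> is the composite
  ``\<open>g\<close> after \<open>f\<close>''.
\<close>

record ('o, 'a) cat =
  Obj :: "'o set"
  Arr :: "'a set"
  Dom :: "'a \<Rightarrow> 'o"
  Cod :: "'a \<Rightarrow> 'o"
  Idn :: "'o \<Rightarrow> 'a"
  Cmp :: "'a \<Rightarrow> 'a \<Rightarrow> 'a"

definition hom :: "('o, 'a) cat \<Rightarrow> 'o \<Rightarrow> 'o \<Rightarrow> 'a set" where
  "hom C x y = {f \<in> Arr C. Dom C f = x \<and> Cod C f = y}"

definition category :: "('o, 'a) cat \<Rightarrow> bool" where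
  "category C \<longleftrightarrow>
     (\<forall>f\<in>Arr C. Dom C f \<in> Obj C \<and> Cod C f \<in> Obj C) \<and>
     (\<forall>x\<in>Obj C. Idn C x \<in> hom C x x) \<and>
     (\<forall>f\<in>Arr C. \<forall>g\<in>Arr C. Dom C g = Cod C f \<longrightarrow> Cmp C g f \<in> hom C (Dom C f) (Cod C g)) \<and>
     (\<forall>f\<in>Arr C. Cmp C f (Idn C (Dom C f)) = f \<and> Cmp C (Idn C (Cod C f)) f = f) \<and>
     (\<forall>f\<in>Arr C. \<forall>g\<in>Arr C. \<forall>h\<in>Arr C. Dom C g = Cod C f \<longrightarrow> Dom C h = Cod C g \<longrightarrow>
        Cmp C h (Cmp C g f) = Cmp C (Cmp C h g) f)"

definition inverse_arrows :: "('o, 'a) cat \<Rightarrow> 'a \<Rightarrow> 'a \<Rightarrow> bool" where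
  "inverse_arrows C f g \<longleftrightarrow> f \<in> Arr C \<and> g \<in> hom C (Cod C f) (Dom C f) \<and>
     Cmp C g f = Idn C (Dom C f) \<and> Cmp C f g = Idn C (Cod C f)"

definition iso_arrow :: "('o, 'a) cat \<Rightarrow> 'a \<Rightarrow> bool" where
  "iso_arrow C f \<longleftrightarrow> (\<exists>g. inverse_arrows C f g)"

definition inv_arrow :: "('o, 'a) cat \<Rightarrow> 'a \<Rightarrow> 'a" where
  "inv_arrow C f = (THE g. inverse_arrows C f g)"

definition op_cat :: "('o, 'a) cat \<Rightarrow> ('o, 'a) cat" where
  "op_cat C = \<lparr>Obj = Obj C, Arr = Arr C, Dom = Cod C, Cod = Dom C, Idn = Idn C,
     Cmp = (\<lambda>g f. Cmp C f g)\<rparr>"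

definition prod_cat :: "('o, 'a) cat \<Rightarrow> ('p, 'b) cat \<Rightarrow> ('o \<times> 'p, 'a \<times> 'b) cat" (infixr "\<times>\<^sub>c" 80)
  where
  "C \<times>\<^sub>c D = \<lparr>Obj = Obj C \<times> Obj D, Arr = Arr C \<times> Arr D,
     Dom = map_prod (Dom C) (Dom D), Cod = map_prod (Cod C) (Cod D),
     Idn = map_prod (Idn C) (Idn D),
     Cmp = (\<lambda>(g, g') (f, f'). (Cmp C g f, Cmp D g' f'))\<rparr>"

definition unit_cat :: "(unit, unit) cat" where
  "unit_cat = \<lparr>Obj = UNIV, Arr = UNIV, Dom = (\<lambda>_. ()), Cod = (\<lambda>_. ()), Idn = (\<lambda>_. ()),
     Cmp = (\<lambda>_ _. ())\<rparr>"

record ('o, 'a, 'p, 'b) functr =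
  fdom :: "('o, 'a) cat"
  fcod :: "('p, 'b) cat"
  fo :: "'o \<Rightarrow> 'p"
  fa :: "'a \<Rightarrow> 'b"

definition is_functor ::
  "('o, 'a) cat \<Rightarrow> ('p, 'b) cat \<Rightarrow> ('o, 'a, 'p, 'b) functr \<Rightarrow> bool" where
  "is_functor C D F \<longleftrightarrow> category C \<and> category D \<and> fdom F = C \<and> fcod F = D \<and>
     (\<forall>x\<in>Obj C. fo F x \<in> Obj D) \<and>
     (\<forall>f\<in>Arr C. fa F f \<in> hom D (fo F (Dom C f)) (fo F (Cod C f))) \<and>
     (\<forall>x\<in>Obj C. fa F (Idn C x) = Idn D (fo F x)) \<and>
     (\<forall>f\<in>Arr C. \<forall>g\<in>Arr C. Dom C g = Cod C f \<longrightarrow>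
        fa F (Cmp C g f) = Cmp D (fa F g) (fa F f))"

definition fid :: "('o, 'a) cat \<Rightarrow> ('o, 'a, 'o, 'a) functr" where
  "fid C = \<lparr>fdom = C, fcod = C, fo = (\<lambda>x. x), fa = (\<lambda>f. f)\<rparr>"

definition fcomp ::
  "('p, 'b, 'q, 'c) functr \<Rightarrow> ('o, 'a, 'p, 'b) functr \<Rightarrow> ('o, 'a, 'q, 'c) functr"
  (infixl "\<circ>\<^sub>f" 75) where
  "G \<circ>\<^sub>f F = \<lparr>fdom = fdom F, fcod = fcod G, fo = fo G \<circ> fo F, fa = fa G \<circ> fa F\<rparr>"

definition fprod ::
  "('o, 'a, 'p, 'b) functr \<Rightarrow> ('q, 'c, 'r, 'd) functr \<Rightarrow>
   ('o \<times> 'q, 'a \<times> 'c, 'p \<times> 'r, 'b \<times> 'd) functr" (infixr "\<times>\<^sub>f" 80) where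
  "F \<times>\<^sub>f G = \<lparr>fdom = fdom F \<times>\<^sub>c fdom G, fcod = fcod F \<times>\<^sub>c fcod G,
     fo = map_prod (fo F) (fo G), fa = map_prod (fa F) (fa G)\<rparr>"

definition fpoint :: "('o, 'a) cat \<Rightarrow> 'o \<Rightarrow> (unit, unit, 'o, 'a) functr" where
  "fpoint C x = \<lparr>fdom = unit_cat, fcod = C, fo = (\<lambda>_. x), fa = (\<lambda>_. Idn C x)\<rparr>"

text \<open>The canonical isomorphisms \<open>(A \<times> B) \<times> C \<cong> A \<times> (B \<times> C)\<close>, \<open>1 \<times> A \<cong> A\<close> and \<open>A \<times> 1 \<cong> A\<close>.\<close>

definition fassoc :: "('o, 'a) cat \<Rightarrow> ('p, 'b) cat \<Rightarrow> ('q, 'c) cat \<Rightarrow>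
   (('o \<times> 'p) \<times> 'q, ('a \<times> 'b) \<times> 'c, 'o \<times> 'p \<times> 'q, 'a \<times> 'b \<times> 'c) functr" where
  "fassoc A B C = \<lparr>fdom = (A \<times>\<^sub>c B) \<times>\<^sub>c C, fcod = A \<times>\<^sub>c (B \<times>\<^sub>c C),
     fo = (\<lambda>((x, y), z). (x, (y, z))), fa = (\<lambda>((f, g), h). (f, (g, h)))\<rparr>"

definition fassoc_inv :: "('o, 'a) cat \<Rightarrow> ('p, 'b) cat \<Rightarrow> ('q, 'c) cat \<Rightarrow>
   ('o \<times> 'p \<times> 'q, 'a \<times> 'b \<times> 'c, ('o \<times> 'p) \<times> 'q, ('a \<times> 'b) \<times> 'c) functr" where
  "fassoc_inv A B C = \<lparr>fdom = A \<times>\<^sub>c (B \<times>\<^sub>c C), fcod = (A \<times>\<^sub>c B) \<times>\<^sub>c C,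
     fo = (\<lambda>(x, (y, z)). ((x, y), z)), fa = (\<lambda>(f, (g, h)). ((f, g), h))\<rparr>"

definition flunit :: "('o, 'a) cat \<Rightarrow> (unit \<times> 'o, unit \<times> 'a, 'o, 'a) functr" where
  "flunit A = \<lparr>fdom = unit_cat \<times>\<^sub>c A, fcod = A, fo = snd, fa = snd\<rparr>"

definition frunit :: "('o, 'a) cat \<Rightarrow> ('o \<times> unit, 'a \<times> unit, 'o, 'a) functr" where
  "frunit A = \<lparr>fdom = A \<times>\<^sub>c unit_cat, fcod = A, fo = fst, fa = fst\<rparr>"

definition nat_iso :: "('o, 'a) cat \<Rightarrow> ('p, 'b) cat \<Rightarrow>
   ('o, 'a, 'p, 'b) functr \<Rightarrow> ('o, 'a, 'p, 'b) functr \<Rightarrow> ('o \<Rightarrow> 'b) \<Rightarrow> bool" where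
  "nat_iso C D F G \<theta> \<longleftrightarrow> is_functor C D F \<and> is_functor C D G \<and>
     (\<forall>x\<in>Obj C. \<theta> x \<in> hom D (fo F x) (fo G x) \<and> iso_arrow D (\<theta> x)) \<and>
     (\<forall>f\<in>Arr C. Cmp D (\<theta> (Cod C f)) (fa F f) = Cmp D (fa G f) (\<theta> (Dom C f)))"

definition equivalence :: "('o, 'a) cat \<Rightarrow> ('p, 'b) cat \<Rightarrow> ('o, 'a, 'p, 'b) functr \<Rightarrow> bool" where
  "equivalence C D F \<longleftrightarrow> is_functor C D F \<and>
     (\<exists>G \<theta> \<zeta>. is_functor D C G \<and>
        nat_iso C C (G \<circ>\<^sub>f F) (fid C) \<theta> \<and> nat_iso D D (F \<circ>\<^sub>f G) (fid D) \<zeta>)"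


section \<open>Monoidal and \<open>\<star>\<close>-autonomous categories\<close>

record ('o, 'a) moncat =
  ucat :: "('o, 'a) cat"
  ten :: "('o \<times> 'o, 'a \<times> 'a, 'o, 'a) functr"
  unt :: "'o"
  asc :: "'o \<Rightarrow> 'o \<Rightarrow> 'o \<Rightarrow> 'a"
  lun :: "'o \<Rightarrow> 'a"
  run :: "'o \<Rightarrow> 'a"

abbreviation tensO :: "('o, 'a) moncat \<Rightarrow> 'o \<Rightarrow> 'o \<Rightarrow> 'o" where
  "tensO M x y \<equiv> fo (ten M) (x, y)"

abbreviation tensA :: "('o, 'a) moncat \<Rightarrow> 'a \<Rightarrow> 'a \<Rightarrow> 'a" where
  "tensA M f g \<equiv> fa (ten M) (f, g)"

text \<open>
  The constraints go \<open>asc x y z : (x \<otimes> y) \<otimes> z \<rightarrow> x \<otimes> (y \<otimes> z)\<close>,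
  \<open>lun x : I \<otimes> x \<rightarrow> x\<close> and \<open>run x : x \<otimes> I \<rightarrow> x\<close>.
\<close>

definition monoidal_category :: "('o, 'a) moncat \<Rightarrow> bool" where
  "monoidal_category M \<longleftrightarrow> (let C = ucat M; T = ten M in
     category C \<and> is_functor (C \<times>\<^sub>c C) C T \<and> unt M \<in> Obj C \<and>
     nat_iso ((C \<times>\<^sub>c C) \<times>\<^sub>c C) C (T \<circ>\<^sub>f (T \<times>\<^sub>f fid C)) (T \<circ>\<^sub>f (fid C \<times>\<^sub>f T) \<circ>\<^sub>f fassoc C C C)
       (\<lambda>((x, y), z). asc M x y z) \<and>
     nat_iso (unit_cat \<times>\<^sub>c C) C (T \<circ>\<^sub>f (fpoint C (unt M) \<times>\<^sub>f fid C)) (flunit C) (\<lambda>(_, x). lun M x) \<and>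
     nat_iso (C \<times>\<^sub>c unit_cat) C (T \<circ>\<^sub>f (fid C \<times>\<^sub>f fpoint C (unt M))) (frunit C) (\<lambda>(x, _). run M x) \<and>
     (\<forall>w\<in>Obj C. \<forall>x\<in>Obj C. \<forall>y\<in>Obj C. \<forall>z\<in>Obj C.
        Cmp C (tensA M (Idn C w) (asc M x y z))
          (Cmp C (asc M w (tensO M x y) z) (tensA M (asc M w x y) (Idn C z))) =
        Cmp C (asc M w x (tensO M y z)) (asc M (tensO M w x) y z)) \<and>
     (\<forall>x\<in>Obj C. \<forall>y\<in>Obj C.
        Cmp C (tensA M (Idn C x) (lun M y)) (asc M x (unt M) y) = tensA M (run M x) (Idn C y)))"

definition mon_op :: "('o, 'a) moncat \<Rightarrow> ('o, 'a) moncat" where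
  "mon_op M = (let C = ucat M in
     \<lparr>ucat = op_cat C,
      ten = \<lparr>fdom = op_cat C \<times>\<^sub>c op_cat C, fcod = op_cat C, fo = fo (ten M), fa = fa (ten M)\<rparr>,
      unt = unt M,
      asc = (\<lambda>x y z. inv_arrow C (asc M x y z)),
      lun = (\<lambda>x. inv_arrow C (lun M x)),
      run = (\<lambda>x. inv_arrow C (run M x))\<rparr>)"

text \<open>
  \<open>\<phi> x y z\<close> is the isomorphism \<open>Hom (x \<otimes> y) (D z) \<cong> Hom x (D (y \<otimes> z))\<close>; the last conjunct is
  naturality (contravariance) in all three variables at once.
\<close>

definition star_autonomous :: "('o, 'a) moncat \<Rightarrow> ('o, 'a, 'o, 'a) functr \<Rightarrow>
   ('o \<Rightarrow> 'o \<Rightarrow> 'o \<Rightarrow> 'a \<Rightarrow> 'a) \<Rightarrow> bool" where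
  "star_autonomous M D \<phi> \<longleftrightarrow> (let C = ucat M in
     monoidal_category M \<and> equivalence (op_cat C) C D \<and>
     (\<forall>x\<in>Obj C. \<forall>y\<in>Obj C. \<forall>z\<in>Obj C.
        bij_betw (\<phi> x y z) (hom C (tensO M x y) (fo D z)) (hom C x (fo D (tensO M y z)))) \<and>
     (\<forall>f\<in>Arr C. \<forall>g\<in>Arr C. \<forall>h\<in>Arr C. \<forall>u\<in>hom C (tensO M (Cod C f) (Cod C g)) (fo D (Cod C h)).
        \<phi> (Dom C f) (Dom C g) (Dom C h) (Cmp C (fa D h) (Cmp C u (tensA M f g))) =
        Cmp C (fa D (tensA M g h)) (Cmp C (\<phi> (Cod C f) (Cod C g) (Cod C h) u) f)))"


section \<open>Coends of sets\<close>

definition set_functor :: "('o, 'a) cat \<Rightarrow> ('o \<Rightarrow> 'v set) \<Rightarrow> ('a \<Rightarrow> 'v \<Rightarrow> 'v) \<Rightarrow> bool" where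
  "set_functor J S T \<longleftrightarrow> category J \<and>
     (\<forall>f\<in>Arr J. \<forall>u\<in>S (Dom J f). T f u \<in> S (Cod J f)) \<and>
     (\<forall>x\<in>Obj J. \<forall>u\<in>S x. T (Idn J x) u = u) \<and>
     (\<forall>f\<in>Arr J. \<forall>g\<in>Arr J. Dom J g = Cod J f \<longrightarrow>
        (\<forall>u\<in>S (Dom J f). T (Cmp J g f) u = T g (T f u)))"

text \<open>
  The coend of a functor \<open>(S, T) : B\<^sup>o\<^sup>p \<times> B \<rightarrow> Set\<close> is the quotient of the disjoint union of the sets
  \<open>S (b, b)\<close> by the equivalence relation generated by
  \<open>(b, T (k, id) t) \<sim> (b', T (id, k) t)\<close> for \<open>k : b \<rightarrow> b'\<close> in \<open>B\<close> and \<open>t \<in> S (b', b)\<close>.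
\<close>

definition coend_points :: "('o, 'a) cat \<Rightarrow> ('o \<times> 'o \<Rightarrow> 'v set) \<Rightarrow> ('o \<times> 'v) set" where
  "coend_points B S = (SIGMA b : Obj B. S (b, b))"

definition coend_gen :: "('o, 'a) cat \<Rightarrow> ('o \<times> 'o \<Rightarrow> 'v set) \<Rightarrow> ('a \<times> 'a \<Rightarrow> 'v \<Rightarrow> 'v) \<Rightarrow>
   (('o \<times> 'v) \<times> ('o \<times> 'v)) set" where
  "coend_gen B S T =
     {((b, T (k, Idn B b) t), (b', T (Idn B b', k) t)) | b b' k t.
        b \<in> Obj B \<and> b' \<in> Obj B \<and> k \<in> hom B b b' \<and> t \<in> S (b', b)}"

definition coend_rel :: "('o, 'a) cat \<Rightarrow> ('o \<times> 'o \<Rightarrow> 'v set) \<Rightarrow> ('a \<times> 'a \<Rightarrow> 'v \<Rightarrow> 'v) \<Rightarrow>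
   (('o \<times> 'v) \<times> ('o \<times> 'v)) set" where
  "coend_rel B S T = Restr ((coend_gen B S T \<union> (coend_gen B S T)\<inverse>)\<^sup>*) (coend_points B S)"

definition coend :: "('o, 'a) cat \<Rightarrow> ('o \<times> 'o \<Rightarrow> 'v set) \<Rightarrow> ('a \<times> 'a \<Rightarrow> 'v \<Rightarrow> 'v) \<Rightarrow>
   ('o \<times> 'v) set set" where
  "coend B S T = coend_points B S // coend_rel B S T"

text \<open>
  The value at an equivalence class of a map defined on representatives. It is meaningful only for
  maps that are constant on the class.
\<close>

definition on_class :: "('x \<Rightarrow> 'y) \<Rightarrow> 'x set \<Rightarrow> 'y" where
  "on_class f X = the_elem (f ` X)"


section \<open>The monoidal bicategory of profunctors\<close>

text \<open>
  \<open>F : A \<nrightarrow> B\<close> is a functor \<open>B\<^sup>o\<^sup>p \<times> A \<rightarrow> Set\<close> with object part \<open>El F\<close> and arrow part \<open>Act F\<close>. It carries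
  its source \<open>A\<close> and target \<open>B\<close>. Its values are subsets of one type.
\<close>

record ('o, 'a, 'p, 'b, 'v) prof =
  psrc :: "('o, 'a) cat"
  ptgt :: "('p, 'b) cat"
  El :: "'p \<times> 'o \<Rightarrow> 'v set"
  Act :: "'b \<times> 'a \<Rightarrow> 'v \<Rightarrow> 'v"

definition profunctor :: "('o, 'a) cat \<Rightarrow> ('p, 'b) cat \<Rightarrow> ('o, 'a, 'p, 'b, 'v) prof \<Rightarrow> bool" where
  "profunctor A B F \<longleftrightarrow> category A \<and> category B \<and> psrc F = A \<and> ptgt F = B \<and>
     set_functor (op_cat B \<times>\<^sub>c A) (El F) (Act F)"

text \<open>The profunctor \<open>(y, x) \<mapsto> Hom y (F x)\<close> of a functor \<open>F\<close>, and identity profunctors.\<close>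

definition rep :: "('o, 'a, 'p, 'b) functr \<Rightarrow> ('o, 'a, 'p, 'b, 'b) prof" where
  "rep F = \<lparr>psrc = fdom F, ptgt = fcod F,
     El = (\<lambda>(y, x). hom (fcod F) y (fo F x)),
     Act = (\<lambda>(h, f) u. Cmp (fcod F) (fa F f) (Cmp (fcod F) u h))\<rparr>"

definition pid :: "('o, 'a) cat \<Rightarrow> ('o, 'a, 'o, 'a, 'a) prof" where
  "pid A = rep (fid A)"

text \<open>
  Composition: \<open>(G \<odot> F) (e, a)\<close> is the coend over \<open>b\<close> of \<open>F (b, a) \<times> G (e, b)\<close>. An element is the
  class \<open>pcls G F (e, a) (b, (u, v))\<close> of some \<open>u \<in> F (b, a)\<close> and \<open>v \<in> G (e, b)\<close>.
\<close>

definition integrandS :: "('p, 'b, 'q, 'c, 'w) prof \<Rightarrow> ('o, 'a, 'p, 'b, 'v) prof \<Rightarrow>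
   'q \<times> 'o \<Rightarrow> 'p \<times> 'p \<Rightarrow> ('v \<times> 'w) set" where
  "integrandS G F = (\<lambda>(e, a) (b, b'). El F (b, a) \<times> El G (e, b'))"

definition integrandT :: "('p, 'b, 'q, 'c, 'w) prof \<Rightarrow> ('o, 'a, 'p, 'b, 'v) prof \<Rightarrow>
   'q \<times> 'o \<Rightarrow> 'b \<times> 'b \<Rightarrow> 'v \<times> 'w \<Rightarrow> 'v \<times> 'w" where
  "integrandT G F = (\<lambda>(e, a) (k, k') (u, v).
     (Act F (k, Idn (psrc F) a) u, Act G (Idn (ptgt G) e, k') v))"

definition pcls :: "('p, 'b, 'q, 'c, 'w) prof \<Rightarrow> ('o, 'a, 'p, 'b, 'v) prof \<Rightarrow>
   'q \<times> 'o \<Rightarrow> 'p \<times> 'v \<times> 'w \<Rightarrow> ('p \<times> 'v \<times> 'w) set" where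
  "pcls G F x t = coend_rel (ptgt F) (integrandS G F x) (integrandT G F x) `` {t}"

definition pcomp :: "('p, 'b, 'q, 'c, 'w) prof \<Rightarrow> ('o, 'a, 'p, 'b, 'v) prof \<Rightarrow>
   ('o, 'a, 'q, 'c, ('p \<times> 'v \<times> 'w) set) prof" (infixr "\<odot>" 70) where
  "G \<odot> F = \<lparr>psrc = psrc F, ptgt = ptgt G,
     El = (\<lambda>x. coend (ptgt F) (integrandS G F x) (integrandT G F x)),
     Act = (\<lambda>(h, f). on_class (\<lambda>(b, (u, v)).
       pcls G F (Dom (ptgt G) h, Cod (psrc F) f)
         (b, (Act F (Idn (ptgt F) b, f) u, Act G (h, Idn (ptgt F) b) v))))\<rparr>"

definition ptens :: "('o, 'a, 'p, 'b, 'v) prof \<Rightarrow> ('q, 'c, 'r, 'd, 'w) prof \<Rightarrow>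
   ('o \<times> 'q, 'a \<times> 'c, 'p \<times> 'r, 'b \<times> 'd, 'v \<times> 'w) prof" (infixr "\<otimes>" 80) where
  "F \<otimes> G = \<lparr>psrc = psrc F \<times>\<^sub>c psrc G, ptgt = ptgt F \<times>\<^sub>c ptgt G,
     El = (\<lambda>((y, y'), (x, x')). El F (y, x) \<times> El G (y', x')),
     Act = (\<lambda>((h, h'), (f, f')). map_prod (Act F (h, f)) (Act G (h', f')))\<rparr>"

text \<open>
  The tensor product of \<open>Prof\<close> is associative and unital only up to the isomorphisms \<open>fassoc\<close>,
  \<open>flunit\<close>, \<open>frunit\<close> of categories. Instead of composing with the profunctors of these
  isomorphisms, we transport profunctors along them by substitution:
  \<open>F \<triangleleft> \<phi>\<close> is \<open>(y, x) \<mapsto> F (y, \<phi> x)\<close> and \<open>\<psi> \<triangleright> F\<close> is \<open>(y, x) \<mapsto> F (\<psi> y, x)\<close>. The equations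
  \<open>(G \<odot> F) \<triangleleft> \<phi> = G \<odot> (F \<triangleleft> \<phi>)\<close> and \<open>(F \<triangleleft> \<phi>) \<otimes> (G \<triangleleft> \<psi>) = (F \<otimes> G) \<triangleleft> (\<phi> \<times> \<psi>)\<close> then
  hold strictly at all objects and arrows of the categories involved.
\<close>

definition psub :: "('p, 'b, 'q, 'c, 'v) prof \<Rightarrow> ('o, 'a, 'p, 'b) functr \<Rightarrow>
   ('o, 'a, 'q, 'c, 'v) prof" (infixl "\<triangleleft>" 72) where
  "F \<triangleleft> \<phi> = \<lparr>psrc = fdom \<phi>, ptgt = ptgt F,
     El = (\<lambda>(y, x). El F (y, fo \<phi> x)), Act = (\<lambda>(h, f). Act F (h, fa \<phi> f))\<rparr>"

definition psubt :: "('q, 'c, 'p, 'b) functr \<Rightarrow> ('o, 'a, 'p, 'b, 'v) prof \<Rightarrow>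
   ('o, 'a, 'q, 'c, 'v) prof" (infixr "\<triangleright>" 71) where
  "\<psi> \<triangleright> F = \<lparr>psrc = psrc F, ptgt = fdom \<psi>,
     El = (\<lambda>(y, x). El F (fo \<psi> y, x)), Act = (\<lambda>(h, f). Act F (fa \<psi> h, f))\<rparr>"


subsection \<open>2-cells\<close>

text \<open>
  A 2-cell carries its source and target 1-cells and its components. Two 2-cells with the same
  source are identified if their components agree on the elements of the source.
\<close>

record ('o, 'a, 'p, 'b, 'v, 'w) cell =
  csrc :: "('o, 'a, 'p, 'b, 'v) prof"
  ctgt :: "('o, 'a, 'p, 'b, 'w) prof"
  cmpt :: "'p \<times> 'o \<Rightarrow> 'v \<Rightarrow> 'w"

definition two_cell :: "('o, 'a, 'p, 'b, 'v) prof \<Rightarrow> ('o, 'a, 'p, 'b, 'w) prof \<Rightarrow>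
   ('o, 'a, 'p, 'b, 'v, 'w) cell \<Rightarrow> bool" where
  "two_cell F G \<tau> \<longleftrightarrow> csrc \<tau> = F \<and> ctgt \<tau> = G \<and>
     profunctor (psrc F) (ptgt F) F \<and> profunctor (psrc F) (ptgt F) G \<and>
     (\<forall>x\<in>Obj (ptgt F) \<times> Obj (psrc F). \<forall>u\<in>El F x. cmpt \<tau> x u \<in> El G x) \<and>
     (\<forall>h\<in>Arr (ptgt F). \<forall>f\<in>Arr (psrc F). \<forall>u\<in>El F (Cod (ptgt F) h, Dom (psrc F) f).
        cmpt \<tau> (Dom (ptgt F) h, Cod (psrc F) f) (Act F (h, f) u) =
        Act G (h, f) (cmpt \<tau> (Cod (ptgt F) h, Dom (psrc F) f) u))"

definition cell_eq :: "('o, 'a, 'p, 'b, 'v, 'w) cell \<Rightarrow> ('o, 'a, 'p, 'b, 'v, 'w) cell \<Rightarrow> bool"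
  (infix "\<doteq>" 50) where
  "\<tau> \<doteq> \<tau>' \<longleftrightarrow> (\<forall>x\<in>Obj (ptgt (csrc \<tau>)) \<times> Obj (psrc (csrc \<tau>)). \<forall>u\<in>El (csrc \<tau>) x.
     cmpt \<tau> x u = cmpt \<tau>' x u)"

definition idc :: "('o, 'a, 'p, 'b, 'v) prof \<Rightarrow> ('o, 'a, 'p, 'b, 'v, 'v) cell" where
  "idc F = \<lparr>csrc = F, ctgt = F, cmpt = (\<lambda>_ u. u)\<rparr>"

definition vcomp :: "('o, 'a, 'p, 'b, 'w, 'z) cell \<Rightarrow> ('o, 'a, 'p, 'b, 'v, 'w) cell \<Rightarrow>
   ('o, 'a, 'p, 'b, 'v, 'z) cell" (infixr "\<bullet>" 55) where
  "\<tau> \<bullet> \<sigma> = \<lparr>csrc = csrc \<sigma>, ctgt = ctgt \<tau>, cmpt = (\<lambda>x u. cmpt \<tau> x (cmpt \<sigma> x u))\<rparr>"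

definition invertible_cell :: "('o, 'a, 'p, 'b, 'v) prof \<Rightarrow> ('o, 'a, 'p, 'b, 'w) prof \<Rightarrow>
   ('o, 'a, 'p, 'b, 'v, 'w) cell \<Rightarrow> bool" where
  "invertible_cell F G \<tau> \<longleftrightarrow> two_cell F G \<tau> \<and>
     (\<exists>\<tau>'. two_cell G F \<tau>' \<and> \<tau>' \<bullet> \<tau> \<doteq> idc F \<and> \<tau> \<bullet> \<tau>' \<doteq> idc G)"

definition cinv :: "('o, 'a, 'p, 'b, 'v, 'w) cell \<Rightarrow> ('o, 'a, 'p, 'b, 'w, 'v) cell" where
  "cinv \<tau> = \<lparr>csrc = ctgt \<tau>, ctgt = csrc \<tau>, cmpt = (\<lambda>x. inv_into (El (csrc \<tau>) x) (cmpt \<tau> x))\<rparr>"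

definition hcomp :: "('p, 'b, 'q, 'c, 'w, 'w') cell \<Rightarrow> ('o, 'a, 'p, 'b, 'v, 'v') cell \<Rightarrow>
   ('o, 'a, 'q, 'c, ('p \<times> 'v \<times> 'w) set, ('p \<times> 'v' \<times> 'w') set) cell" (infixr "\<star>" 70) where
  "\<tau> \<star> \<sigma> = \<lparr>csrc = csrc \<tau> \<odot> csrc \<sigma>, ctgt = ctgt \<tau> \<odot> ctgt \<sigma>,
     cmpt = (\<lambda>(e, a). on_class (\<lambda>(b, (u, v)).
       pcls (ctgt \<tau>) (ctgt \<sigma>) (e, a) (b, (cmpt \<sigma> (b, a) u, cmpt \<tau> (e, b) v))))\<rparr>"

definition ctens :: "('o, 'a, 'p, 'b, 'v, 'v') cell \<Rightarrow> ('q, 'c, 'r, 'd, 'w, 'w') cell \<Rightarrow>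
   ('o \<times> 'q, 'a \<times> 'c, 'p \<times> 'r, 'b \<times> 'd, 'v \<times> 'w, 'v' \<times> 'w') cell" (infixr "\<boxtimes>" 80) where
  "\<tau> \<boxtimes> \<sigma> = \<lparr>csrc = csrc \<tau> \<otimes> csrc \<sigma>, ctgt = ctgt \<tau> \<otimes> ctgt \<sigma>,
     cmpt = (\<lambda>((y, y'), (x, x')). map_prod (cmpt \<tau> (y, x)) (cmpt \<sigma> (y', x')))\<rparr>"

definition csub :: "('p, 'b, 'q, 'c, 'v, 'w) cell \<Rightarrow> ('o, 'a, 'p, 'b) functr \<Rightarrow>
   ('o, 'a, 'q, 'c, 'v, 'w) cell" (infixl "\<lhd>" 72) where
  "\<tau> \<lhd> \<phi> = \<lparr>csrc = csrc \<tau> \<triangleleft> \<phi>, ctgt = ctgt \<tau> \<triangleleft> \<phi>, cmpt = (\<lambda>(y, x). cmpt \<tau> (y, fo \<phi> x))\<rparr>"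


subsection \<open>Structural 2-cells\<close>

text \<open>\<open>(H \<odot> G) \<odot> F \<Rightarrow> H \<odot> (G \<odot> F)\<close>\<close>

definition passoc :: "('q, 'c, 'r, 'd, 'z) prof \<Rightarrow> ('p, 'b, 'q, 'c, 'w) prof \<Rightarrow>
   ('o, 'a, 'p, 'b, 'v) prof \<Rightarrow> ('o, 'a, 'r, 'd, ('p \<times> 'v \<times> ('q \<times> 'w \<times> 'z) set) set,
     ('q \<times> ('p \<times> 'v \<times> 'w) set \<times> 'z) set) cell" where
  "passoc H G F = \<lparr>csrc = (H \<odot> G) \<odot> F, ctgt = H \<odot> (G \<odot> F),
     cmpt = (\<lambda>(d, a). on_class (\<lambda>(b, (u, Y)). on_class (\<lambda>(c, (v, w)).
       pcls H (G \<odot> F) (d, a) (c, (pcls G F (c, a) (b, (u, v)), w))) Y))\<rparr>"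

text \<open>\<open>id \<odot> F \<Rightarrow> F\<close> and \<open>F \<odot> id \<Rightarrow> F\<close>\<close>

definition plunit :: "('o, 'a, 'p, 'b, 'v) prof \<Rightarrow>
   ('o, 'a, 'p, 'b, ('p \<times> 'v \<times> 'b) set, 'v) cell" where
  "plunit F = \<lparr>csrc = pid (ptgt F) \<odot> F, ctgt = F,
     cmpt = (\<lambda>(y, x). on_class (\<lambda>(b, (u, k)). Act F (k, Idn (psrc F) x) u))\<rparr>"

definition prunit :: "('o, 'a, 'p, 'b, 'v) prof \<Rightarrow>
   ('o, 'a, 'p, 'b, ('o \<times> 'a \<times> 'v) set, 'v) cell" where
  "prunit F = \<lparr>csrc = F \<odot> pid (psrc F), ctgt = F,
     cmpt = (\<lambda>(y, x). on_class (\<lambda>(a, (k, u)). Act F (Idn (ptgt F) y, k) u))\<rparr>"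

text \<open>\<open>(G \<otimes> G') \<odot> (F \<otimes> F') \<Rightarrow> (G \<odot> F) \<otimes> (G' \<odot> F')\<close>\<close>

definition interchange :: "('p, 'b, 'q, 'c, 'w) prof \<Rightarrow> ('p1, 'b1, 'q1, 'c1, 'w1) prof \<Rightarrow>
   ('o, 'a, 'p, 'b, 'v) prof \<Rightarrow> ('o1, 'a1, 'p1, 'b1, 'v1) prof \<Rightarrow>
   ('o \<times> 'o1, 'a \<times> 'a1, 'q \<times> 'q1, 'c \<times> 'c1, (('p \<times> 'p1) \<times> ('v \<times> 'v1) \<times> ('w \<times> 'w1)) set,
    ('p \<times> 'v \<times> 'w) set \<times> ('p1 \<times> 'v1 \<times> 'w1) set) cell" where
  "interchange G G' F F' = \<lparr>csrc = (G \<otimes> G') \<odot> (F \<otimes> F'), ctgt = (G \<odot> F) \<otimes> (G' \<odot> F'),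
     cmpt = (\<lambda>((e, e'), (a, a')). on_class (\<lambda>((b, b'), ((u, u'), (v, v'))).
       (pcls G F (e, a) (b, (u, v)), pcls G' F' (e', a') (b', (u', v')))))\<rparr>"

text \<open>\<open>(G \<otimes> id\<^sub>C) \<odot> (F \<otimes> id\<^sub>C) \<Rightarrow> (G \<odot> F) \<otimes> id\<^sub>C\<close> and
  \<open>(id\<^sub>A \<otimes> G) \<odot> (id\<^sub>A \<otimes> F) \<Rightarrow> id\<^sub>A \<otimes> (G \<odot> F)\<close>\<close>

definition tens_comp_r where
  "tens_comp_r C G F =
     (idc (G \<odot> F) \<boxtimes> plunit (pid C)) \<bullet> interchange G (pid C) F (pid C)"

definition tens_comp_l where
  "tens_comp_l A G F =
     (plunit (pid A) \<boxtimes> idc (G \<odot> F)) \<bullet> interchange (pid A) G (pid A) F"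

text \<open>\<open>(id \<otimes> G) \<odot> (F \<otimes> id) \<Rightarrow> (F \<otimes> id) \<odot> (id \<otimes> G)\<close>, through \<open>F \<otimes> G\<close>\<close>

definition exchange where
  "exchange F G =
     cinv ((prunit F \<boxtimes> plunit G) \<bullet> interchange F (pid (ptgt G)) (pid (psrc F)) G) \<bullet>
     (plunit F \<boxtimes> prunit G) \<bullet> interchange (pid (ptgt F)) G F (pid (psrc G))"

text \<open>Naturality of associativity of \<open>\<otimes>\<close>:
  \<open>(G \<triangleleft> fassoc) \<odot> ((F\<^sub>1 \<otimes> F\<^sub>2) \<otimes> F\<^sub>3) \<Rightarrow> (G \<odot> (F\<^sub>1 \<otimes> (F\<^sub>2 \<otimes> F\<^sub>3))) \<triangleleft> fassoc\<close>\<close>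

definition assoc_natural where
  "assoc_natural G F1 F2 F3 =
     \<lparr>csrc = (G \<triangleleft> fassoc (ptgt F1) (ptgt F2) (ptgt F3)) \<odot> ((F1 \<otimes> F2) \<otimes> F3),
      ctgt = (G \<odot> (F1 \<otimes> (F2 \<otimes> F3))) \<triangleleft> fassoc (psrc F1) (psrc F2) (psrc F3),
      cmpt = (\<lambda>(e, ((x, y), z)). on_class (\<lambda>(((b1, b2), b3), (((u1, u2), u3), v)).
        pcls G (F1 \<otimes> (F2 \<otimes> F3)) (e, (x, (y, z))) ((b1, (b2, b3)), ((u1, (u2, u3)), v))))\<rparr>"


section \<open>Adjunctions, pseudomonoids, Frobenius pseudomonoids\<close>

definition adjunction :: "('o, 'a, 'p, 'b, 'v) prof \<Rightarrow> ('p, 'b, 'o, 'a, 'w) prof \<Rightarrow>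
   ('o, 'a, 'o, 'a, 'a, ('p \<times> 'v \<times> 'w) set) cell \<Rightarrow>
   ('p, 'b, 'p, 'b, ('o \<times> 'w \<times> 'v) set, 'b) cell \<Rightarrow> bool" where
  "adjunction F G u e \<longleftrightarrow> (let A = psrc F; B = ptgt F in
     profunctor A B F \<and> profunctor B A G \<and>
     two_cell (pid A) (G \<odot> F) u \<and> two_cell (F \<odot> G) (pid B) e \<and>
     plunit F \<bullet> (e \<star> idc F) \<bullet> cinv (passoc F G F) \<bullet> (idc F \<star> u) \<bullet> cinv (prunit F) \<doteq> idc F \<and>
     prunit G \<bullet> (idc G \<star> e) \<bullet> passoc G F G \<bullet> (u \<star> idc G) \<bullet> cinv (plunit G) \<doteq> idc G)"

text \<open>
  Here and in the definition of Frobenius pseudomonoids, the profunctors whose existence is claimed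
  are required to take values in subsets of the same type as the given one.
\<close>

definition has_right_adjoint :: "('o, 'a, 'p, 'b, 'v) prof \<Rightarrow> bool" where
  "has_right_adjoint F \<longleftrightarrow> (\<exists>(G :: ('p, 'b, 'o, 'a, 'v) prof) u e. adjunction F G u e)"

text \<open>The axioms below compare two 2-cells out of \<open>(\<mu> \<odot> (\<mu> \<otimes> 1)) \<odot> ((\<mu> \<otimes> 1) \<otimes> 1)\<close>.\<close>

definition pentagon_2 where
  "pentagon_2 A \<mu> \<alpha> =
     ((idc \<mu> \<star> tens_comp_l A \<mu> (pid A \<otimes> \<mu>)) \<bullet>
      passoc \<mu> (pid A \<otimes> \<mu>) (pid A \<otimes> (pid A \<otimes> \<mu>)))
       \<lhd> fassoc A A (A \<times>\<^sub>c A) \<lhd> fassoc (A \<times>\<^sub>c A) A A \<bullet>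
     (assoc_natural (\<mu> \<odot> (pid A \<otimes> \<mu>)) (pid A) (pid A) \<mu> \<bullet>
      (\<alpha> \<star> idc ((pid A \<otimes> pid A) \<otimes> \<mu>)) \<bullet>
      cinv (passoc \<mu> (\<mu> \<otimes> pid A) ((pid A \<otimes> pid A) \<otimes> \<mu>)) \<bullet>
      (idc \<mu> \<star> exchange \<mu> \<mu>) \<bullet>
      passoc \<mu> (pid A \<otimes> \<mu>) (\<mu> \<otimes> (pid A \<otimes> pid A)))
       \<lhd> fassoc (A \<times>\<^sub>c A) A A \<bullet>
     assoc_natural (\<mu> \<odot> (pid A \<otimes> \<mu>)) \<mu> (pid A) (pid A) \<bullet>
     (\<alpha> \<star> idc ((\<mu> \<otimes> pid A) \<otimes> pid A))"

definition pentagon_3 where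
  "pentagon_3 A \<mu> \<alpha> =
     ((idc \<mu> \<star> (idc (pid A) \<boxtimes> \<alpha>)) \<bullet>
      (idc \<mu> \<star> tens_comp_l A \<mu> (\<mu> \<otimes> pid A)) \<bullet>
      passoc \<mu> (pid A \<otimes> \<mu>) (pid A \<otimes> (\<mu> \<otimes> pid A)))
       \<lhd> fassoc A (A \<times>\<^sub>c A) A \<lhd> (fassoc A A A \<times>\<^sub>f fid A) \<bullet>
     (assoc_natural (\<mu> \<odot> (pid A \<otimes> \<mu>)) (pid A) \<mu> (pid A) \<bullet>
      (\<alpha> \<star> idc ((pid A \<otimes> \<mu>) \<otimes> pid A)) \<bullet>
      cinv (passoc \<mu> (\<mu> \<otimes> pid A) ((pid A \<otimes> \<mu>) \<otimes> pid A)) \<bullet>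
      (idc \<mu> \<star> cinv (tens_comp_r A \<mu> (pid A \<otimes> \<mu>))))
       \<lhd> (fassoc A A A \<times>\<^sub>f fid A) \<bullet>
     (idc \<mu> \<star> (\<alpha> \<boxtimes> idc (pid A))) \<bullet>
     (idc \<mu> \<star> tens_comp_r A \<mu> (\<mu> \<otimes> pid A)) \<bullet>
     passoc \<mu> (\<mu> \<otimes> pid A) ((\<mu> \<otimes> pid A) \<otimes> pid A)"

text \<open>The two sides of the triangle axiom, out of \<open>(\<mu> \<odot> (\<mu> \<otimes> 1)) \<odot> ((1 \<otimes> \<eta>) \<otimes> 1)\<close>.\<close>

definition triangle_2 where
  "triangle_2 A \<mu> \<eta> \<alpha> l =
     prunit \<mu> \<lhd> (fid A \<times>\<^sub>f flunit A) \<lhd> fassoc A unit_cat A \<bullet>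
     ((idc \<mu> \<star> (idc (pid A) \<boxtimes> l)) \<bullet>
      (idc \<mu> \<star> tens_comp_l A \<mu> (\<eta> \<otimes> pid A)) \<bullet>
      passoc \<mu> (pid A \<otimes> \<mu>) (pid A \<otimes> (\<eta> \<otimes> pid A)))
       \<lhd> fassoc A unit_cat A \<bullet>
     assoc_natural (\<mu> \<odot> (pid A \<otimes> \<mu>)) (pid A) \<eta> (pid A) \<bullet>
     (\<alpha> \<star> idc ((pid A \<otimes> \<eta>) \<otimes> pid A))"

definition triangle_1 where
  "triangle_1 A \<mu> \<eta> r =
     prunit \<mu> \<lhd> (frunit A \<times>\<^sub>f fid A) \<bullet>
     (idc \<mu> \<star> (r \<boxtimes> idc (pid A))) \<bullet>
     (idc \<mu> \<star> tens_comp_r A \<mu> (pid A \<otimes> \<eta>)) \<bullet>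
     passoc \<mu> (\<mu> \<otimes> pid A) ((pid A \<otimes> \<eta>) \<otimes> pid A)"

definition pseudomonoid where
  "pseudomonoid A \<mu> \<eta> \<alpha> l r \<longleftrightarrow>
     category A \<and> profunctor (A \<times>\<^sub>c A) A \<mu> \<and> profunctor unit_cat A \<eta> \<and>
     invertible_cell (\<mu> \<odot> (\<mu> \<otimes> pid A)) ((\<mu> \<odot> (pid A \<otimes> \<mu>)) \<triangleleft> fassoc A A A) \<alpha> \<and>
     invertible_cell (\<mu> \<odot> (\<eta> \<otimes> pid A)) (pid A \<triangleleft> flunit A) l \<and>
     invertible_cell (\<mu> \<odot> (pid A \<otimes> \<eta>)) (pid A \<triangleleft> frunit A) r \<and>
     pentagon_2 A \<mu> \<alpha> \<doteq> pentagon_3 A \<mu> \<alpha> \<and>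
     triangle_2 A \<mu> \<eta> \<alpha> l \<doteq> triangle_1 A \<mu> \<eta> r"

text \<open>
  \<open>X \<stileturn> Y\<close> with evaluation \<open>\<epsilon> : X \<otimes> Y \<rightarrow> 1\<close> and coevaluation \<open>\<kappa> : 1 \<rightarrow> Y \<otimes> X\<close>. The snake composites
  are 1-cells \<open>1 \<otimes> Y \<rightarrow> Y \<otimes> 1\<close> and \<open>X \<otimes> 1 \<rightarrow> 1 \<otimes> X\<close>, so identities are transported accordingly.
\<close>

definition biexact_pairing where
  "biexact_pairing X Y \<epsilon> \<kappa> \<longleftrightarrow>
     category X \<and> category Y \<and>
     profunctor (X \<times>\<^sub>c Y) unit_cat \<epsilon> \<and> profunctor unit_cat (Y \<times>\<^sub>c X) \<kappa> \<and>
     (\<exists>\<zeta>. invertible_cell (((pid Y \<otimes> \<epsilon>) \<triangleleft> fassoc Y X Y) \<odot> (\<kappa> \<otimes> pid Y))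
        (frunit Y \<triangleright> pid Y \<triangleleft> flunit Y) \<zeta>) \<and>
     (\<exists>\<zeta>. invertible_cell (flunit X \<triangleright> pid X \<triangleleft> frunit X)
        (((\<epsilon> \<otimes> pid X) \<triangleleft> fassoc_inv X Y X) \<odot> (pid X \<otimes> \<kappa>)) \<zeta>)"

definition frobenius_form where
  "frobenius_form A \<mu> (\<sigma> :: ('o \<times> 'o, 'a \<times> 'a, unit, unit, 'v) prof) \<longleftrightarrow>
     (\<exists>\<kappa> :: (unit, unit, 'o \<times> 'o, 'a \<times> 'a, 'v) prof. biexact_pairing A A \<sigma> \<kappa>) \<and>
     (\<exists>\<theta>. invertible_cell (\<sigma> \<odot> (\<mu> \<otimes> pid A)) ((\<sigma> \<odot> (pid A \<otimes> \<mu>)) \<triangleleft> fassoc A A A) \<theta>)"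

definition frobenius_pseudomonoid where
  "frobenius_pseudomonoid A (\<mu> :: ('o \<times> 'o, 'a \<times> 'a, 'o, 'a, 'v) prof) \<eta> \<alpha> l r \<longleftrightarrow>
     pseudomonoid A \<mu> \<eta> \<alpha> l r \<and>
     (\<exists>\<sigma> :: ('o \<times> 'o, 'a \<times> 'a, unit, unit, 'v) prof. frobenius_form A \<mu> \<sigma>)"

definition dagger_frobenius_pseudomonoid where
  "dagger_frobenius_pseudomonoid A \<mu> \<eta> \<alpha> l r \<longleftrightarrow>
     frobenius_pseudomonoid A \<mu> \<eta> \<alpha> l r \<and> has_right_adjoint \<mu> \<and> has_right_adjoint \<eta>"


section \<open>The pseudomonoid induced by a monoidal category\<close>

text \<open>
  The image of a monoidal category under \<open>F \<mapsto> rep F\<close>: multiplication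
  \<open>(c, (a, b)) \<mapsto> Hom c (a \<otimes> b)\<close> and unit \<open>c \<mapsto> Hom c I\<close>. An element of \<open>\<mu> \<odot> (\<mu> \<otimes> 1)\<close> at
  \<open>(d, ((a, b), c))\<close> is represented by \<open>p : x \<rightarrow> a \<otimes> b\<close>, \<open>k : y \<rightarrow> c\<close>, \<open>q : d \<rightarrow> x \<otimes> y\<close>, and corresponds
  by the Yoneda lemma to \<open>(p \<otimes> k) \<circ> q : d \<rightarrow> (a \<otimes> b) \<otimes> c\<close>; the 2-cells below are postcomposition with
  the constraints of the monoidal category under this correspondence.

  Since profunctors \<open>A \<nrightarrow> B\<close> are functors on \<open>B\<^sup>o\<^sup>p \<times> A\<close>, a Frobenius form is covariant in both arguments,
  while the pairing \<open>(x, y) \<mapsto> Hom x (D y)\<close> of a \<open>\<star>\<close>-autonomous category \<open>C\<close> is contravariant in both. So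
  the Frobenius pseudomonoid of \<open>C\<close> is the one induced by the monoidal category \<open>mon_op C\<close>, with
  underlying object \<open>C\<^sup>o\<^sup>p\<close> and multiplication \<open>(c, (a, b)) \<mapsto> Hom\<^sub>C (a \<otimes> b) c\<close>.
\<close>

definition ind_mult :: "('o, 'a) moncat \<Rightarrow> ('o \<times> 'o, 'a \<times> 'a, 'o, 'a, 'a) prof" where
  "ind_mult M = rep (ten M)"

definition ind_unit :: "('o, 'a) moncat \<Rightarrow> (unit, unit, 'o, 'a, 'a) prof" where
  "ind_unit M = rep (fpoint (ucat M) (unt M))"

definition ind_assoc where
  "ind_assoc M = (let C = ucat M; \<mu> = ind_mult M in
     \<lparr>csrc = \<mu> \<odot> (\<mu> \<otimes> pid C), ctgt = (\<mu> \<odot> (pid C \<otimes> \<mu>)) \<triangleleft> fassoc C C C,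
      cmpt = (\<lambda>(d, ((a, b), c)). on_class (\<lambda>((x, y), ((p, k), q)).
        pcls \<mu> (pid C \<otimes> \<mu>) (d, (a, (b, c)))
          ((a, tensO M b c), ((Idn C a, Idn C (tensO M b c)),
           Cmp C (asc M a b c) (Cmp C (tensA M p k) q)))))\<rparr>)"

definition ind_lunit where
  "ind_lunit M = (let C = ucat M; \<mu> = ind_mult M in
     \<lparr>csrc = \<mu> \<odot> (ind_unit M \<otimes> pid C), ctgt = pid C \<triangleleft> flunit C,
      cmpt = (\<lambda>(d, (_, a)). on_class (\<lambda>((x, y), ((p, k), q)).
        Cmp C (lun M a) (Cmp C (tensA M p k) q)))\<rparr>)"

definition ind_runit where
  "ind_runit M = (let C = ucat M; \<mu> = ind_mult M in
     \<lparr>csrc = \<mu> \<odot> (pid C \<otimes> ind_unit M), ctgt = pid C \<triangleleft> frunit C,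
      cmpt = (\<lambda>(d, (a, _)). on_class (\<lambda>((x, y), ((k, p), q)).
        Cmp C (run M a) (Cmp C (tensA M k p) q)))\<rparr>)"

end

(*
A profunctor represented by a functor F has elements Hom y (F x). Composites, tensor products and
substitutions of represented profunctors are represented, and a 2-cell between represented
profunctors is the same thing as a natural transformation of the representing functors. Under this
correspondence all structural 2-cells become identities and the cells of the induced pseudomonoid
become the constraints of the monoidal category, so that the pentagon and triangle axioms for
pseudomonoids reduce to those of the monoidal category. The multiplication and unit, being
represented, have the corepresented profunctors as right adjoints.

Writing A for the opposite of the star-autonomous category C, the Frobenius form is Hom_C x (D y),
and the coevaluation is Hom_C (D y) x. The snake isomorphisms follow from the equivalence D being
fully faithful and essentially surjective. By the co-Yoneda lemma the two sides of the Frobenius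
isomorphism are Hom_C (x * y) (D z) and Hom_C x (D (y * z)).
*)
theory Submission
  imports Defs
begin

section \<open>Categories and functors\<close>

text \<open>Two regimes coexist. In the pentagon and triangle all cells lie between represented
  profunctors, so they are compared through the arrows that elements stand for. Elements of an
  iterated composite are classes containing classes, and computing with representatives there would
  mean proving well-definedness anew at every stage. The corepresented profunctors and the two
  duality forms are in general not represented, so the adjunctions, the snakes and the co-Yoneda
  isomorphism are treated on representatives. Two rules suffice for this: an arrow may slide from
  one entry of a pair to the other (\<open>pcls_gen\<close>), and a map that respects sliding is
  computed on any representative (\<open>on_class_pcls\<close>). A further obstacle is that inverse
  cells in the axioms are given pointwise by \<open>inv_into\<close>. They can be evaluated only
  once injectivity is known, which comes from the bijection with hom sets in the first regime and is
  proved by hand in the second.\<close>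

lemma hom_iff: "f \<in> hom C x y \<longleftrightarrow> f \<in> Arr C \<and> Dom C f = x \<and> Cod C f = y"
  by (simp add: hom_def)

lemma Dom_Obj [simp]: "category C \<Longrightarrow> f \<in> Arr C \<Longrightarrow> Dom C f \<in> Obj C"
  and Cod_Obj [simp]: "category C \<Longrightarrow> f \<in> Arr C \<Longrightarrow> Cod C f \<in> Obj C"
  and Idn_Arr [simp]: "category C \<Longrightarrow> x \<in> Obj C \<Longrightarrow> Idn C x \<in> Arr C"
  and Dom_Idn [simp]: "category C \<Longrightarrow> x \<in> Obj C \<Longrightarrow> Dom C (Idn C x) = x"
  and Cod_Idn [simp]: "category C \<Longrightarrow> x \<in> Obj C \<Longrightarrow> Cod C (Idn C x) = x"
  and Cmp_Arr [simp]: "category C \<Longrightarrow> f \<in> Arr C \<Longrightarrow> g \<in> Arr C \<Longrightarrow> Dom C g = Cod C f \<Longrightarrow>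
    Cmp C g f \<in> Arr C"
  and Dom_Cmp [simp]: "category C \<Longrightarrow> f \<in> Arr C \<Longrightarrow> g \<in> Arr C \<Longrightarrow> Dom C g = Cod C f \<Longrightarrow>
    Dom C (Cmp C g f) = Dom C f"
  and Cod_Cmp [simp]: "category C \<Longrightarrow> f \<in> Arr C \<Longrightarrow> g \<in> Arr C \<Longrightarrow> Dom C g = Cod C f \<Longrightarrow>
    Cod C (Cmp C g f) = Cod C g"
  and Cmp_Idn_right [simp]: "category C \<Longrightarrow> f \<in> Arr C \<Longrightarrow> Dom C f = x \<Longrightarrow> Cmp C f (Idn C x) = f"
  and Cmp_Idn_left [simp]: "category C \<Longrightarrow> f \<in> Arr C \<Longrightarrow> Cod C f = x \<Longrightarrow> Cmp C (Idn C x) f = f"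
  and Cmp_assoc: "category C \<Longrightarrow> f \<in> Arr C \<Longrightarrow> g \<in> Arr C \<Longrightarrow> h \<in> Arr C \<Longrightarrow>
    Dom C g = Cod C f \<Longrightarrow> Dom C h = Cod C g \<Longrightarrow> Cmp C (Cmp C h g) f = Cmp C h (Cmp C g f)"
  by (auto simp: category_def hom_def)

lemma Idn_hom: "category C \<Longrightarrow> x \<in> Obj C \<Longrightarrow> Idn C x \<in> hom C x x"
  by (simp add: hom_iff)

lemma inverse_arrows_unique:
  assumes C: "category C" and g: "inverse_arrows C f g" and g': "inverse_arrows C f g'"
  shows "g = g'"
proof -
  have "g = Cmp C (Cmp C g' f) g" using g g' C by (auto simp: inverse_arrows_def hom_iff)
  also have "\<dots> = Cmp C g' (Cmp C f g)"
    by (rule Cmp_assoc) (use g g' C in \<open>auto simp: inverse_arrows_def hom_iff\<close>)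
  also have "\<dots> = g'" using g g' C by (auto simp: inverse_arrows_def hom_iff)
  finally show ?thesis .
qed

lemma inv_arrow_inverse:
  assumes "category C" "iso_arrow C f"
  shows "inverse_arrows C f (inv_arrow C f)"
  unfolding inv_arrow_def using assms inverse_arrows_unique[OF assms(1)]
  by (auto simp: iso_arrow_def intro: theI)

lemma inv_arrowD:
  assumes "category C" "iso_arrow C f"
  shows "f \<in> Arr C" "inv_arrow C f \<in> Arr C" "Dom C (inv_arrow C f) = Cod C f"
    "Cod C (inv_arrow C f) = Dom C f" "Cmp C (inv_arrow C f) f = Idn C (Dom C f)"
    "Cmp C f (inv_arrow C f) = Idn C (Cod C f)"
  using inv_arrow_inverse[OF assms] by (auto simp: inverse_arrows_def hom_iff)

lemma op_cat_simps [simp]: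
  "Obj (op_cat C) = Obj C" "Arr (op_cat C) = Arr C" "Dom (op_cat C) = Cod C"
  "Cod (op_cat C) = Dom C" "Idn (op_cat C) = Idn C" "Cmp (op_cat C) g f = Cmp C f g"
  by (simp_all add: op_cat_def)

lemma hom_op_cat [simp]: "hom (op_cat C) x y = hom C y x"
  by (auto simp: hom_def)

lemma prod_cat_simps [simp]:
  "Obj (C \<times>\<^sub>c D) = Obj C \<times> Obj D" "Arr (C \<times>\<^sub>c D) = Arr C \<times> Arr D"
  "Dom (C \<times>\<^sub>c D) (f, f') = (Dom C f, Dom D f')"
  "Cod (C \<times>\<^sub>c D) (f, f') = (Cod C f, Cod D f')"
  "Idn (C \<times>\<^sub>c D) (x, x') = (Idn C x, Idn D x')"
  "Cmp (C \<times>\<^sub>c D) (g, g') (f, f') = (Cmp C g f, Cmp D g' f')"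
  by (simp_all add: prod_cat_def)

lemma hom_prod_cat [simp]: "hom (C \<times>\<^sub>c D) (x, x') (y, y') = hom C x y \<times> hom D x' y'"
  by (auto simp: hom_def)

lemma unit_cat_simps [simp]:
  "Obj unit_cat = UNIV" "Arr unit_cat = UNIV" "Dom unit_cat f = ()" "Cod unit_cat f = ()"
  "Idn unit_cat x = ()" "Cmp unit_cat g f = ()"
  by (simp_all add: unit_cat_def)

lemma hom_unit_cat [simp]: "hom unit_cat x y = UNIV"
  by (auto simp: hom_def)

lemma category_unit_cat [simp]: "category unit_cat"
  by (simp add: category_def)

lemma category_op_cat [simp]: "category C \<Longrightarrow> category (op_cat C)"
  unfolding category_def by (auto simp: hom_iff)

lemma category_prod_cat [simp]: "category C \<Longrightarrow> category D \<Longrightarrow> category (C \<times>\<^sub>c D)"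
  unfolding category_def by (auto simp: hom_iff)

lemma inverse_arrows_op: "inverse_arrows (op_cat C) f g \<longleftrightarrow> inverse_arrows C f g"
  by (auto simp: inverse_arrows_def hom_iff)

lemma iso_arrow_op [simp]: "iso_arrow (op_cat C) f \<longleftrightarrow> iso_arrow C f"
  by (simp add: iso_arrow_def inverse_arrows_op)

lemma iso_arrow_inv:
  assumes "category C" "iso_arrow C f"
  shows "iso_arrow C (inv_arrow C f)"
  using inv_arrow_inverse[OF assms] unfolding iso_arrow_def
  by (intro exI[of _ f]) (auto simp: inverse_arrows_def hom_iff)

lemma inverse_arrows_Cmp:
  assumes C: "category C" and f: "inverse_arrows C f f'" and g: "inverse_arrows C g g'" and "Dom C g = Cod C f"
  shows "inverse_arrows C (Cmp C g f) (Cmp C f' g')"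
proof -
  have fg: "f \<in> Arr C" "f' \<in> Arr C" "Dom C f' = Cod C f" "Cod C f' = Dom C f"
    "g \<in> Arr C" "g' \<in> Arr C" "Dom C g' = Cod C g" "Cod C g' = Dom C g"
    and inv: "Cmp C f' f = Idn C (Dom C f)" "Cmp C f f' = Idn C (Cod C f)"
    "Cmp C g' g = Idn C (Dom C g)" "Cmp C g g' = Idn C (Cod C g)"
    using assms by (auto simp: inverse_arrows_def hom_iff)
  have "Cmp C (Cmp C f' g') (Cmp C g f) = Cmp C f' (Cmp C (Cmp C g' g) f)"
    "Cmp C (Cmp C g f) (Cmp C f' g') = Cmp C g (Cmp C (Cmp C f f') g')"
    using C fg assms(4) by (simp_all add: Cmp_assoc)
  then show ?thesis
    using C fg inv assms(4) by (simp add: inverse_arrows_def hom_iff)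
qed

text \<open>Conjugating a commutative square by inverses. In the opposite category the constraints
  become inverse arrows, and this supplies their naturality.\<close>

lemma inv_arrow_natural:
  assumes C: "category C" and a: "iso_arrow C a" "iso_arrow C a'"
    and f: "f \<in> Arr C" "g \<in> Arr C" "Dom C f = Dom C a" "Cod C f = Dom C a'" "Dom C g = Cod C a" "Cod C g = Cod C a'"
    and eq: "Cmp C a' f = Cmp C g a"
  shows "Cmp C f (inv_arrow C a) = Cmp C (inv_arrow C a') g"
proof -
  note i = inv_arrowD[OF C a(1)] and i' = inv_arrowD[OF C a(2)]
  note [simp] = i(1-4) i'(1-4) C f
  have "Cmp C f (inv_arrow C a) = Cmp C (Cmp C (inv_arrow C a') a') (Cmp C f (inv_arrow C a))"
    by (simp add: i'(5))
  also have "\<dots> = Cmp C (inv_arrow C a') (Cmp C (Cmp C a' f) (inv_arrow C a))"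
    by (simp add: Cmp_assoc)
  also have "\<dots> = Cmp C (inv_arrow C a') (Cmp C g (Cmp C a (inv_arrow C a)))"
    unfolding eq by (simp add: Cmp_assoc)
  finally show ?thesis by (simp add: i(6))
qed

lemma is_functorD:
  assumes "is_functor C D F"
  shows "category C" "category D" "fdom F = C" "fcod F = D"
    "x \<in> Obj C \<Longrightarrow> fo F x \<in> Obj D"
    "f \<in> Arr C \<Longrightarrow> fa F f \<in> Arr D"
    "f \<in> Arr C \<Longrightarrow> Dom D (fa F f) = fo F (Dom C f)"
    "f \<in> Arr C \<Longrightarrow> Cod D (fa F f) = fo F (Cod C f)"
    "x \<in> Obj C \<Longrightarrow> fa F (Idn C x) = Idn D (fo F x)"
    "f \<in> Arr C \<Longrightarrow> g \<in> Arr C \<Longrightarrow> Dom C g = Cod C f \<Longrightarrow>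
      fa F (Cmp C g f) = Cmp D (fa F g) (fa F f)"
  using assms by (auto simp: is_functor_def hom_iff)

lemma functr_simps [simp]:
  "fdom (fid C) = C" "fcod (fid C) = C" "fo (fid C) x = x" "fa (fid C) f = f"
  "fdom (G \<circ>\<^sub>f F) = fdom F" "fcod (G \<circ>\<^sub>f F) = fcod G"
  "fo (G \<circ>\<^sub>f F) x = fo G (fo F x)" "fa (G \<circ>\<^sub>f F) f = fa G (fa F f)"
  "fdom (F \<times>\<^sub>f F') = fdom F \<times>\<^sub>c fdom F'" "fcod (F \<times>\<^sub>f F') = fcod F \<times>\<^sub>c fcod F'"
  "fo (F \<times>\<^sub>f F') (x, x') = (fo F x, fo F' x')" "fa (F \<times>\<^sub>f F') (f, f') = (fa F f, fa F' f')"
  "fdom (fpoint C z) = unit_cat" "fcod (fpoint C z) = C"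
  "fo (fpoint C z) p = z" "fa (fpoint C z) q = Idn C z"
  by (simp_all add: fid_def fcomp_def fprod_def fpoint_def)

lemma fassoc_simps [simp]:
  "fdom (fassoc A B C) = (A \<times>\<^sub>c B) \<times>\<^sub>c C" "fcod (fassoc A B C) = A \<times>\<^sub>c (B \<times>\<^sub>c C)"
  "fo (fassoc A B C) ((x, y), z) = (x, (y, z))" "fa (fassoc A B C) ((f, g), h) = (f, (g, h))"
  "fdom (fassoc_inv A B C) = A \<times>\<^sub>c (B \<times>\<^sub>c C)" "fcod (fassoc_inv A B C) = (A \<times>\<^sub>c B) \<times>\<^sub>c C"
  "fo (fassoc_inv A B C) (x, (y, z)) = ((x, y), z)"
  "fa (fassoc_inv A B C) (f, (g, h)) = ((f, g), h)"
  "fdom (flunit A) = unit_cat \<times>\<^sub>c A" "fcod (flunit A) = A"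
  "fo (flunit A) (t, x) = x" "fa (flunit A) (t', f) = f"
  "fdom (frunit A) = A \<times>\<^sub>c unit_cat" "fcod (frunit A) = A"
  "fo (frunit A) (x, t) = x" "fa (frunit A) (f, t') = f"
  by (simp_all add: fassoc_def fassoc_inv_def flunit_def frunit_def)

lemma is_functor_fid [simp]: "category C \<Longrightarrow> is_functor C C (fid C)"
  by (simp add: is_functor_def hom_iff)

lemma is_functor_fcomp:
  "is_functor C D F \<Longrightarrow> is_functor D E G \<Longrightarrow> is_functor C E (G \<circ>\<^sub>f F)"
  by (auto simp: is_functor_def hom_iff)

lemma is_functor_fprod:
  "is_functor C D F \<Longrightarrow> is_functor C' D' F' \<Longrightarrow> is_functor (C \<times>\<^sub>c C') (D \<times>\<^sub>c D') (F \<times>\<^sub>f F')"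
  by (auto simp: is_functor_def hom_iff)

lemma is_functor_fpoint [simp]: "category C \<Longrightarrow> z \<in> Obj C \<Longrightarrow> is_functor unit_cat C (fpoint C z)"
  by (simp add: is_functor_def hom_iff)

lemma is_functor_canonical [simp]:
  "category A \<Longrightarrow> category B \<Longrightarrow> category C \<Longrightarrow>
    is_functor ((A \<times>\<^sub>c B) \<times>\<^sub>c C) (A \<times>\<^sub>c (B \<times>\<^sub>c C)) (fassoc A B C)"
  "category A \<Longrightarrow> category B \<Longrightarrow> category C \<Longrightarrow>
    is_functor (A \<times>\<^sub>c (B \<times>\<^sub>c C)) ((A \<times>\<^sub>c B) \<times>\<^sub>c C) (fassoc_inv A B C)"
  "category A \<Longrightarrow> is_functor (unit_cat \<times>\<^sub>c A) A (flunit A)"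
  "category A \<Longrightarrow> is_functor (A \<times>\<^sub>c unit_cat) A (frunit A)"
  by (auto simp: is_functor_def hom_iff)

section \<open>Equivalences of categories\<close>

lemma nat_iso_faithful:
  assumes \<theta>: "nat_iso C C (G \<circ>\<^sub>f F) (fid C) \<theta>" and f: "f \<in> hom C x y" "g \<in> hom C x y" "fa F f = fa F g"
  shows "f = g"
proof -
  have C: "category C" using \<theta> by (simp add: nat_iso_def is_functor_def)
  have x: "x \<in> Obj C" using C f by (auto simp: hom_iff)
  have "\<theta> x \<in> hom C (fo G (fo F x)) x" "iso_arrow C (\<theta> x)"
    and nat: "\<And>f. f \<in> Arr C \<Longrightarrow> Cmp C (\<theta> (Cod C f)) (fa G (fa F f)) = Cmp C f (\<theta> (Dom C f))"
    using \<theta> x by (auto simp: nat_iso_def)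
  then obtain i where i: "\<theta> x \<in> Arr C" "Cod C (\<theta> x) = x" "i \<in> Arr C" "Dom C i = x" "Cod C i = Dom C (\<theta> x)"
    "Cmp C (\<theta> x) i = Idn C x"
    by (auto simp: iso_arrow_def inverse_arrows_def hom_iff)
  \<comment> \<open>Naturality turns equality after \<open>F\<close> into equality after
    precomposition with the isomorphism \<theta> x, which \<open>i\<close> then cancels.\<close>
  have "Cmp C f (\<theta> x) = Cmp C g (\<theta> x)"
    using nat[of f] nat[of g] f by (auto simp: hom_iff)
  then have "Cmp C (Cmp C f (\<theta> x)) i = Cmp C (Cmp C g (\<theta> x)) i" by simp
  then show ?thesis using i f C by (simp add: hom_iff Cmp_assoc)
qed

lemma equivalence_fully_faithful:
  assumes "equivalence C D F" and xy: "x \<in> Obj C" "y \<in> Obj C"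
  shows "bij_betw (fa F) (hom C x y) (hom D (fo F x) (fo F y))"
proof -
  obtain G \<theta> \<zeta> where F: "is_functor C D F" and G: "is_functor D C G"
    and \<theta>: "nat_iso C C (G \<circ>\<^sub>f F) (fid C) \<theta>" and \<zeta>: "nat_iso D D (F \<circ>\<^sub>f G) (fid D) \<zeta>"
    using assms(1) by (auto simp: equivalence_def)
  note [simp] = is_functorD[OF F] is_functorD[OF G]
  have iso: "\<theta> z \<in> Arr C" "Dom C (\<theta> z) = fo G (fo F z)" "Cod C (\<theta> z) = z" "iso_arrow C (\<theta> z)"
    if "z \<in> Obj C" for z
    using \<theta> that by (auto simp: nat_iso_def hom_iff)
  have nat: "Cmp C (\<theta> (Cod C f)) (fa G (fa F f)) = Cmp C f (\<theta> (Dom C f))" if "f \<in> Arr C" for f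
    using \<theta> that by (auto simp: nat_iso_def)
  note ix = inv_arrowD[OF is_functorD(1)[OF F] iso(4)[OF xy(1)]]
    and iy = inv_arrowD[OF is_functorD(1)[OF F] iso(4)[OF xy(2)]]
  have full: "w \<in> fa F ` hom C x y" if w: "w \<in> hom D (fo F x) (fo F y)" for w
  proof -
    \<comment> \<open>The preimage is \<open>w\<close> transported along the isomorphisms \<theta>.
      Naturality shows that \<open>G\<close> takes the same value at \<open>F ?f\<close> and at
      \<open>w\<close>; then \<open>G\<close> is faithful, by the other isomorphism \<zeta>.\<close>
    let ?f = "Cmp C (\<theta> y) (Cmp C (fa G w) (inv_arrow C (\<theta> x)))"
    have W: "w \<in> Arr D" "Dom D w = fo F x" "Cod D w = fo F y" using w by (auto simp: hom_iff)
    have f: "?f \<in> hom C x y" using W ix xy iso by (simp add: hom_iff)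
    have "Cmp C (\<theta> y) (fa G (fa F ?f)) = Cmp C ?f (\<theta> x)"
      using nat[of ?f] f by (simp add: hom_iff)
    also have "\<dots> = Cmp C (\<theta> y) (fa G w)"
      using W ix xy iso by (simp add: Cmp_assoc)
    finally have "Cmp C (inv_arrow C (\<theta> y)) (Cmp C (\<theta> y) (fa G (fa F ?f))) =
        Cmp C (inv_arrow C (\<theta> y)) (Cmp C (\<theta> y) (fa G w))" by simp
    moreover have "Cmp C (inv_arrow C (\<theta> y)) (Cmp C (\<theta> y) v) = v"
      if "v \<in> hom C (fo G (fo F x)) (fo G (fo F y))" for v
      using that iy iso xy by (simp add: hom_iff flip: Cmp_assoc)
    moreover have "fa G (fa F ?f) \<in> hom C (fo G (fo F x)) (fo G (fo F y))"
      "fa G w \<in> hom C (fo G (fo F x)) (fo G (fo F y))"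
      using f W xy by (auto simp: hom_iff)
    ultimately have "fa G (fa F ?f) = fa G w" by metis
    moreover have "fa F ?f \<in> hom D (fo F x) (fo F y)" using f by (auto simp: hom_iff)
    ultimately have "fa F ?f = w" using nat_iso_faithful[OF \<zeta>] w by blast
    then show ?thesis using f by (metis imageI)
  qed
  show ?thesis
    by (rule bij_betw_imageI)
      (use nat_iso_faithful[OF \<theta>] full in \<open>auto intro!: inj_onI simp: hom_iff\<close>)
qed

lemma equivalence_essentially_surjective:
  assumes "equivalence C D F" "z \<in> Obj D"
  obtains x f g where "x \<in> Obj C" "f \<in> hom D (fo F x) z" "g \<in> hom D z (fo F x)"
    "Cmp D g f = Idn D (fo F x)" "Cmp D f g = Idn D z"
proof -
  obtain G \<zeta> where G: "is_functor D C G" and \<zeta>: "nat_iso D D (F \<circ>\<^sub>f G) (fid D) \<zeta>"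
    using assms(1) by (auto simp: equivalence_def)
  then have "\<zeta> z \<in> hom D (fo F (fo G z)) z" "iso_arrow D (\<zeta> z)"
    using assms(2) by (auto simp: nat_iso_def)
  then obtain g where "inverse_arrows D (\<zeta> z) g" by (auto simp: iso_arrow_def)
  with \<open>\<zeta> z \<in> hom D (fo F (fo G z)) z\<close> that[of "fo G z" "\<zeta> z" g] show ?thesis
    using is_functorD(5)[OF G] assms(2) by (auto simp: inverse_arrows_def hom_iff)
qed

section \<open>Profunctors and coends\<close>

text \<open>The endpoints are variables tied by equations, so that simplification can apply the
  rules even where a domain or codomain has already been rewritten.\<close>

lemma profunctorD:
  assumes "profunctor A B F"
  shows "category A" "category B" "psrc F = A" "ptgt F = B"
    "\<And>h f u y x y' x'. h \<in> Arr B \<Longrightarrow> f \<in> Arr A \<Longrightarrow> u \<in> El F (y, x) \<Longrightarrow> Cod B h = y \<Longrightarrow> Dom A f = x \<Longrightarrow>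
      Dom B h = y' \<Longrightarrow> Cod A f = x' \<Longrightarrow> Act F (h, f) u \<in> El F (y', x')"
    "\<And>y x u. y \<in> Obj B \<Longrightarrow> x \<in> Obj A \<Longrightarrow> u \<in> El F (y, x) \<Longrightarrow> Act F (Idn B y, Idn A x) u = u"
    "\<And>h h' f f' u y x. h \<in> Arr B \<Longrightarrow> h' \<in> Arr B \<Longrightarrow> f \<in> Arr A \<Longrightarrow> f' \<in> Arr A \<Longrightarrow>
      Cod B h' = Dom B h \<Longrightarrow> Dom A f' = Cod A f \<Longrightarrow> u \<in> El F (y, x) \<Longrightarrow> Cod B h = y \<Longrightarrow> Dom A f = x \<Longrightarrow>
      Act F (h', f') (Act F (h, f) u) = Act F (Cmp B h h', Cmp A f' f) u"
proof -
  have F: "category A" "category B" "psrc F = A" "ptgt F = B"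
    and sf: "set_functor (op_cat B \<times>\<^sub>c A) (El F) (Act F)"
    using assms by (simp_all add: profunctor_def)
  show "category A" "category B" "psrc F = A" "ptgt F = B" by (fact F)+
  show "Act F (h, f) u \<in> El F (y', x')" if "h \<in> Arr B" "f \<in> Arr A" "u \<in> El F (y, x)" "Cod B h = y"
      "Dom A f = x" "Dom B h = y'" "Cod A f = x'" for h f u y x y' x'
    using sf that by (auto simp: set_functor_def)
  show "Act F (Idn B y, Idn A x) u = u" if "y \<in> Obj B" "x \<in> Obj A" "u \<in> El F (y, x)" for y x u
    using sf that by (auto simp: set_functor_def)
  show "Act F (h', f') (Act F (h, f) u) = Act F (Cmp B h h', Cmp A f' f) u"
    if "h \<in> Arr B" "h' \<in> Arr B" "f \<in> Arr A" "f' \<in> Arr A" "Cod B h' = Dom B h" "Dom A f' = Cod A f"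
      "u \<in> El F (y, x)" "Cod B h = y" "Dom A f = x" for h h' f f' u y x
    using sf that by (auto simp: set_functor_def)
qed

lemma profunctorI:
  assumes "category A" "category B" "psrc F = A" "ptgt F = B"
    "\<And>h f u. h \<in> Arr B \<Longrightarrow> f \<in> Arr A \<Longrightarrow> u \<in> El F (Cod B h, Dom A f) \<Longrightarrow>
      Act F (h, f) u \<in> El F (Dom B h, Cod A f)"
    "\<And>y x u. y \<in> Obj B \<Longrightarrow> x \<in> Obj A \<Longrightarrow> u \<in> El F (y, x) \<Longrightarrow> Act F (Idn B y, Idn A x) u = u"
    "\<And>h h' f f' u. h \<in> Arr B \<Longrightarrow> h' \<in> Arr B \<Longrightarrow> f \<in> Arr A \<Longrightarrow> f' \<in> Arr A \<Longrightarrow>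
      Cod B h' = Dom B h \<Longrightarrow> Dom A f' = Cod A f \<Longrightarrow> u \<in> El F (Cod B h, Dom A f) \<Longrightarrow>
      Act F (Cmp B h h', Cmp A f' f) u = Act F (h', f') (Act F (h, f) u)"
  shows "profunctor A B F"
  unfolding profunctor_def set_functor_def using assms by auto

lemma rep_simps [simp]:
  "psrc (rep F) = fdom F" "ptgt (rep F) = fcod F"
  "El (rep F) (y, x) = hom (fcod F) y (fo F x)"
  "Act (rep F) (h, f) u = Cmp (fcod F) (fa F f) (Cmp (fcod F) u h)"
  by (simp_all add: rep_def)

lemma pid_simps [simp]:
  "psrc (pid A) = A" "ptgt (pid A) = A" "El (pid A) (y, x) = hom A y x"
  "Act (pid A) (h, f) u = Cmp A f (Cmp A u h)"
  by (simp_all add: pid_def)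

lemma profunctor_rep:
  assumes "is_functor A B F"
  shows "profunctor A B (rep F)"
  by (rule profunctorI) (use is_functorD[OF assms] in \<open>auto simp: hom_iff Cmp_assoc\<close>)

lemma profunctor_pid: "category A \<Longrightarrow> profunctor A A (pid A)"
  by (simp add: pid_def profunctor_rep)

lemma psub_simps [simp]:
  "psrc (F \<triangleleft> \<phi>) = fdom \<phi>" "ptgt (F \<triangleleft> \<phi>) = ptgt F"
  "El (F \<triangleleft> \<phi>) (y, x) = El F (y, fo \<phi> x)" "Act (F \<triangleleft> \<phi>) (h, f) = Act F (h, fa \<phi> f)"
  by (simp_all add: psub_def)

lemma psubt_simps [simp]:
  "psrc (\<psi> \<triangleright> F) = psrc F" "ptgt (\<psi> \<triangleright> F) = fdom \<psi>"
  "El (\<psi> \<triangleright> F) (y, x) = El F (fo \<psi> y, x)" "Act (\<psi> \<triangleright> F) (h, f) = Act F (fa \<psi> h, f)"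
  by (simp_all add: psubt_def)

lemma ptens_simps [simp]:
  "psrc (F \<otimes> G) = psrc F \<times>\<^sub>c psrc G" "ptgt (F \<otimes> G) = ptgt F \<times>\<^sub>c ptgt G"
  "El (F \<otimes> G) ((y, y'), (x, x')) = El F (y, x) \<times> El G (y', x')"
  "Act (F \<otimes> G) ((h, h'), (f, f')) = map_prod (Act F (h, f)) (Act G (h', f'))"
  by (simp_all add: ptens_def)

lemma profunctor_psub:
  assumes F: "profunctor B E F" and \<phi>: "is_functor A B \<phi>"
  shows "profunctor A E (F \<triangleleft> \<phi>)"
  by (rule profunctorI) (use profunctorD[OF F] is_functorD[OF \<phi>] in auto)

lemma profunctor_psubt:
  assumes F: "profunctor A B F" and \<psi>: "is_functor E B \<psi>"
  shows "profunctor A E (\<psi> \<triangleright> F)"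
  by (rule profunctorI) (use profunctorD[OF F] is_functorD[OF \<psi>] in auto)

lemma profunctor_ptens:
  assumes F: "profunctor A B F" and G: "profunctor A' B' G"
  shows "profunctor (A \<times>\<^sub>c A') (B \<times>\<^sub>c B') (F \<otimes> G)"
  by (rule profunctorI) (use profunctorD[OF F] profunctorD[OF G] in \<open>auto simp: map_prod_def\<close>)

section \<open>Composition of profunctors through classes in a coend\<close>

lemma equiv_coend_rel: "equiv (coend_points B S) (coend_rel B S T)"
proof (rule equivI)
  let ?R = "(coend_gen B S T \<union> (coend_gen B S T)\<inverse>)\<^sup>*"
  show "coend_rel B S T \<subseteq> coend_points B S \<times> coend_points B S"
    by (auto simp: coend_rel_def)
  show "refl_on (coend_points B S) (coend_rel B S T)"
    by (auto simp: refl_on_def coend_rel_def)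
  have "sym ?R" by (intro sym_rtrancl sym_Un_converse)
  then show "sym (coend_rel B S T)"
    by (auto simp: coend_rel_def sym_def)
  show "trans (coend_rel B S T)"
    by (auto simp: coend_rel_def trans_def intro: rtrancl_trans)
qed

lemma pcomp_simps [simp]: "psrc (G \<odot> F) = psrc F" "ptgt (G \<odot> F) = ptgt G"
  by (simp_all add: pcomp_def)

lemma El_pcomp: "El (G \<odot> F) x = (pcls G F x) ` {(b, (u, v)). b \<in> Obj (ptgt F) \<and>
    u \<in> El F (b, snd x) \<and> v \<in> El G (fst x, b)}"
  by (cases x) (auto simp: pcomp_def coend_def quotient_def pcls_def coend_points_def integrandS_def)

lemma pcls_in:
  "b \<in> Obj (ptgt F) \<Longrightarrow> u \<in> El F (b, a) \<Longrightarrow> v \<in> El G (e, b) \<Longrightarrow>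
    pcls G F (e, a) (b, (u, v)) \<in> El (G \<odot> F) (e, a)"
  by (auto simp: El_pcomp)

lemma pcls_cases:
  assumes "X \<in> El (G \<odot> F) (e, a)"
  obtains b u v where "b \<in> Obj (ptgt F)" "u \<in> El F (b, a)" "v \<in> El G (e, b)"
    "X = pcls G F (e, a) (b, (u, v))"
  using assms by (auto simp: El_pcomp)

text \<open>The generating relation as a sliding rule: an arrow \<open>k\<close> acting on the first
  entry may act on the second instead. Normal forms of classes are reached by chaining instances of
  it.\<close>

lemma pcls_gen:
  assumes F: "profunctor A B F" and G: "profunctor B E G" and "e \<in> Obj E" "a \<in> Obj A"
    and "k \<in> Arr B" "Dom B k = b" "Cod B k = b'" and "u \<in> El F (b', a)" "v \<in> El G (e, b)"
  shows "pcls G F (e, a) (b, (Act F (k, Idn A a) u, v)) =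
    pcls G F (e, a) (b', (u, Act G (Idn E e, k) v))"
proof -
  note [simp] = profunctorD[OF F] profunctorD[OF G]
  let ?S = "integrandS G F (e, a)" and ?T = "integrandT G F (e, a)"
  have b: "b \<in> Obj B" "b' \<in> Obj B" using assms by auto
  have T: "?T (k, Idn B b) (u, v) = (Act F (k, Idn A a) u, v)"
    "?T (Idn B b', k) (u, v) = (u, Act G (Idn E e, k) v)"
    using assms b by (auto simp: integrandT_def)
  have "((b, ?T (k, Idn B b) (u, v)), (b', ?T (Idn B b', k) (u, v))) \<in> coend_gen B ?S ?T"
    unfolding coend_gen_def using assms b by (fastforce simp: integrandS_def hom_iff)
  moreover have "(b, ?T (k, Idn B b) (u, v)) \<in> coend_points B ?S"
    "(b', ?T (Idn B b', k) (u, v)) \<in> coend_points B ?S"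
    unfolding T using assms b by (auto simp: coend_points_def integrandS_def)
  ultimately have "((b, ?T (k, Idn B b) (u, v)), (b', ?T (Idn B b', k) (u, v))) \<in> coend_rel B ?S ?T"
    unfolding coend_rel_def by blast
  from equiv_class_eq[OF equiv_coend_rel this] show ?thesis
    unfolding pcls_def T by simp
qed

text \<open>A map invariant under sliding is constant along the zigzags that generate the relation,
  so its image of a class is a singleton. The evaluation of any cell given by
  \<open>on_class\<close> starts here.\<close>

lemma on_class_pcls:
  assumes F: "profunctor A B F" and G: "profunctor B E G"
    and t: "b \<in> Obj B" "u \<in> El F (b, a)" "v \<in> El G (e, b)" and ea: "e \<in> Obj E" "a \<in> Obj A"
    and f: "\<And>b b' k u v. k \<in> Arr B \<Longrightarrow> Dom B k = b \<Longrightarrow> Cod B k = b' \<Longrightarrow> u \<in> El F (b', a) \<Longrightarrow>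
      v \<in> El G (e, b) \<Longrightarrow> f (b, (Act F (k, Idn A a) u, v)) = f (b', (u, Act G (Idn E e, k) v))"
  shows "on_class f (pcls G F (e, a) (b, (u, v))) = f (b, (u, v))"
proof -
  note [simp] = profunctorD[OF F] profunctorD[OF G]
  let ?S = "integrandS G F (e, a)" and ?T = "integrandT G F (e, a)"
  have gen: "f s = f s'" if "(s, s') \<in> coend_gen B ?S ?T" for s s'
    using that f ea by (auto simp: coend_gen_def integrandS_def integrandT_def hom_iff)
  have rel: "f s = f s'" if "(s, s') \<in> (coend_gen B ?S ?T \<union> (coend_gen B ?S ?T)\<inverse>)\<^sup>*" for s s'
    using that by induction (auto dest: gen)
  have "(b, (u, v)) \<in> coend_points B ?S"
    using t by (simp add: coend_points_def integrandS_def)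
  then have "(b, (u, v)) \<in> pcls G F (e, a) (b, (u, v))"
    unfolding pcls_def profunctorD(4)[OF F] by (rule equiv_class_self[OF equiv_coend_rel])
  moreover have "f s = f (b, (u, v))" if "s \<in> pcls G F (e, a) (b, (u, v))" for s
    using that rel[of "(b, (u, v))" s] by (auto simp: pcls_def coend_rel_def)
  ultimately have "f ` pcls G F (e, a) (b, (u, v)) = {f (b, (u, v))}" by blast
  then show ?thesis by (simp add: on_class_def)
qed

lemma Act_pcomp:
  assumes F: "profunctor A B F" and G: "profunctor B E G"
    and "h \<in> Arr E" "f \<in> Arr A" "Cod E h = e" "Dom A f = a" "Dom E h = e'" "Cod A f = a'"
    and "b \<in> Obj B" "u \<in> El F (b, a)" "v \<in> El G (e, b)"
  shows "Act (G \<odot> F) (h, f) (pcls G F (e, a) (b, (u, v))) =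
    pcls G F (e', a') (b, (Act F (Idn B b, f) u, Act G (h, Idn B b) v))"
proof -
  note [simp] = profunctorD[OF F] profunctorD[OF G]
  let ?f = "\<lambda>(b, (u, v)). pcls G F (e', a') (b, (Act F (Idn B b, f) u, Act G (h, Idn B b) v))"
  \<comment> \<open>The action of \<open>h\<close> and \<open>f\<close> commutes with that of
    \<open>k\<close>, so the slide can be performed after it, at the new endpoints.\<close>
  have "?f (b, (Act F (k, Idn A a) u, v)) = ?f (b', (u, Act G (Idn E e, k) v))"
    if "k \<in> Arr B" "Dom B k = b" "Cod B k = b'" "u \<in> El F (b', a)" "v \<in> El G (e, b)" for b b' k u v
    using pcls_gen[OF F G, of e' a' k b b' "Act F (Idn B b', f) u" "Act G (h, Idn B b) v"] that assms
    by auto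
  note f = this
  have "on_class ?f (pcls G F (e, a) (b, (u, v))) = ?f (b, (u, v))"
    by (rule on_class_pcls[OF F G]) (use assms f in auto)
  with assms show ?thesis by (auto simp: pcomp_def)
qed

lemma profunctor_pcomp:
  assumes F: "profunctor A B F" and G: "profunctor B E G"
  shows "profunctor A E (G \<odot> F)"
proof -
  note [simp] = profunctorD[OF F] profunctorD[OF G] Act_pcomp[OF F G]
  show ?thesis
    by (rule profunctorI) (auto elim!: pcls_cases intro!: pcls_in)
qed

section \<open>2-cells on representatives\<close>

lemma two_cellD:
  assumes "two_cell F G \<tau>" and F: "profunctor A B F"
  shows "csrc \<tau> = F" "ctgt \<tau> = G" "profunctor A B G"
    "\<And>y x u. y \<in> Obj B \<Longrightarrow> x \<in> Obj A \<Longrightarrow> u \<in> El F (y, x) \<Longrightarrow> cmpt \<tau> (y, x) u \<in> El G (y, x)"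
    "\<And>h f u y x y' x'. h \<in> Arr B \<Longrightarrow> f \<in> Arr A \<Longrightarrow> u \<in> El F (y, x) \<Longrightarrow> Cod B h = y \<Longrightarrow> Dom A f = x \<Longrightarrow>
      Dom B h = y' \<Longrightarrow> Cod A f = x' \<Longrightarrow>
      cmpt \<tau> (y', x') (Act F (h, f) u) = Act G (h, f) (cmpt \<tau> (y, x) u)"
  using assms profunctorD(3,4)[OF F] by (auto simp: two_cell_def)

lemma two_cellI:
  assumes "csrc \<tau> = F" "ctgt \<tau> = G" "profunctor A B F" "profunctor A B G"
    "\<And>y x u. y \<in> Obj B \<Longrightarrow> x \<in> Obj A \<Longrightarrow> u \<in> El F (y, x) \<Longrightarrow> cmpt \<tau> (y, x) u \<in> El G (y, x)"
    "\<And>h f u. h \<in> Arr B \<Longrightarrow> f \<in> Arr A \<Longrightarrow> u \<in> El F (Cod B h, Dom A f) \<Longrightarrow>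
      cmpt \<tau> (Dom B h, Cod A f) (Act F (h, f) u) = Act G (h, f) (cmpt \<tau> (Cod B h, Dom A f) u)"
  shows "two_cell F G \<tau>"
  using assms profunctorD(3,4)[OF assms(3)] by (auto simp: two_cell_def)

lemma cell_simps [simp]:
  "csrc (idc F) = F" "ctgt (idc F) = F" "cmpt (idc F) x u = u"
  "csrc (\<tau> \<bullet> \<sigma>) = csrc \<sigma>" "ctgt (\<tau> \<bullet> \<sigma>) = ctgt \<tau>" "cmpt (\<tau> \<bullet> \<sigma>) x w = cmpt \<tau> x (cmpt \<sigma> x w)"
  "csrc (cinv \<tau>) = ctgt \<tau>" "ctgt (cinv \<tau>) = csrc \<tau>"
  by (simp_all add: idc_def vcomp_def cinv_def)

lemma whisker_simps [simp]:
  "csrc (\<tau> \<star> \<sigma>) = csrc \<tau> \<odot> csrc \<sigma>" "ctgt (\<tau> \<star> \<sigma>) = ctgt \<tau> \<odot> ctgt \<sigma>"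
  by (simp_all add: hcomp_def)

lemma ctens_simps [simp]:
  "csrc (\<tau> \<boxtimes> \<sigma>) = csrc \<tau> \<otimes> csrc \<sigma>" "ctgt (\<tau> \<boxtimes> \<sigma>) = ctgt \<tau> \<otimes> ctgt \<sigma>"
  "cmpt (\<tau> \<boxtimes> \<sigma>) ((y, y'), (x, x')) = map_prod (cmpt \<tau> (y, x)) (cmpt \<sigma> (y', x'))"
  by (simp_all add: ctens_def)

lemma csub_simps [simp]:
  "csrc (\<tau> \<lhd> \<phi>) = csrc \<tau> \<triangleleft> \<phi>" "ctgt (\<tau> \<lhd> \<phi>) = ctgt \<tau> \<triangleleft> \<phi>"
  "cmpt (\<tau> \<lhd> \<phi>) (y, x) = cmpt \<tau> (y, fo \<phi> x)"
  by (simp_all add: csub_def)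

lemma structural_simps [simp]:
  "csrc (passoc H G F) = (H \<odot> G) \<odot> F" "ctgt (passoc H G F) = H \<odot> (G \<odot> F)"
  "csrc (plunit F) = pid (ptgt F) \<odot> F" "ctgt (plunit F) = F"
  "csrc (prunit F) = F \<odot> pid (psrc F)" "ctgt (prunit F) = F"
  by (simp_all add: passoc_def plunit_def prunit_def)

lemma interchange_simps [simp]:
  "csrc (interchange G G' F F') = (G \<otimes> G') \<odot> (F \<otimes> F')"
  "ctgt (interchange G G' F F') = (G \<odot> F) \<otimes> (G' \<odot> F')"
  by (simp_all add: interchange_def)

lemma assoc_natural_simps [simp]:
  "csrc (assoc_natural G F1 F2 F3) =
    (G \<triangleleft> fassoc (ptgt F1) (ptgt F2) (ptgt F3)) \<odot> ((F1 \<otimes> F2) \<otimes> F3)"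
  "ctgt (assoc_natural G F1 F2 F3) =
    (G \<odot> (F1 \<otimes> (F2 \<otimes> F3))) \<triangleleft> fassoc (psrc F1) (psrc F2) (psrc F3)"
  by (simp_all add: assoc_natural_def)

lemma cinv_cmpt:
  assumes "inj_on (cmpt \<tau> x) (El (csrc \<tau>) x)" "u \<in> El (csrc \<tau>) x" "cmpt \<tau> x u = w"
  shows "cmpt (cinv \<tau>) x w = u"
  using assms by (auto simp: cinv_def)

lemma two_cell_cinv:
  assumes \<tau>: "two_cell F G \<tau>" and F: "profunctor A B F"
    and bij: "\<And>y x. y \<in> Obj B \<Longrightarrow> x \<in> Obj A \<Longrightarrow> bij_betw (cmpt \<tau> (y, x)) (El F (y, x)) (El G (y, x))"
  shows "two_cell G F (cinv \<tau>)"
proof -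
  note t = two_cellD[OF \<tau> F]
  note [simp] = profunctorD[OF F] profunctorD[OF t(3)] t
  have inv': "cmpt (cinv \<tau>) (y, x) w = u"
    if "y \<in> Obj B" "x \<in> Obj A" "u \<in> El F (y, x)" "cmpt \<tau> (y, x) u = w" for y x u w
    using bij[OF that(1,2)] that(3,4) by (intro cinv_cmpt) (auto simp: bij_betw_def)
  have inv: "cmpt (cinv \<tau>) (y, x) w \<in> El F (y, x) \<and> cmpt \<tau> (y, x) (cmpt (cinv \<tau>) (y, x) w) = w"
    if yx: "y \<in> Obj B" "x \<in> Obj A" and w: "w \<in> El G (y, x)" for y x w
  proof -
    obtain u where "u \<in> El F (y, x)" "cmpt \<tau> (y, x) u = w"
      using bij[OF yx] w by (metis bij_betw_imp_surj_on imageE)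
    with inv'[OF yx this] show ?thesis by simp
  qed
  show ?thesis
  proof (rule two_cellI[OF _ _ t(3) F])
    fix h f w assume "h \<in> Arr B" "f \<in> Arr A" "w \<in> El G (Cod B h, Dom A f)"
    then show "cmpt (cinv \<tau>) (Dom B h, Cod A f) (Act G (h, f) w) =
        Act F (h, f) (cmpt (cinv \<tau>) (Cod B h, Dom A f) w)"
      using inv[of "Cod B h" "Dom A f" w] by (intro inv') auto
  qed (use inv in auto)
qed

text \<open>The pointwise inverse of a natural family of bijections is natural, by
  \<open>two_cell_cinv\<close>.\<close>

lemma invertible_cellI:
  assumes \<tau>: "two_cell F G \<tau>" and F: "profunctor A B F"
    and bij: "\<And>y x. y \<in> Obj B \<Longrightarrow> x \<in> Obj A \<Longrightarrow> bij_betw (cmpt \<tau> (y, x)) (El F (y, x)) (El G (y, x))"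
  shows "invertible_cell F G \<tau>"
proof -
  note t = two_cellD[OF \<tau> F]
  note [simp] = profunctorD(3,4)[OF F] profunctorD(3,4)[OF t(3)]
  have "cinv \<tau> \<bullet> \<tau> \<doteq> idc F" "\<tau> \<bullet> cinv \<tau> \<doteq> idc G"
    using bij t by (auto simp: cell_eq_def cinv_def bij_betw_def f_inv_into_f)
  then show ?thesis
    unfolding invertible_cell_def using \<tau> two_cell_cinv[OF \<tau> F bij] by blast
qed

lemma invertible_cell_bij:
  assumes "invertible_cell F G \<tau>" and F: "profunctor A B F" and "y \<in> Obj B" "x \<in> Obj A"
  shows "bij_betw (cmpt \<tau> (y, x)) (El F (y, x)) (El G (y, x))"
proof -
  obtain \<tau>' where t: "two_cell F G \<tau>" "two_cell G F \<tau>'" "\<tau>' \<bullet> \<tau> \<doteq> idc F" "\<tau> \<bullet> \<tau>' \<doteq> idc G"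
    using assms(1) by (auto simp: invertible_cell_def)
  note \<tau> = two_cellD[OF t(1) F]
  note \<tau>' = two_cellD[OF t(2) \<tau>(3)]
  show ?thesis
    by (rule bij_betw_byWitness[where f' = "cmpt \<tau>' (y, x)"])
      (use assms t \<tau> \<tau>' profunctorD(3,4)[OF F] profunctorD(3,4)[OF \<tau>(3)] in \<open>auto simp: cell_eq_def\<close>)
qed

lemma invertible_cell_vcomp:
  assumes \<tau>: "invertible_cell F G \<tau>" and \<sigma>: "invertible_cell G H \<sigma>"
  shows "invertible_cell F H (\<sigma> \<bullet> \<tau>)"
proof -
  have t: "two_cell F G \<tau>" and s: "two_cell G H \<sigma>" using assms by (auto simp: invertible_cell_def)
  have F: "profunctor (psrc F) (ptgt F) F" using t by (simp add: two_cell_def)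
  note \<tau>D = two_cellD[OF t F]
  note \<sigma>D = two_cellD[OF s \<tau>D(3)]
  show ?thesis
  proof (rule invertible_cellI[OF _ F])
    note [simp] = profunctorD(1,2)[OF F]
    show "two_cell F H (\<sigma> \<bullet> \<tau>)"
      by (rule two_cellI[OF _ _ F \<sigma>D(3)]) (auto simp: \<tau>D \<sigma>D)
    show "bij_betw (cmpt (\<sigma> \<bullet> \<tau>) (y, x)) (El F (y, x)) (El H (y, x))"
      if "y \<in> Obj (ptgt F)" "x \<in> Obj (psrc F)" for y x
      using bij_betw_trans[OF invertible_cell_bij[OF \<tau> F that] invertible_cell_bij[OF \<sigma> \<tau>D(3) that]]
      by (simp add: comp_def vcomp_def)
  qed
qed

lemma invertible_cell_sym:
  assumes "invertible_cell F G \<tau>"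
  shows "\<exists>\<tau>'. invertible_cell G F \<tau>'"
  using assms by (auto simp: invertible_cell_def)

lemma invertible_cell_csub:
  assumes \<tau>: "invertible_cell F G \<tau>" and F: "profunctor B E F" and \<phi>: "is_functor A B \<phi>"
  shows "invertible_cell (F \<triangleleft> \<phi>) (G \<triangleleft> \<phi>) (\<tau> \<lhd> \<phi>)"
proof -
  have t: "two_cell F G \<tau>" using \<tau> by (simp add: invertible_cell_def)
  note \<tau>D = two_cellD[OF t F]
  show ?thesis
  proof (rule invertible_cellI[OF _ profunctor_psub[OF F \<phi>]])
    show "two_cell (F \<triangleleft> \<phi>) (G \<triangleleft> \<phi>) (\<tau> \<lhd> \<phi>)"
      by (rule two_cellI[OF _ _ profunctor_psub[OF F \<phi>] profunctor_psub[OF \<tau>D(3) \<phi>]])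
        (use is_functorD[OF \<phi>] in \<open>auto simp: \<tau>D\<close>)
    show "bij_betw (cmpt (\<tau> \<lhd> \<phi>) (y, x)) (El (F \<triangleleft> \<phi>) (y, x)) (El (G \<triangleleft> \<phi>) (y, x))"
      if "y \<in> Obj E" "x \<in> Obj A" for y x
      using invertible_cell_bij[OF \<tau> F] that is_functorD[OF \<phi>] by simp
  qed
qed

lemma hcomp_pcls:
  assumes F: "profunctor A B F" and G: "profunctor B E G"
    and \<tau>: "two_cell G G' \<tau>" and \<sigma>: "two_cell F F' \<sigma>"
    and "e \<in> Obj E" "a \<in> Obj A" "b \<in> Obj B" "u \<in> El F (b, a)" "v \<in> El G (e, b)"
  shows "cmpt (\<tau> \<star> \<sigma>) (e, a) (pcls G F (e, a) (b, (u, v))) =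
    pcls G' F' (e, a) (b, (cmpt \<sigma> (b, a) u, cmpt \<tau> (e, b) v))"
proof -
  note t = two_cellD[OF \<tau> G] and s = two_cellD[OF \<sigma> F]
  note [simp] = profunctorD[OF F] profunctorD[OF G]
  let ?f = "\<lambda>(b, (u, v)). pcls G' F' (e, a) (b, (cmpt \<sigma> (b, a) u, cmpt \<tau> (e, b) v))"
  have "?f (b, (Act F (k, Idn A a) u, v)) = ?f (b', (u, Act G (Idn E e, k) v))"
    if k: "k \<in> Arr B" "Dom B k = b" "Cod B k = b'" "u \<in> El F (b', a)" "v \<in> El G (e, b)" for b b' k u v
  proof -
    have bb: "b \<in> Obj B" "b' \<in> Obj B" using k by auto
    \<comment> \<open>Naturality of both cells lets \<open>k\<close> leave their arguments, so that
      it can slide between the images.\<close>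
    have "cmpt \<sigma> (b, a) (Act F (k, Idn A a) u) = Act F' (k, Idn A a) (cmpt \<sigma> (b', a) u)"
      using k assms by (intro s(5)) auto
    moreover have "cmpt \<tau> (e, b') (Act G (Idn E e, k) v) = Act G' (Idn E e, k) (cmpt \<tau> (e, b) v)"
      using k assms by (intro t(5)) auto
    ultimately show ?thesis
      using pcls_gen[OF s(3) t(3), of e a k b b' "cmpt \<sigma> (b', a) u" "cmpt \<tau> (e, b) v"] k assms
        t(4) s(4) bb
      by auto
  qed
  note f = this
  have "on_class ?f (pcls G F (e, a) (b, (u, v))) = ?f (b, (u, v))"
    by (rule on_class_pcls[OF F G]) (use assms f in auto)
  with assms show ?thesis by (auto simp: hcomp_def t(1,2) s(1,2))
qed

lemma plunit_pcls:
  assumes F: "profunctor A B F"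
    and "y \<in> Obj B" "x \<in> Obj A" "b \<in> Obj B" "u \<in> El F (b, x)" "k \<in> hom B y b"
  shows "cmpt (plunit F) (y, x) (pcls (pid B) F (y, x) (b, (u, k))) = Act F (k, Idn A x) u"
proof -
  note [simp] = profunctorD[OF F]
  let ?f = "\<lambda>(b, (u, k)). Act F (k, Idn A x) u"
  have "?f (b, (Act F (k, Idn A x) u, v)) = ?f (b', (u, Act (pid B) (Idn B y, k) v))"
    if k: "k \<in> Arr B" "Dom B k = b" "Cod B k = b'" "u \<in> El F (b', x)" "v \<in> El (pid B) (y, b)"
    for b b' k u v
    using k assms by (auto simp: hom_iff)
  note f = this
  have "on_class ?f (pcls (pid B) F (y, x) (b, (u, k))) = ?f (b, (u, k))"
    by (rule on_class_pcls[OF F profunctor_pid]) (use assms f in auto)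
  with assms show ?thesis by (auto simp: plunit_def)
qed

lemma prunit_pcls:
  assumes F: "profunctor A B F"
    and "y \<in> Obj B" "x \<in> Obj A" "a \<in> Obj A" "k \<in> hom A a x" "u \<in> El F (y, a)"
  shows "cmpt (prunit F) (y, x) (pcls F (pid A) (y, x) (a, (k, u))) = Act F (Idn B y, k) u"
proof -
  note [simp] = profunctorD[OF F]
  let ?f = "\<lambda>(b, (k, u)). Act F (Idn B y, k) u"
  have "?f (b, (Act (pid A) (k, Idn A x) u, v)) = ?f (b', (u, Act F (Idn B y, k) v))"
    if k: "k \<in> Arr A" "Dom A k = b" "Cod A k = b'" "u \<in> El (pid A) (b', x)" "v \<in> El F (y, b)"
    for b b' k u v
    using k assms by (auto simp: hom_iff)
  note f = this
  have "on_class ?f (pcls F (pid A) (y, x) (a, (k, u))) = ?f (a, (k, u))"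
    by (rule on_class_pcls[OF profunctor_pid F]) (use assms f in auto)
  with assms show ?thesis by (auto simp: prunit_def)
qed

lemma interchange_pcls:
  assumes F: "profunctor A B F" and G: "profunctor B E G"
    and F': "profunctor A' B' F'" and G': "profunctor B' E' G'"
    and "e \<in> Obj E" "a \<in> Obj A" "b \<in> Obj B" "u \<in> El F (b, a)" "v \<in> El G (e, b)"
    and "e' \<in> Obj E'" "a' \<in> Obj A'" "b' \<in> Obj B'" "u' \<in> El F' (b', a')" "v' \<in> El G' (e', b')"
  shows "cmpt (interchange G G' F F') ((e, e'), (a, a'))
      (pcls (G \<otimes> G') (F \<otimes> F') ((e, e'), (a, a')) ((b, b'), ((u, u'), (v, v')))) =
    (pcls G F (e, a) (b, (u, v)), pcls G' F' (e', a') (b', (u', v')))"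
proof -
  note [simp] = profunctorD[OF F] profunctorD[OF G] profunctorD[OF F'] profunctorD[OF G']
  let ?f = "\<lambda>((b, b'), ((u, u'), (v, v'))).
    (pcls G F (e, a) (b, (u, v)), pcls G' F' (e', a') (b', (u', v')))"
  have "?f (b, (Act (F \<otimes> F') (k, Idn (A \<times>\<^sub>c A') (a, a')) u, v)) =
      ?f (b', (u, Act (G \<otimes> G') (Idn (E \<times>\<^sub>c E') (e, e'), k) v))"
    if "k \<in> Arr (B \<times>\<^sub>c B')" "Dom (B \<times>\<^sub>c B') k = b" "Cod (B \<times>\<^sub>c B') k = b'"
      "u \<in> El (F \<otimes> F') (b', (a, a'))" "v \<in> El (G \<otimes> G') ((e, e'), b)" for b b' k u v
  proof -
    \<comment> \<open>An arrow of the product category is a pair, so a slide in the source becomes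
      one slide in each factor of the target.\<close>
    obtain k1 k2 u1 u2 v1 v2 where ku: "k = (k1, k2)" "u = (u1, u2)" "v = (v1, v2)"
      by (metis surj_pair)
    show ?thesis
      using pcls_gen[OF F G, of e a k1 _ _ u1 v1] pcls_gen[OF F' G', of e' a' k2 _ _ u2 v2] that assms
      by (auto simp: ku)
  qed
  note f = this
  have "on_class ?f (pcls (G \<otimes> G') (F \<otimes> F') ((e, e'), (a, a')) ((b, b'), ((u, u'), (v, v')))) = ?f ((b, b'), ((u, u'), (v, v')))"
    by (rule on_class_pcls[OF profunctor_ptens[OF F F'] profunctor_ptens[OF G G']]) (use assms f in auto)
  with assms show ?thesis by (auto simp: interchange_def)
qed

lemma assoc_natural_pcls:
  assumes F: "profunctor A1 B1 F1" "profunctor A2 B2 F2" "profunctor A3 B3 F3"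
    and G: "profunctor (B1 \<times>\<^sub>c (B2 \<times>\<^sub>c B3)) E G"
    and "e \<in> Obj E" "x \<in> Obj A1" "y \<in> Obj A2" "z \<in> Obj A3" "b1 \<in> Obj B1" "b2 \<in> Obj B2" "b3 \<in> Obj B3"
    "u1 \<in> El F1 (b1, x)" "u2 \<in> El F2 (b2, y)" "u3 \<in> El F3 (b3, z)" "v \<in> El G (e, (b1, (b2, b3)))"
  shows "cmpt (assoc_natural G F1 F2 F3) (e, ((x, y), z))
      (pcls (G \<triangleleft> fassoc B1 B2 B3) ((F1 \<otimes> F2) \<otimes> F3) (e, ((x, y), z))
        (((b1, b2), b3), (((u1, u2), u3), v))) =
    pcls G (F1 \<otimes> (F2 \<otimes> F3)) (e, (x, (y, z))) ((b1, (b2, b3)), ((u1, (u2, u3)), v))"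
proof -
  note [simp] = profunctorD[OF F(1)] profunctorD[OF F(2)] profunctorD[OF F(3)] profunctorD[OF G]
  note T = profunctor_ptens[OF F(1) profunctor_ptens[OF F(2) F(3)]]
    and T' = profunctor_ptens[OF profunctor_ptens[OF F(1) F(2)] F(3)]
  let ?f = "\<lambda>(((b1, b2), b3), (((u1, u2), u3), v)).
        pcls G (F1 \<otimes> (F2 \<otimes> F3)) (e, (x, (y, z))) ((b1, (b2, b3)), ((u1, (u2, u3)), v))"
  have "?f (b, (Act ((F1 \<otimes> F2) \<otimes> F3) (k, Idn ((A1 \<times>\<^sub>c A2) \<times>\<^sub>c A3) ((x, y), z)) u, v)) =
      ?f (b', (u, Act (G \<triangleleft> fassoc B1 B2 B3) (Idn E e, k) v))"
    if "k \<in> Arr ((B1 \<times>\<^sub>c B2) \<times>\<^sub>c B3)" "Dom ((B1 \<times>\<^sub>c B2) \<times>\<^sub>c B3) k = b" "Cod ((B1 \<times>\<^sub>c B2) \<times>\<^sub>c B3) k = b'"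
      "u \<in> El ((F1 \<otimes> F2) \<otimes> F3) (b', ((x, y), z))" "v \<in> El (G \<triangleleft> fassoc B1 B2 B3) (e, b)" for b b' k u v
  proof -
    obtain k1 k2 k3 u1 u2 u3 where ku: "k = ((k1, k2), k3)" "u = ((u1, u2), u3)"
      by (metis surj_pair)
    show ?thesis
      using pcls_gen[OF T G, of e "(x, (y, z))" "(k1, (k2, k3))" _ _ "(u1, (u2, u3))" v] that assms
      by (auto simp: ku)
  qed
  note f = this
  have "on_class ?f (pcls (G \<triangleleft> fassoc B1 B2 B3) ((F1 \<otimes> F2) \<otimes> F3) (e, ((x, y), z)) (((b1, b2), b3), (((u1, u2), u3), v))) = ?f (((b1, b2), b3), (((u1, u2), u3), v))"
    by (rule on_class_pcls[OF T' profunctor_psub[OF G]]) (use assms f in auto)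
  with assms show ?thesis by (auto simp: assoc_natural_def)
qed

context
  fixes A :: "('o, 'a) cat" and B :: "('p, 'b) cat" and C :: "('q, 'c) cat" and E :: "('r, 'd) cat"
    and F :: "('o, 'a, 'p, 'b, 'v) prof" and G :: "('p, 'b, 'q, 'c, 'w) prof"
    and H :: "('q, 'c, 'r, 'd, 'z) prof"
  assumes F: "profunctor A B F" and G: "profunctor B C G" and H: "profunctor C E H"
begin

text \<open>The second entry of a representative is itself a class, so well-definedness is checked
  in two layers: \<open>g b u\<close> handles slides in \<open>C\<close> with the outer
  representative fixed, and on this basis \<open>?f\<close> is shown to respect slides in
  \<open>B\<close>.\<close>

lemma passoc_pcls:
  assumes "d \<in> Obj E" "a \<in> Obj A" "b \<in> Obj B" "c \<in> Obj C"
    "u \<in> El F (b, a)" "v \<in> El G (c, b)" "w \<in> El H (d, c)"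
  shows "cmpt (passoc H G F) (d, a) (pcls (H \<odot> G) F (d, a) (b, (u, pcls H G (d, b) (c, (v, w))))) =
    pcls H (G \<odot> F) (d, a) (c, (pcls G F (c, a) (b, (u, v)), w))"
proof -
  note [simp] = profunctorD[OF F] profunctorD[OF G] profunctorD[OF H]
  note GF = profunctor_pcomp[OF F G] and HG = profunctor_pcomp[OF G H]
  define g where "g b u = (\<lambda>(c, (v, w)). pcls H (G \<odot> F) (d, a) (c, (pcls G F (c, a) (b, (u, v)), w)))"
    for b u
  have g': "g b u (c, (v, w)) = pcls H (G \<odot> F) (d, a) (c, (pcls G F (c, a) (b, (u, v)), w))" for b u c v w
    by (simp add: g_def)
  have g: "on_class (g b u) (pcls H G (d, b) (c, (v, w))) = g b u (c, (v, w))"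
    if "b \<in> Obj B" "c \<in> Obj C" "u \<in> El F (b, a)" "v \<in> El G (c, b)" "w \<in> El H (d, c)" for b u c v w
  proof (rule on_class_pcls[OF G H])
    fix c c' k v w
    assume k: "k \<in> Arr C" "Dom C k = c" "Cod C k = c'" "v \<in> El G (c', b)" "w \<in> El H (d, c)"
    \<comment> \<open>In the target the first entry is a class. Here \<open>k\<close> acts on it
      through \<open>v\<close>, which permits a slide in
      \<open>H \<odot> (G \<odot> F)\<close>.\<close>
    have "pcls G F (c, a) (b, (u, Act G (k, Idn B b) v)) =
        Act (G \<odot> F) (k, Idn A a) (pcls G F (c', a) (b, (u, v)))"
      using k that assms by (subst Act_pcomp[OF F G]) auto
    moreover have "pcls G F (c', a) (b, (u, v)) \<in> El (G \<odot> F) (c', a)"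
      using k that by (intro pcls_in) auto
    ultimately show "g b u (c, (Act G (k, Idn B b) v, w)) = g b u (c', (v, Act H (Idn E d, k) w))"
      using pcls_gen[OF GF H, of d a k c c' "pcls G F (c', a) (b, (u, v))" w] k assms
      by (simp add: g_def)
  qed (use that assms in auto)
  let ?f = "\<lambda>(b, (u, Y)). on_class (g b u) Y"
  have "?f (b, (Act F (k, Idn A a) u, Y)) = ?f (b', (u, Act (H \<odot> G) (Idn E d, k) Y))"
    if k: "k \<in> Arr B" "Dom B k = b" "Cod B k = b'" "u \<in> El F (b', a)" "Y \<in> El (H \<odot> G) (d, b)"
    for b b' k u Y
    using k(5)
  proof (rule pcls_cases)
    fix c v w assume v: "c \<in> Obj (ptgt G)" "v \<in> El G (c, b)" "w \<in> El H (d, c)"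
      and Y: "Y = pcls H G (d, b) (c, (v, w))"
    have "Act (H \<odot> G) (Idn E d, k) Y = pcls H G (d, b') (c, (Act G (Idn C c, k) v, w))"
      unfolding Y using k v assms by (subst Act_pcomp[OF G H]) auto
    then show ?thesis
      using k v assms pcls_gen[OF F G, of c a k b b' u v] by (auto simp: Y g g')
  qed
  note f = this
  have "on_class ?f (pcls (H \<odot> G) F (d, a) (b, (u, pcls H G (d, b) (c, (v, w))))) = ?f (b, (u, pcls H G (d, b) (c, (v, w))))"
    by (rule on_class_pcls[OF F HG]) (use assms f in \<open>auto intro!: pcls_in\<close>)
  with assms pcls_in[of c G v b w H d] show ?thesis by (simp add: passoc_def g g' flip: g_def)
qed

text \<open>The left inverse is the rebracketing in the other direction, again a nested
  \<open>on_class\<close>. Injectivity is what the evaluation of \<open>cinv (passoc H G F)\<close>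
  requires; it serves the adjunctions, where one profunctor is corepresented.\<close>

lemma passoc_inj:
  assumes da: "d \<in> Obj E" "a \<in> Obj A"
  shows "inj_on (cmpt (passoc H G F) (d, a)) (El ((H \<odot> G) \<odot> F) (d, a))"
proof -
  note [simp] = profunctorD[OF F] profunctorD[OF G] profunctorD[OF H]
  note GF = profunctor_pcomp[OF F G] and HG = profunctor_pcomp[OF G H]
  define g where "g c w = (\<lambda>(b, (u, v)). pcls (H \<odot> G) F (d, a) (b, (u, pcls H G (d, b) (c, (v, w)))))"
    for c w
  have g': "g c w (b, (u, v)) = pcls (H \<odot> G) F (d, a) (b, (u, pcls H G (d, b) (c, (v, w))))" for b u c v w
    by (simp add: g_def)
  have g: "on_class (g c w) (pcls G F (c, a) (b, (u, v))) = g c w (b, (u, v))"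
    if "b \<in> Obj B" "c \<in> Obj C" "u \<in> El F (b, a)" "v \<in> El G (c, b)" "w \<in> El H (d, c)" for b u c v w
  proof (rule on_class_pcls[OF F G])
    fix b b' k u v
    assume k: "k \<in> Arr B" "Dom B k = b" "Cod B k = b'" "u \<in> El F (b', a)" "v \<in> El G (c, b)"
    have "pcls H G (d, b') (c, (Act G (Idn C c, k) v, w)) =
        Act (H \<odot> G) (Idn E d, k) (pcls H G (d, b) (c, (v, w)))"
      using k that assms by (subst Act_pcomp[OF G H]) auto
    moreover have "pcls H G (d, b) (c, (v, w)) \<in> El (H \<odot> G) (d, b)"
      using k that by (intro pcls_in) auto
    ultimately show "g c w (b, (Act F (k, Idn A a) u, v)) = g c w (b', (u, Act G (Idn C c, k) v))"
      using pcls_gen[OF F HG, of d a k b b' u "pcls H G (d, b) (c, (v, w))"] k assms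
      by (simp add: g_def)
  qed (use that assms in auto)
  let ?f = "\<lambda>(c, (X, w)). on_class (g c w) X"
  have f: "?f (c, (Act (G \<odot> F) (k, Idn A a) X, w)) = ?f (c', (X, Act H (Idn E d, k) w))"
    if k: "k \<in> Arr C" "Dom C k = c" "Cod C k = c'" "X \<in> El (G \<odot> F) (c', a)" "w \<in> El H (d, c)"
    for c c' k X w
    using k(4)
  proof (rule pcls_cases)
    fix b u v assume v: "b \<in> Obj (ptgt F)" "u \<in> El F (b, a)" "v \<in> El G (c', b)"
      and X: "X = pcls G F (c', a) (b, (u, v))"
    have "Act (G \<odot> F) (k, Idn A a) X = pcls G F (c, a) (b, (u, Act G (k, Idn B b) v))"
      unfolding X using k v assms by (subst Act_pcomp[OF F G]) auto
    then show ?thesis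
      using k v assms pcls_gen[OF G H, of d b k c c' v w] by (auto simp: X g g')
  qed
  show ?thesis
  proof (rule inj_on_inverseI[where g = "on_class ?f"])
    fix Z assume "Z \<in> El ((H \<odot> G) \<odot> F) (d, a)"
    then obtain b u c v w where Z: "Z = pcls (H \<odot> G) F (d, a) (b, (u, pcls H G (d, b) (c, (v, w))))"
      and m: "b \<in> Obj B" "u \<in> El F (b, a)" "c \<in> Obj C" "v \<in> El G (c, b)" "w \<in> El H (d, c)"
      by (auto elim!: pcls_cases)
    have "on_class ?f (pcls H (G \<odot> F) (d, a) (c, (pcls G F (c, a) (b, (u, v)), w))) =
        ?f (c, (pcls G F (c, a) (b, (u, v)), w))"
      using m da pcls_in[of b F u a v G c] f by (intro on_class_pcls[OF GF H]) auto
    then show "on_class ?f (cmpt (passoc H G F) (d, a) Z) = Z"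
      using m da by (simp add: Z passoc_pcls g g')
  qed
qed

end

text \<open>A case of co-Yoneda: in the class of \<open>(b, (u, k))\<close> the arrow
  \<open>k\<close> slides onto \<open>u\<close> and leaves the identity of \<open>y\<close>, so
  inserting the identity is inverse to acting.\<close>

lemma plunit_bij:
  assumes F: "profunctor A B F" and yx: "y \<in> Obj B" "x \<in> Obj A"
  shows "bij_betw (cmpt (plunit F) (y, x)) (El (pid B \<odot> F) (y, x)) (El F (y, x))"
proof (rule bij_betw_byWitness[where f' = "\<lambda>u. pcls (pid B) F (y, x) (y, (u, Idn B y))"])
  note [simp] = profunctorD[OF F] hom_iff
  have "pcls (pid B) F (y, x) (y, (Act F (k, Idn A x) u, Idn B y)) = pcls (pid B) F (y, x) (b, (u, k))"
    if "b \<in> Obj B" "u \<in> El F (b, x)" "k \<in> hom B y b" for b u k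
    using pcls_gen[OF F profunctor_pid, of y x k y b u "Idn B y"] that yx by auto
  then show "\<forall>X\<in>El (pid B \<odot> F) (y, x). pcls (pid B) F (y, x) (y, (cmpt (plunit F) (y, x) X, Idn B y)) = X"
    using yx by (auto elim!: pcls_cases simp: plunit_pcls[OF F])
  show "\<forall>u\<in>El F (y, x). cmpt (plunit F) (y, x) (pcls (pid B) F (y, x) (y, (u, Idn B y))) = u"
    using yx by (auto simp: plunit_pcls[OF F])
  show "cmpt (plunit F) (y, x) ` El (pid B \<odot> F) (y, x) \<subseteq> El F (y, x)"
    using yx by (auto elim!: pcls_cases simp: plunit_pcls[OF F])
  show "(\<lambda>u. pcls (pid B) F (y, x) (y, (u, Idn B y))) ` El F (y, x) \<subseteq> El (pid B \<odot> F) (y, x)"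
    using yx by (auto intro!: pcls_in)
qed

lemma prunit_bij:
  assumes F: "profunctor A B F" and yx: "y \<in> Obj B" "x \<in> Obj A"
  shows "bij_betw (cmpt (prunit F) (y, x)) (El (F \<odot> pid A) (y, x)) (El F (y, x))"
proof (rule bij_betw_byWitness[where f' = "\<lambda>u. pcls F (pid A) (y, x) (x, (Idn A x, u))"])
  note [simp] = profunctorD[OF F] hom_iff
  have "pcls F (pid A) (y, x) (x, (Idn A x, Act F (Idn B y, k) u)) = pcls F (pid A) (y, x) (a, (k, u))"
    if "a \<in> Obj A" "k \<in> hom A a x" "u \<in> El F (y, a)" for a k u
    using pcls_gen[OF profunctor_pid F, of y x k a x "Idn A x" u] that yx by auto
  then show "\<forall>X\<in>El (F \<odot> pid A) (y, x). pcls F (pid A) (y, x) (x, (Idn A x, cmpt (prunit F) (y, x) X)) = X"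
    using yx by (auto elim!: pcls_cases simp: prunit_pcls[OF F])
  show "\<forall>u\<in>El F (y, x). cmpt (prunit F) (y, x) (pcls F (pid A) (y, x) (x, (Idn A x, u))) = u"
    using yx by (auto simp: prunit_pcls[OF F])
  show "cmpt (prunit F) (y, x) ` El (F \<odot> pid A) (y, x) \<subseteq> El F (y, x)"
    using yx by (auto elim!: pcls_cases simp: prunit_pcls[OF F])
  show "(\<lambda>u. pcls F (pid A) (y, x) (x, (Idn A x, u))) ` El F (y, x) \<subseteq> El (F \<odot> pid A) (y, x)"
    using yx by (auto intro!: pcls_in)
qed

section \<open>Profunctors represented by functors\<close>

text \<open>
  \<open>ryo R\<close> is the isomorphism \<open>rpr R (y, x) \<cong> Hom y (rfn R x)\<close>. Keeping it as data makes it possible to compute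
  with elements of iterated composites, which are nested equivalence classes, as with arrows.
\<close>

record ('o, 'a, 'p, 'b, 'v) repr =
  rpr :: "('o, 'a, 'p, 'b, 'v) prof"
  rfn :: "('o, 'a, 'p, 'b) functr"
  ryo :: "'p \<times> 'o \<Rightarrow> 'v \<Rightarrow> 'b"

definition representation :: "('o, 'a) cat \<Rightarrow> ('p, 'b) cat \<Rightarrow> ('o, 'a, 'p, 'b, 'v) repr \<Rightarrow> bool" where
  "representation A B R \<longleftrightarrow> is_functor A B (rfn R) \<and> profunctor A B (rpr R) \<and>
     (\<forall>y\<in>Obj B. \<forall>x\<in>Obj A. bij_betw (ryo R (y, x)) (El (rpr R) (y, x)) (hom B y (fo (rfn R) x))) \<and>
     (\<forall>h\<in>Arr B. \<forall>f\<in>Arr A. \<forall>u\<in>El (rpr R) (Cod B h, Dom A f).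
        ryo R (Dom B h, Cod A f) (Act (rpr R) (h, f) u) =
        Cmp B (fa (rfn R) f) (Cmp B (ryo R (Cod B h, Dom A f) u) h))"

definition rrep :: "('o, 'a, 'p, 'b) functr \<Rightarrow> ('o, 'a, 'p, 'b, 'b) repr" where
  "rrep F = \<lparr>rpr = rep F, rfn = F, ryo = (\<lambda>_ u. u)\<rparr>"

text \<open>A pair \<open>(u, v)\<close> stands for arrows from \<open>b\<close> to
  \<open>S x\<close> and from \<open>y\<close> to \<open>R b\<close>. Its image is the composite
  from \<open>y\<close> through \<open>R b\<close> to \<open>R (S x)\<close>, which sliding does not
  change.\<close>

definition rcomp :: "('p, 'b, 'q, 'c, 'w) repr \<Rightarrow> ('o, 'a, 'p, 'b, 'v) repr \<Rightarrow>
   ('o, 'a, 'q, 'c, ('p \<times> 'v \<times> 'w) set) repr" where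
  "rcomp R S = \<lparr>rpr = rpr R \<odot> rpr S, rfn = rfn R \<circ>\<^sub>f rfn S,
     ryo = (\<lambda>(y, x). on_class (\<lambda>(b, (u, v)).
       Cmp (fcod (rfn R)) (fa (rfn R) (ryo S (b, x) u)) (ryo R (y, b) v)))\<rparr>"

definition rtens :: "('o, 'a, 'p, 'b, 'v) repr \<Rightarrow> ('q, 'c, 'r, 'd, 'w) repr \<Rightarrow>
   ('o \<times> 'q, 'a \<times> 'c, 'p \<times> 'r, 'b \<times> 'd, 'v \<times> 'w) repr" where
  "rtens R S = \<lparr>rpr = rpr R \<otimes> rpr S, rfn = rfn R \<times>\<^sub>f rfn S,
     ryo = (\<lambda>((y, y'), (x, x')). map_prod (ryo R (y, x)) (ryo S (y', x')))\<rparr>"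

definition rsub :: "('p, 'b, 'q, 'c, 'v) repr \<Rightarrow> ('o, 'a, 'p, 'b) functr \<Rightarrow>
   ('o, 'a, 'q, 'c, 'v) repr" where
  "rsub R \<phi> = \<lparr>rpr = rpr R \<triangleleft> \<phi>, rfn = rfn R \<circ>\<^sub>f \<phi>, ryo = (\<lambda>(y, x). ryo R (y, fo \<phi> x))\<rparr>"

lemma repr_simps [simp]:
  "rpr (rrep F) = rep F" "rfn (rrep F) = F" "ryo (rrep F) z = (\<lambda>u. u)"
  by (simp_all add: rrep_def)

lemma rcomp_simps [simp]:
  "rpr (rcomp R S) = rpr R \<odot> rpr S" "rfn (rcomp R S) = rfn R \<circ>\<^sub>f rfn S"
  by (simp_all add: rcomp_def)

lemma rtens_simps [simp]:
  "rpr (rtens R S) = rpr R \<otimes> rpr S" "rfn (rtens R S) = rfn R \<times>\<^sub>f rfn S"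
  "ryo (rtens R S) ((y, y'), (x, x')) = map_prod (ryo R (y, x)) (ryo S (y', x'))"
  by (simp_all add: rtens_def)

lemma rsub_simps [simp]:
  "rpr (rsub R \<phi>) = rpr R \<triangleleft> \<phi>" "rfn (rsub R \<phi>) = rfn R \<circ>\<^sub>f \<phi>"
  "ryo (rsub R \<phi>) (y, x) = ryo R (y, fo \<phi> x)"
  by (simp_all add: rsub_def)

lemma representationD:
  assumes "representation A B R"
  shows "is_functor A B (rfn R)" "profunctor A B (rpr R)"
    "\<And>y x. y \<in> Obj B \<Longrightarrow> x \<in> Obj A \<Longrightarrow>
      bij_betw (ryo R (y, x)) (El (rpr R) (y, x)) (hom B y (fo (rfn R) x))"
    "\<And>y x u. y \<in> Obj B \<Longrightarrow> x \<in> Obj A \<Longrightarrow> u \<in> El (rpr R) (y, x) \<Longrightarrow> ryo R (y, x) u \<in> Arr B"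
    "\<And>y x u. y \<in> Obj B \<Longrightarrow> x \<in> Obj A \<Longrightarrow> u \<in> El (rpr R) (y, x) \<Longrightarrow> Dom B (ryo R (y, x) u) = y"
    "\<And>y x u. y \<in> Obj B \<Longrightarrow> x \<in> Obj A \<Longrightarrow> u \<in> El (rpr R) (y, x) \<Longrightarrow>
      Cod B (ryo R (y, x) u) = fo (rfn R) x"
    "\<And>h f u y x y' x'. h \<in> Arr B \<Longrightarrow> f \<in> Arr A \<Longrightarrow> u \<in> El (rpr R) (y, x) \<Longrightarrow> Cod B h = y \<Longrightarrow>
      Dom A f = x \<Longrightarrow> Dom B h = y' \<Longrightarrow> Cod A f = x' \<Longrightarrow>
      ryo R (y', x') (Act (rpr R) (h, f) u) = Cmp B (fa (rfn R) f) (Cmp B (ryo R (y, x) u) h)"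
proof -
  show bij: "bij_betw (ryo R (y, x)) (El (rpr R) (y, x)) (hom B y (fo (rfn R) x))"
    if "y \<in> Obj B" "x \<in> Obj A" for y x
    using assms that by (simp add: representation_def)
  have "ryo R (y, x) u \<in> hom B y (fo (rfn R) x)"
    if "y \<in> Obj B" "x \<in> Obj A" "u \<in> El (rpr R) (y, x)" for y x u
    using bij_betwE[OF bij] that by blast
  then show "ryo R (y, x) u \<in> Arr B" "Dom B (ryo R (y, x) u) = y"
    "Cod B (ryo R (y, x) u) = fo (rfn R) x"
    if "y \<in> Obj B" "x \<in> Obj A" "u \<in> El (rpr R) (y, x)" for y x u
    using that by (auto simp: hom_iff)
qed (use assms in \<open>auto simp: representation_def\<close>)

lemma representation_inj:
  assumes "representation A B R" "y \<in> Obj B" "x \<in> Obj A" "u \<in> El (rpr R) (y, x)"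
    "u' \<in> El (rpr R) (y, x)" "ryo R (y, x) u = ryo R (y, x) u'"
  shows "u = u'"
  using representationD(3)[OF assms(1-3)] assms(4-) by (auto simp: bij_betw_def dest: inj_onD)

lemma representation_surj:
  assumes "representation A B R" "y \<in> Obj B" "x \<in> Obj A" "k \<in> hom B y (fo (rfn R) x)"
  obtains u where "u \<in> El (rpr R) (y, x)" "ryo R (y, x) u = k"
  using representationD(3)[OF assms(1-3)] assms(4) by (metis bij_betw_imp_surj_on imageE)

lemma representation_rrep:
  assumes "is_functor A B F"
  shows "representation A B (rrep F)"
  using profunctor_rep[OF assms] is_functorD(1-4)[OF assms] assms
  by (simp add: representation_def bij_betw_def)

lemma representation_rtens:
  assumes R: "representation A B R" and S: "representation A' B' S"
  shows "representation (A \<times>\<^sub>c A') (B \<times>\<^sub>c B') (rtens R S)"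
proof -
  note [simp] = representationD(3-7)[OF R] representationD(3-7)[OF S]
  show ?thesis
    unfolding representation_def
    using is_functor_fprod[OF representationD(1)[OF R] representationD(1)[OF S]]
      profunctor_ptens[OF representationD(2)[OF R] representationD(2)[OF S]]
    by (auto intro!: bij_betw_map_prod)
qed

lemma representation_rsub:
  assumes R: "representation B E R" and \<phi>: "is_functor A B \<phi>"
  shows "representation A E (rsub R \<phi>)"
  unfolding representation_def
  using is_functor_fcomp[OF \<phi> representationD(1)[OF R]]
    profunctor_psub[OF representationD(2)[OF R] \<phi>] representationD(3-7)[OF R] is_functorD[OF \<phi>]
  by auto

lemma ryo_rcomp:
  assumes R: "representation B E R" and S: "representation A B S"
    and "y \<in> Obj E" "x \<in> Obj A" "b \<in> Obj B" "u \<in> El (rpr S) (b, x)" "v \<in> El (rpr R) (y, b)"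
  shows "ryo (rcomp R S) (y, x) (pcls (rpr R) (rpr S) (y, x) (b, (u, v))) =
    Cmp E (fa (rfn R) (ryo S (b, x) u)) (ryo R (y, b) v)"
proof -
  note r = representationD[OF R] and s = representationD[OF S]
  note [simp] = r(3-7) s(3-7) profunctorD(1-4)[OF r(2)] profunctorD(1-4)[OF s(2)]
    is_functorD(3-)[OF r(1)] is_functorD(3-)[OF s(1)]
  let ?f = "\<lambda>(b, (u, v)). Cmp E (fa (rfn R) (ryo S (b, x) u)) (ryo R (y, b) v)"
  have "?f (b, (Act (rpr S) (k, Idn A x) u, v)) = ?f (b', (u, Act (rpr R) (Idn E y, k) v))"
    if "k \<in> Arr B" "Dom B k = b" "Cod B k = b'" "u \<in> El (rpr S) (b', x)" "v \<in> El (rpr R) (y, b)"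
    for b b' k u v
    using that assms by (auto simp: Cmp_assoc)
  note f = this
  have "on_class ?f (pcls (rpr R) (rpr S) (y, x) (b, (u, v))) = ?f (b, (u, v))"
    by (rule on_class_pcls[OF s(2) r(2)]) (use assms f in auto)
  with assms show ?thesis by (simp add: rcomp_def)
qed

text \<open>The element \<open>u0\<close> standing for the identity is universal: \<open>u\<close>
  is \<open>u0\<close> acted on by the arrow of \<open>u\<close>. Sliding that arrow onto
  \<open>v\<close> gives every class the first entry \<open>u0\<close>, and the second entry is then
  determined by the composite arrow.\<close>

lemma rcomp_normal_form:
  assumes R: "representation B E R" and S: "representation A B S"
    and yx: "y \<in> Obj E" "x \<in> Obj A" and b: "b \<in> Obj B" "u \<in> El (rpr S) (b, x)" "v \<in> El (rpr R) (y, b)"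
    and u0: "u0 \<in> El (rpr S) (fo (rfn S) x, x)" "ryo S (fo (rfn S) x, x) u0 = Idn B (fo (rfn S) x)"
    and v0: "v0 \<in> El (rpr R) (y, fo (rfn S) x)"
      "ryo R (y, fo (rfn S) x) v0 = Cmp E (fa (rfn R) (ryo S (b, x) u)) (ryo R (y, b) v)"
  shows "pcls (rpr R) (rpr S) (y, x) (b, (u, v)) =
    pcls (rpr R) (rpr S) (y, x) (fo (rfn S) x, (u0, v0))"
proof -
  note r = representationD[OF R] and s = representationD[OF S]
  note [simp] = r(3-7) s(3-7) profunctorD(1-5)[OF r(2)] profunctorD(1-5)[OF s(2)]
    is_functorD(3-)[OF r(1)] is_functorD(3-)[OF s(1)]
  let ?k = "ryo S (b, x) u"
  have k: "?k \<in> Arr B" "Dom B ?k = b" "Cod B ?k = fo (rfn S) x" using assms by auto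
  have "Act (rpr S) (?k, Idn A x) u0 = u"
    by (rule representation_inj[OF S, of b x]) (use assms k in auto)
  moreover have "Act (rpr R) (Idn E y, ?k) v = v0"
    by (rule representation_inj[OF R, of y "fo (rfn S) x"]) (use assms k in auto)
  ultimately show ?thesis
    using pcls_gen[OF s(2) r(2) yx k u0(1) b(3)] by simp
qed

text \<open>Elements with the same arrow have the same normal form, which gives injectivity. For
  surjectivity the universal element \<open>u0\<close> is paired with an element of \<open>R\<close>
  that stands for the given arrow.\<close>

lemma representation_rcomp:
  assumes R: "representation B E R" and S: "representation A B S"
  shows "representation A E (rcomp R S)"
proof -
  note r = representationD[OF R] and s = representationD[OF S]
  note [simp] = r(4-7) s(4-7) profunctorD[OF r(2)] profunctorD[OF s(2)]
    is_functorD[OF r(1)] is_functorD[OF s(1)] ryo_rcomp[OF R S]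
  have bij: "bij_betw (ryo (rcomp R S) (y, x)) (El (rpr R \<odot> rpr S) (y, x))
      (hom E y (fo (rfn R) (fo (rfn S) x)))" if yx: "y \<in> Obj E" "x \<in> Obj A" for y x
  proof -
    obtain u0 where u0: "u0 \<in> El (rpr S) (fo (rfn S) x, x)"
      "ryo S (fo (rfn S) x, x) u0 = Idn B (fo (rfn S) x)"
      using representation_surj[OF S, of "fo (rfn S) x" x "Idn B (fo (rfn S) x)"] yx
      by (auto simp: hom_iff)
    show ?thesis
    proof (rule bij_betw_imageI)
      show "inj_on (ryo (rcomp R S) (y, x)) (El (rpr R \<odot> rpr S) (y, x))"
      proof (rule inj_onI)
      fix X X' assume X: "X \<in> El (rpr R \<odot> rpr S) (y, x)" "X' \<in> El (rpr R \<odot> rpr S) (y, x)"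
        and eq: "ryo (rcomp R S) (y, x) X = ryo (rcomp R S) (y, x) X'"
      obtain b u v where b: "b \<in> Obj B" "u \<in> El (rpr S) (b, x)" "v \<in> El (rpr R) (y, b)"
        "X = pcls (rpr R) (rpr S) (y, x) (b, (u, v))"
        using X(1) by (auto elim!: pcls_cases)
      obtain b' u' v' where b': "b' \<in> Obj B" "u' \<in> El (rpr S) (b', x)" "v' \<in> El (rpr R) (y, b')"
        "X' = pcls (rpr R) (rpr S) (y, x) (b', (u', v'))"
        using X(2) by (auto elim!: pcls_cases)
      have "Cmp E (fa (rfn R) (ryo S (b, x) u)) (ryo R (y, b) v) \<in>
          hom E y (fo (rfn R) (fo (rfn S) x))"
        using b yx by (auto simp: hom_iff)
      then obtain v0 where v0: "v0 \<in> El (rpr R) (y, fo (rfn S) x)"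
        "ryo R (y, fo (rfn S) x) v0 = Cmp E (fa (rfn R) (ryo S (b, x) u)) (ryo R (y, b) v)"
        using representation_surj[OF R, of y "fo (rfn S) x"] yx by auto
      moreover have "Cmp E (fa (rfn R) (ryo S (b, x) u)) (ryo R (y, b) v) =
          Cmp E (fa (rfn R) (ryo S (b', x) u')) (ryo R (y, b') v')"
        using eq b b' yx by simp
      ultimately show "X = X'"
        using rcomp_normal_form[OF R S yx b(1-3) u0 v0]
          rcomp_normal_form[OF R S yx b'(1-3) u0, of v0] b(4) b'(4) by simp
      qed
    next
      show "ryo (rcomp R S) (y, x) ` El (rpr R \<odot> rpr S) (y, x) = hom E y (fo (rfn R) (fo (rfn S) x))"
      proof (intro subset_antisym subsetI)
      fix k assume "k \<in> ryo (rcomp R S) (y, x) ` El (rpr R \<odot> rpr S) (y, x)"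
      then show "k \<in> hom E y (fo (rfn R) (fo (rfn S) x))"
        using yx by (auto elim!: pcls_cases simp: hom_iff)
    next
      fix k assume k: "k \<in> hom E y (fo (rfn R) (fo (rfn S) x))"
      then obtain v0 where v0: "v0 \<in> El (rpr R) (y, fo (rfn S) x)" "ryo R (y, fo (rfn S) x) v0 = k"
        using representation_surj[OF R, of y "fo (rfn S) x"] yx by auto
      then have "ryo (rcomp R S) (y, x) (pcls (rpr R) (rpr S) (y, x) (fo (rfn S) x, (u0, v0))) = k"
        using u0 yx k by (simp add: hom_iff)
      moreover have "pcls (rpr R) (rpr S) (y, x) (fo (rfn S) x, (u0, v0)) \<in> El (rpr R \<odot> rpr S) (y, x)"
        using u0 v0 yx by (intro pcls_in) auto
      ultimately show "k \<in> ryo (rcomp R S) (y, x) ` El (rpr R \<odot> rpr S) (y, x)" by blast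
      qed
    qed
  qed
  have "ryo (rcomp R S) (Dom E h, Cod A f) (Act (rpr R \<odot> rpr S) (h, f) X) =
      Cmp E (fa (rfn R) (fa (rfn S) f)) (Cmp E (ryo (rcomp R S) (Cod E h, Dom A f) X) h)"
    if "h \<in> Arr E" "f \<in> Arr A" "X \<in> El (rpr R \<odot> rpr S) (Cod E h, Dom A f)" for h f X
    using that by (auto elim!: pcls_cases simp: Act_pcomp[OF s(2) r(2)] Cmp_assoc)
  then show ?thesis
    unfolding representation_def
    using is_functor_fcomp[OF s(1) r(1)] profunctor_pcomp[OF s(2) r(2)] bij by simp
qed

text \<open>\<open>\<tau>\<close> corresponds by the Yoneda lemma to the natural transformation \<open>\<theta>\<close> between the representing functors.\<close>

definition represented :: "('o, 'a) cat \<Rightarrow> ('p, 'b) cat \<Rightarrow> ('o, 'a, 'p, 'b, 'v) repr \<Rightarrow>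
   ('o, 'a, 'p, 'b, 'w) repr \<Rightarrow> ('o, 'a, 'p, 'b, 'v, 'w) cell \<Rightarrow> ('o \<Rightarrow> 'b) \<Rightarrow> bool" where
  "represented A B R S \<tau> \<theta> \<longleftrightarrow> representation A B R \<and> representation A B S \<and>
     csrc \<tau> = rpr R \<and> ctgt \<tau> = rpr S \<and>
     (\<forall>x\<in>Obj A. \<theta> x \<in> hom B (fo (rfn R) x) (fo (rfn S) x)) \<and>
     (\<forall>f\<in>Arr A. Cmp B (\<theta> (Cod A f)) (fa (rfn R) f) = Cmp B (fa (rfn S) f) (\<theta> (Dom A f))) \<and>
     (\<forall>y\<in>Obj B. \<forall>x\<in>Obj A. \<forall>u\<in>El (rpr R) (y, x). cmpt \<tau> (y, x) u \<in> El (rpr S) (y, x) \<and>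
        ryo S (y, x) (cmpt \<tau> (y, x) u) = Cmp B (\<theta> x) (ryo R (y, x) u))"

lemma representedD:
  assumes "represented A B R S \<tau> \<theta>"
  shows "representation A B R" "representation A B S" "csrc \<tau> = rpr R" "ctgt \<tau> = rpr S"
    "\<And>x. x \<in> Obj A \<Longrightarrow> \<theta> x \<in> Arr B"
    "\<And>x. x \<in> Obj A \<Longrightarrow> Dom B (\<theta> x) = fo (rfn R) x"
    "\<And>x. x \<in> Obj A \<Longrightarrow> Cod B (\<theta> x) = fo (rfn S) x"
    "\<And>f. f \<in> Arr A \<Longrightarrow> Cmp B (\<theta> (Cod A f)) (fa (rfn R) f) = Cmp B (fa (rfn S) f) (\<theta> (Dom A f))"
    "\<And>y x u. y \<in> Obj B \<Longrightarrow> x \<in> Obj A \<Longrightarrow> u \<in> El (rpr R) (y, x) \<Longrightarrow>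
      cmpt \<tau> (y, x) u \<in> El (rpr S) (y, x)"
    "\<And>y x u. y \<in> Obj B \<Longrightarrow> x \<in> Obj A \<Longrightarrow> u \<in> El (rpr R) (y, x) \<Longrightarrow>
        ryo S (y, x) (cmpt \<tau> (y, x) u) = Cmp B (\<theta> x) (ryo R (y, x) u)"
  using assms by (auto simp: represented_def hom_iff)

section \<open>Calculus of 2-cells between represented profunctors\<close>

lemma represented_two_cell:
  assumes \<tau>: "represented A B R S \<tau> \<theta>"
  shows "two_cell (rpr R) (rpr S) \<tau>"
proof -
  note t = representedD[OF \<tau>]
  note r = representationD[OF t(1)] and s = representationD[OF t(2)]
  note [simp] = t(3-) r(4-7) s(4-7) is_functorD[OF r(1)] is_functorD[OF s(1)]
    profunctorD(5)[OF r(2)] profunctorD(5)[OF s(2)]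
  show ?thesis
  proof (rule two_cellI[OF _ _ r(2) s(2)])
    fix h f u assume h: "h \<in> Arr B" "f \<in> Arr A" "u \<in> El (rpr R) (Cod B h, Dom A f)"
    then have "Cmp B (\<theta> (Cod A f)) (Cmp B (fa (rfn R) f) (Cmp B (ryo R (Cod B h, Dom A f) u) h)) =
        Cmp B (fa (rfn S) f) (Cmp B (\<theta> (Dom A f)) (Cmp B (ryo R (Cod B h, Dom A f) u) h))"
      by (simp flip: Cmp_assoc)
    note nat = this
    have c: "cmpt \<tau> (Cod B h, Dom A f) u \<in> El (rpr S) (Cod B h, Dom A f)"
      using h by (intro t(9)) auto
    \<comment> \<open>As \<open>ryo S\<close> is injective, it suffices to compare arrows, where the
      claim is \<open>nat\<close>.\<close>
    show "cmpt \<tau> (Dom B h, Cod A f) (Act (rpr R) (h, f) u) =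
        Act (rpr S) (h, f) (cmpt \<tau> (Cod B h, Dom A f) u)"
      using h nat profunctorD(5)[OF s(2) _ _ c] s(7)[OF _ _ c]
      by (intro representation_inj[OF t(2), of "Dom B h" "Cod A f"]) (auto simp: Cmp_assoc)
  qed auto
qed

text \<open>This turns the pentagon and the triangle into equations between arrows:
  \<open>ryo S\<close> is injective, so \<theta> determines the components. The targets may differ
  as records because the two sides of the pentagon end in differently placed substitutions.\<close>

lemma represented_eq:
  assumes \<tau>: "represented A B R S \<tau> \<theta>" and \<tau>': "represented A B R S' \<tau>' \<theta>'"
    and S: "\<And>y x. y \<in> Obj B \<Longrightarrow> x \<in> Obj A \<Longrightarrow> El (rpr S') (y, x) = El (rpr S) (y, x)"
      "\<And>y x. y \<in> Obj B \<Longrightarrow> x \<in> Obj A \<Longrightarrow> ryo S' (y, x) = ryo S (y, x)"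
    and \<theta>: "\<And>x. x \<in> Obj A \<Longrightarrow> \<theta>' x = \<theta> x"
  shows "\<tau> \<doteq> \<tau>'"
proof -
  note t = representedD[OF \<tau>] and t' = representedD[OF \<tau>']
  have "cmpt \<tau> (y, x) u = cmpt \<tau>' (y, x) u"
    if "y \<in> Obj B" "x \<in> Obj A" "u \<in> El (rpr R) (y, x)" for y x u
    using that t(9,10)[OF that] t'(9,10)[OF that] S \<theta> by (intro representation_inj[OF t(2)]) auto
  then show ?thesis
    using profunctorD(3,4)[OF representationD(2)[OF t(1)]] by (auto simp: cell_eq_def t(3))
qed

lemma represented_idc:
  assumes R: "representation A B R"
  shows "represented A B R R (idc (rpr R)) (\<lambda>x. Idn B (fo (rfn R) x))"
  unfolding represented_def
  using R representationD[OF R] is_functorD[OF representationD(1)[OF R]] by (auto simp: hom_iff)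

text \<open>
  \<open>S\<close> and \<open>S'\<close> are not required to be equal, since \<open>(G \<odot> F) \<triangleleft> \<phi>\<close> and \<open>G \<odot> (F \<triangleleft> \<phi>)\<close> agree only at objects and
  arrows of the categories.
\<close>

lemma represented_vcomp:
  assumes \<tau>: "represented A B S' T \<tau> \<theta>'" and \<sigma>: "represented A B R S \<sigma> \<theta>"
    and S: "\<And>y x. y \<in> Obj B \<Longrightarrow> x \<in> Obj A \<Longrightarrow> El (rpr S') (y, x) = El (rpr S) (y, x)"
      "\<And>y x. y \<in> Obj B \<Longrightarrow> x \<in> Obj A \<Longrightarrow> ryo S' (y, x) = ryo S (y, x)"
      "\<And>x. x \<in> Obj A \<Longrightarrow> fo (rfn S') x = fo (rfn S) x"
      "\<And>f. f \<in> Arr A \<Longrightarrow> fa (rfn S') f = fa (rfn S) f"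
  shows "represented A B R T (\<tau> \<bullet> \<sigma>) (\<lambda>x. Cmp B (\<theta>' x) (\<theta> x))"
proof -
  note t = representedD[OF \<tau>] and s = representedD[OF \<sigma>]
  note r = representationD[OF s(1)] and r' = representationD[OF t(1)] and r'' = representationD[OF t(2)]
  note [simp] = t(3-7,9,10) s(3-7,9,10) is_functorD[OF r(1)] is_functorD[OF r'(1)] is_functorD[OF r''(1)]
    r(4-6)
  have "Cmp B (Cmp B (\<theta>' (Cod A f)) (\<theta> (Cod A f))) (fa (rfn R) f) =
      Cmp B (fa (rfn T) f) (Cmp B (\<theta>' (Dom A f)) (\<theta> (Dom A f)))" if f: "f \<in> Arr A" for f
  proof -
    have "Cmp B (Cmp B (\<theta>' (Cod A f)) (\<theta> (Cod A f))) (fa (rfn R) f) =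
        Cmp B (\<theta>' (Cod A f)) (Cmp B (fa (rfn S) f) (\<theta> (Dom A f)))"
      using f S(3) s(8)[OF f] by (simp add: Cmp_assoc)
    also have "\<dots> = Cmp B (Cmp B (\<theta>' (Cod A f)) (fa (rfn S') f)) (\<theta> (Dom A f))"
      using f S(3,4) is_functorD(6-8)[OF representationD(1)[OF s(2)] f] by (simp add: Cmp_assoc)
    also have "\<dots> = Cmp B (fa (rfn T) f) (Cmp B (\<theta>' (Dom A f)) (\<theta> (Dom A f)))"
      unfolding t(8)[OF f] using f S(3) by (simp add: Cmp_assoc)
    finally show ?thesis .
  qed
  moreover have "ryo T (y, x) (cmpt \<tau> (y, x) (cmpt \<sigma> (y, x) u)) =
      Cmp B (Cmp B (\<theta>' x) (\<theta> x)) (ryo R (y, x) u)"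
    if "y \<in> Obj B" "x \<in> Obj A" "u \<in> El (rpr R) (y, x)" for y x u
    using that S t(10)[of y x "cmpt \<sigma> (y, x) u"] by (auto simp: Cmp_assoc)
  ultimately show ?thesis
    unfolding represented_def using s(1) t(2) S by (auto simp: hom_iff)
qed

lemma represented_csub:
  assumes \<tau>: "represented B E R S \<tau> \<theta>" and \<phi>: "is_functor A B \<phi>"
  shows "represented A E (rsub R \<phi>) (rsub S \<phi>) (\<tau> \<lhd> \<phi>) (\<lambda>x. \<theta> (fo \<phi> x))"
proof -
  note t = representedD[OF \<tau>]
  have "Cmp E (\<theta> (fo \<phi> (Cod A f))) (fa (rfn R) (fa \<phi> f)) =
      Cmp E (fa (rfn S) (fa \<phi> f)) (\<theta> (fo \<phi> (Dom A f)))" if "f \<in> Arr A" for f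
    using t(8)[of "fa \<phi> f"] that by (simp add: is_functorD[OF \<phi>])
  then show ?thesis
    unfolding represented_def
    using representation_rsub[OF t(1) \<phi>] representation_rsub[OF t(2) \<phi>] t(3-7,9,10) is_functorD[OF \<phi>]
    by (auto simp: hom_iff)
qed

lemma represented_ctens:
  assumes \<tau>: "represented A B R S \<tau> \<theta>" and \<sigma>: "represented A' B' R' S' \<sigma> \<theta>'"
  shows "represented (A \<times>\<^sub>c A') (B \<times>\<^sub>c B') (rtens R R') (rtens S S') (\<tau> \<boxtimes> \<sigma>)
    (\<lambda>(x, x'). (\<theta> x, \<theta>' x'))"
  unfolding represented_def
  using representedD[OF \<tau>] representedD[OF \<sigma>] by (auto simp: hom_iff intro!: representation_rtens)

text \<open>The transformation is the Godement product. On a representative, \<theta> appears at the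
  intermediate object \<open>b\<close>; naturality of \<theta> at the arrow of \<open>u\<close>
  moves it to \<open>fo (rfn S) x\<close>.\<close>

lemma represented_hcomp:
  assumes \<tau>: "represented B E R R' \<tau> \<theta>" and \<sigma>: "represented A B S S' \<sigma> \<theta>'"
  shows "represented A E (rcomp R S) (rcomp R' S') (\<tau> \<star> \<sigma>)
    (\<lambda>x. Cmp E (fa (rfn R') (\<theta>' x)) (\<theta> (fo (rfn S) x)))"
proof -
  note t = representedD[OF \<tau>] and s = representedD[OF \<sigma>]
  note r = representationD[OF t(1)] and r' = representationD[OF t(2)]
    and p = representationD[OF s(1)] and p' = representationD[OF s(2)]
  note rc = representation_rcomp[OF t(1) s(1)] representation_rcomp[OF t(2) s(2)]
  note two = represented_two_cell[OF \<tau>] represented_two_cell[OF \<sigma>]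
  note [simp] = t(3-7,9,10) s(3-7,9,10) is_functorD[OF r(1)] is_functorD[OF r'(1)]
    is_functorD[OF p(1)] is_functorD[OF p'(1)] r(4-6) p(4-6) r'(4-6) p'(4-6)
    profunctorD(1-4)[OF r(2)] profunctorD(1-4)[OF p(2)] profunctorD(1-4)[OF r'(2)]
    profunctorD(1-4)[OF p'(2)]
    ryo_rcomp[OF t(1) s(1)] ryo_rcomp[OF t(2) s(2)] hcomp_pcls[OF p(2) r(2) two]
  have nat: "Cmp E (Cmp E (fa (rfn R') (\<theta>' (Cod A f))) (\<theta> (fo (rfn S) (Cod A f)))) (fa (rfn R) (fa (rfn S) f)) =
      Cmp E (fa (rfn R') (fa (rfn S') f)) (Cmp E (fa (rfn R') (\<theta>' (Dom A f))) (\<theta> (fo (rfn S) (Dom A f))))"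
    if f: "f \<in> Arr A" for f
  proof -
    have "Cmp E (\<theta> (fo (rfn S) (Cod A f))) (fa (rfn R) (fa (rfn S) f)) =
        Cmp E (fa (rfn R') (fa (rfn S) f)) (\<theta> (fo (rfn S) (Dom A f)))"
      using t(8)[of "fa (rfn S) f"] f by simp
    moreover have "Cmp E (fa (rfn R') (\<theta>' (Cod A f))) (fa (rfn R') (fa (rfn S) f)) =
        Cmp E (fa (rfn R') (fa (rfn S') f)) (fa (rfn R') (\<theta>' (Dom A f)))"
      using arg_cong[OF s(8)[OF f], of "fa (rfn R')"] f by simp
    ultimately show ?thesis using f by (simp add: Cmp_assoc) (simp flip: Cmp_assoc)
  qed
  have val: "Cmp E (fa (rfn R') (Cmp B (\<theta>' x) (ryo S (b, x) u))) (Cmp E (\<theta> b) (ryo R (y, b) v)) =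
      Cmp E (Cmp E (fa (rfn R') (\<theta>' x)) (\<theta> (fo (rfn S) x)))
        (Cmp E (fa (rfn R) (ryo S (b, x) u)) (ryo R (y, b) v))"
    if m: "y \<in> Obj E" "x \<in> Obj A" "b \<in> Obj B" "u \<in> El (rpr S) (b, x)" "v \<in> El (rpr R) (y, b)"
    for y x b u v
  proof -
    have "Cmp E (\<theta> (fo (rfn S) x)) (fa (rfn R) (ryo S (b, x) u)) =
        Cmp E (fa (rfn R') (ryo S (b, x) u)) (\<theta> b)"
      using t(8)[of "ryo S (b, x) u"] m by simp
    then have "Cmp E (\<theta> (fo (rfn S) x)) (Cmp E (fa (rfn R) (ryo S (b, x) u)) (ryo R (y, b) v)) =
        Cmp E (fa (rfn R') (ryo S (b, x) u)) (Cmp E (\<theta> b) (ryo R (y, b) v))"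
      using m by (simp flip: Cmp_assoc)
    then show ?thesis using m by (simp add: Cmp_assoc)
  qed
  have "cmpt (\<tau> \<star> \<sigma>) (y, x) X \<in> El (rpr R' \<odot> rpr S') (y, x) \<and>
      ryo (rcomp R' S') (y, x) (cmpt (\<tau> \<star> \<sigma>) (y, x) X) =
      Cmp E (Cmp E (fa (rfn R') (\<theta>' x)) (\<theta> (fo (rfn S) x))) (ryo (rcomp R S) (y, x) X)"
    if "y \<in> Obj E" "x \<in> Obj A" "X \<in> El (rpr R \<odot> rpr S) (y, x)" for y x X
    using that(3)
  proof (rule pcls_cases)
    fix b u v assume "b \<in> Obj (ptgt (rpr S))" "u \<in> El (rpr S) (b, x)" "v \<in> El (rpr R) (y, b)"
      "X = pcls (rpr R) (rpr S) (y, x) (b, (u, v))"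
    with that val show ?thesis by (auto intro!: pcls_in)
  qed
  then show ?thesis
    unfolding represented_def using rc nat by (auto simp: hom_iff)
qed

text \<open>Under the bijections with hom sets the component is postcomposition with \<theta> x,
  which postcomposition with \<theta>' x inverts.\<close>

lemma represented_bij:
  assumes \<tau>: "represented A B R S \<tau> \<theta>" and \<theta>': "\<And>x. x \<in> Obj A \<Longrightarrow> \<theta>' x \<in> hom B (fo (rfn S) x) (fo (rfn R) x)"
      "\<And>x. x \<in> Obj A \<Longrightarrow> Cmp B (\<theta>' x) (\<theta> x) = Idn B (fo (rfn R) x)"
      "\<And>x. x \<in> Obj A \<Longrightarrow> Cmp B (\<theta> x) (\<theta>' x) = Idn B (fo (rfn S) x)"
    and yx: "y \<in> Obj B" "x \<in> Obj A"
  shows "bij_betw (cmpt \<tau> (y, x)) (El (rpr R) (y, x)) (El (rpr S) (y, x))"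
proof -
  note t = representedD[OF \<tau>]
  note r = representationD[OF t(1)] and s = representationD[OF t(2)]
  note [simp] = is_functorD[OF r(1)] is_functorD[OF s(1)] t(5-7,9,10) r(4-6) s(4-6)
  have th: "\<theta>' x \<in> Arr B" "Dom B (\<theta>' x) = fo (rfn S) x" "Cod B (\<theta>' x) = fo (rfn R) x"
    using \<theta>'(1)[OF yx(2)] by (auto simp: hom_iff)
  have inv: "ryo R (y, x) u = Cmp B (\<theta>' x) (ryo S (y, x) (cmpt \<tau> (y, x) u))"
    if "u \<in> El (rpr R) (y, x)" for u
    using that yx th \<theta>'(2) by (simp flip: Cmp_assoc)
  show ?thesis
  proof (rule bij_betw_imageI)
    show "inj_on (cmpt \<tau> (y, x)) (El (rpr R) (y, x))"
      using inv yx by (intro inj_onI) (metis representation_inj[OF t(1)])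
    have "w \<in> cmpt \<tau> (y, x) ` El (rpr R) (y, x)" if w: "w \<in> El (rpr S) (y, x)" for w
    proof -
      obtain u where u: "u \<in> El (rpr R) (y, x)" "ryo R (y, x) u = Cmp B (\<theta>' x) (ryo S (y, x) w)"
        using representation_surj[OF t(1) yx, of "Cmp B (\<theta>' x) (ryo S (y, x) w)"] yx th w
        by (auto simp: hom_iff)
      have "ryo S (y, x) (cmpt \<tau> (y, x) u) = ryo S (y, x) w"
        using u yx th w \<theta>'(3) by (simp flip: Cmp_assoc)
      then have "cmpt \<tau> (y, x) u = w"
        using representation_inj[OF t(2) yx] u w yx by simp
      then show ?thesis using u by blast
    qed
    then show "cmpt \<tau> (y, x) ` El (rpr R) (y, x) = El (rpr S) (y, x)"
      using yx by auto
  qed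
qed

lemma represented_cinv:
  assumes \<tau>: "represented A B R S \<tau> \<theta>" and \<theta>': "\<And>x. x \<in> Obj A \<Longrightarrow> \<theta>' x \<in> hom B (fo (rfn S) x) (fo (rfn R) x)"
      "\<And>x. x \<in> Obj A \<Longrightarrow> Cmp B (\<theta>' x) (\<theta> x) = Idn B (fo (rfn R) x)"
      "\<And>x. x \<in> Obj A \<Longrightarrow> Cmp B (\<theta> x) (\<theta>' x) = Idn B (fo (rfn S) x)"
  shows "represented A B S R (cinv \<tau>) \<theta>'"
proof -
  note t = representedD[OF \<tau>]
  note r = representationD[OF t(1)] and s = representationD[OF t(2)]
  note [simp] = is_functorD[OF r(1)] is_functorD[OF s(1)] t(3-7,9,10) r(4-6) s(4-6)
  have th: "\<theta>' x \<in> Arr B" "Dom B (\<theta>' x) = fo (rfn S) x" "Cod B (\<theta>' x) = fo (rfn R) x"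
    if "x \<in> Obj A" for x
    using \<theta>'(1)[OF that] by (auto simp: hom_iff)
  have val: "cmpt (cinv \<tau>) (y, x) w \<in> El (rpr R) (y, x) \<and>
      ryo R (y, x) (cmpt (cinv \<tau>) (y, x) w) = Cmp B (\<theta>' x) (ryo S (y, x) w)"
    if yx: "y \<in> Obj B" "x \<in> Obj A" and w: "w \<in> El (rpr S) (y, x)" for y x w
  proof -
    note bij = represented_bij[OF \<tau> \<theta>' yx]
    obtain u where u: "u \<in> El (rpr R) (y, x)" "cmpt \<tau> (y, x) u = w"
      using bij w by (metis bij_betw_imp_surj_on imageE)
    have "cmpt (cinv \<tau>) (y, x) w = u"
      using bij u by (intro cinv_cmpt) (auto simp: bij_betw_def)
    moreover have "ryo R (y, x) u = Cmp B (\<theta>' x) (ryo S (y, x) (cmpt \<tau> (y, x) u))"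
      using u(1) yx th \<theta>'(2) by (simp flip: Cmp_assoc)
    ultimately show ?thesis using u by simp
  qed
  have nat: "Cmp B (\<theta>' (Cod A f)) (fa (rfn S) f) = Cmp B (fa (rfn R) f) (\<theta>' (Dom A f))"
    if f: "f \<in> Arr A" for f
  proof -
    have A: "category A" using is_functorD(1)[OF r(1)] .
    \<comment> \<open>Insert \<theta> after \<theta>' on the right, apply naturality of \<theta>,
      and cancel \<theta>' after \<theta> on the left.\<close>
    have "Cmp B (\<theta>' (Cod A f)) (fa (rfn S) f) =
        Cmp B (\<theta>' (Cod A f)) (Cmp B (fa (rfn S) f) (Cmp B (\<theta> (Dom A f)) (\<theta>' (Dom A f))))"
      using f \<theta>'(3)[of "Dom A f"] th by simp
    also have "\<dots> = Cmp B (\<theta>' (Cod A f)) (Cmp B (Cmp B (fa (rfn S) f) (\<theta> (Dom A f))) (\<theta>' (Dom A f)))"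
      using f th by (simp add: Cmp_assoc)
    also have "\<dots> = Cmp B (Cmp B (\<theta>' (Cod A f)) (\<theta> (Cod A f))) (Cmp B (fa (rfn R) f) (\<theta>' (Dom A f)))"
      unfolding t(8)[OF f, symmetric] using f th by (simp add: Cmp_assoc)
    also have "\<dots> = Cmp B (fa (rfn R) f) (\<theta>' (Dom A f))"
      using f th \<theta>'(2)[of "Cod A f"] by simp
    finally show ?thesis .
  qed
  show ?thesis
    unfolding represented_def using t(1,2) \<theta>'(1) nat val by auto
qed

lemma represented_invertible:
  assumes "represented A B R S \<tau> \<theta>" "\<And>x. x \<in> Obj A \<Longrightarrow> iso_arrow B (\<theta> x)"
  shows "invertible_cell (rpr R) (rpr S) \<tau>"
proof -
  note t = representedD[OF assms(1)]
  define \<theta>' where "\<theta>' x = (SOME g. inverse_arrows B (\<theta> x) g)" for x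
  have "inverse_arrows B (\<theta> x) (\<theta>' x)" if "x \<in> Obj A" for x
    unfolding \<theta>'_def using assms(2)[OF that] by (auto simp: iso_arrow_def intro: someI)
  then have th: "\<And>x. x \<in> Obj A \<Longrightarrow> \<theta>' x \<in> hom B (fo (rfn S) x) (fo (rfn R) x)"
      "\<And>x. x \<in> Obj A \<Longrightarrow> Cmp B (\<theta>' x) (\<theta> x) = Idn B (fo (rfn R) x)"
      "\<And>x. x \<in> Obj A \<Longrightarrow> Cmp B (\<theta> x) (\<theta>' x) = Idn B (fo (rfn S) x)"
    using t(6,7) by (auto simp: inverse_arrows_def)
  show ?thesis
    by (rule invertible_cellI[OF represented_two_cell[OF assms(1)] representationD(2)[OF t(1)]])
      (rule represented_bij[OF assms(1) th])
qed

text \<open>A criterion for structural cells: they do not change the arrow that an element stands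
  for. The two representing functors agree on the objects and arrows of \<open>A\<close> but may
  differ as records, so the identities are written at \<open>rfn R\<close>.\<close>

lemma represented_identity:
  assumes R: "representation A B R" and S: "representation A B S"
    and "csrc \<tau> = rpr R" "ctgt \<tau> = rpr S"
    and fo: "\<And>x. x \<in> Obj A \<Longrightarrow> fo (rfn S) x = fo (rfn R) x"
    and fa: "\<And>f. f \<in> Arr A \<Longrightarrow> fa (rfn S) f = fa (rfn R) f"
    and v: "\<And>y x u. y \<in> Obj B \<Longrightarrow> x \<in> Obj A \<Longrightarrow> u \<in> El (rpr R) (y, x) \<Longrightarrow>
      cmpt \<tau> (y, x) u \<in> El (rpr S) (y, x) \<and> ryo S (y, x) (cmpt \<tau> (y, x) u) = ryo R (y, x) u"
  shows "represented A B R S \<tau> (\<lambda>x. Idn B (fo (rfn R) x))"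
  unfolding represented_def using assms is_functorD[OF representationD(1)[OF R]] representationD(4-6)[OF R]
  by (simp add: hom_iff)

lemma represented_cinv_identity:
  assumes \<tau>: "represented A B R S \<tau> (\<lambda>x. Idn B (fo (rfn R) x))"
  shows "represented A B S R (cinv \<tau>) (\<lambda>x. Idn B (fo (rfn S) x))"
proof -
  note t = representedD[OF \<tau>]
  note [simp] = is_functorD[OF representationD(1)[OF t(1)]]
  have "fo (rfn S) x = fo (rfn R) x" if "x \<in> Obj A" for x
    using t(7)[OF that] that by simp
  then show ?thesis
    by (intro represented_cinv[OF \<tau>]) (auto simp: hom_iff)
qed

lemma represented_cong:
  assumes "represented A B R S \<tau> \<theta>" and "\<And>x. x \<in> Obj A \<Longrightarrow> \<theta> x = \<theta>' x"
  shows "represented A B R S \<tau> \<theta>'"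
proof -
  have "Dom A f \<in> Obj A \<and> Cod A f \<in> Obj A" if "f \<in> Arr A" for f
    using that is_functorD(1)[OF representationD(1)[OF representedD(1)[OF assms(1)]]] by simp
  then show ?thesis using assms by (simp add: represented_def)
qed

lemma represented_vcomp_identity:
  assumes \<tau>: "represented A B S T \<tau> (\<lambda>x. Idn B (fo (rfn S) x))"
    and \<sigma>: "represented A B R S \<sigma> (\<lambda>x. Idn B (fo (rfn R) x))"
  shows "represented A B R T (\<tau> \<bullet> \<sigma>) (\<lambda>x. Idn B (fo (rfn R) x))"
proof -
  note s = representedD[OF \<sigma>]
  note [simp] = is_functorD[OF representationD(1)[OF s(1)]]
  have "fo (rfn S) x = fo (rfn R) x" if "x \<in> Obj A" for x
    using s(7)[OF that] that by simp
  then show ?thesis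
    by (intro represented_cong[OF represented_vcomp[OF \<tau> \<sigma>]]) auto
qed

lemma represented_ctens_identity:
  assumes \<tau>: "represented A B R S \<tau> (\<lambda>x. Idn B (fo (rfn R) x))"
    and \<sigma>: "represented A' B' R' S' \<sigma> (\<lambda>x. Idn B' (fo (rfn R') x))"
  shows "represented (A \<times>\<^sub>c A') (B \<times>\<^sub>c B') (rtens R R') (rtens S S') (\<tau> \<boxtimes> \<sigma>)
    (\<lambda>x. Idn (B \<times>\<^sub>c B') (fo (rfn (rtens R R')) x))"
  by (intro represented_cong[OF represented_ctens[OF \<tau> \<sigma>]]) auto

section \<open>Structural 2-cells\<close>

text \<open>Both bracketings of a triple stand for the same composite arrow, by functoriality of
  \<open>rfn R\<close> and associativity in \<open>E\<close>.\<close>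

lemma represented_passoc:
  assumes R: "representation C E R" and S: "representation B C S" and T: "representation A B T"
  shows "represented A E (rcomp (rcomp R S) T) (rcomp R (rcomp S T))
    (passoc (rpr R) (rpr S) (rpr T)) (\<lambda>x. Idn E (fo (rfn (rcomp (rcomp R S) T)) x))"
proof (rule represented_identity)
  note r = representationD[OF R] and s = representationD[OF S] and t = representationD[OF T]
  show rst: "representation A E (rcomp (rcomp R S) T)" "representation A E (rcomp R (rcomp S T))"
    by (rule representation_rcomp[OF representation_rcomp[OF R S] T],
        rule representation_rcomp[OF R representation_rcomp[OF S T]])
  note [simp] = r(4-6) s(4-6) t(4-6) is_functorD[OF r(1)] is_functorD[OF s(1)] is_functorD[OF t(1)]
    ryo_rcomp[OF R S] ryo_rcomp[OF S T] ryo_rcomp[OF R representation_rcomp[OF S T], simplified]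
    ryo_rcomp[OF representation_rcomp[OF R S] T, simplified] profunctorD(1-4)[OF r(2)]
    profunctorD(1-4)[OF s(2)] profunctorD(1-4)[OF t(2)] passoc_pcls[OF t(2) s(2) r(2)]
  fix y x X assume "y \<in> Obj E" "x \<in> Obj A" "X \<in> El (rpr (rcomp (rcomp R S) T)) (y, x)"
  then show "cmpt (passoc (rpr R) (rpr S) (rpr T)) (y, x) X \<in> El (rpr (rcomp R (rcomp S T))) (y, x) \<and>
      ryo (rcomp R (rcomp S T)) (y, x) (cmpt (passoc (rpr R) (rpr S) (rpr T)) (y, x) X) =
      ryo (rcomp (rcomp R S) T) (y, x) X"
    by (auto elim!: pcls_cases intro!: pcls_in simp: Cmp_assoc pcls_in)
qed simp_all

lemma rep_fid [simp]: "rep (fid A) = pid A"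
  by (simp add: pid_def)

lemma represented_plunit:
  assumes R: "representation A B R"
  shows "represented A B (rcomp (rrep (fid B)) R) R (plunit (rpr R))
    (\<lambda>x. Idn B (fo (rfn (rcomp (rrep (fid B)) R)) x))"
proof (rule represented_identity)
  note r = representationD[OF R]
  have I: "representation B B (rrep (fid B))"
    using is_functorD[OF r(1)] by (intro representation_rrep) simp
  show "representation A B (rcomp (rrep (fid B)) R)"
    using representation_rcomp I R by blast
  note [simp] = r(4-7) is_functorD[OF r(1)] profunctorD(1-5)[OF r(2)] ryo_rcomp[OF I R, simplified]
    plunit_pcls[OF r(2)] hom_iff
  show "csrc (plunit (rpr R)) = rpr (rcomp (rrep (fid B)) R)" by simp
  fix y x X assume "y \<in> Obj B" "x \<in> Obj A" "X \<in> El (rpr (rcomp (rrep (fid B)) R)) (y, x)"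
  then show "cmpt (plunit (rpr R)) (y, x) X \<in> El (rpr R) (y, x) \<and>
      ryo R (y, x) (cmpt (plunit (rpr R)) (y, x) X) = ryo (rcomp (rrep (fid B)) R) (y, x) X"
    by (auto elim!: pcls_cases simp: Cmp_assoc pcls_in)
qed (use R in simp_all)

lemma represented_prunit:
  assumes R: "representation A B R"
  shows "represented A B (rcomp R (rrep (fid A))) R (prunit (rpr R))
    (\<lambda>x. Idn B (fo (rfn (rcomp R (rrep (fid A)))) x))"
proof (rule represented_identity)
  note r = representationD[OF R]
  have I: "representation A A (rrep (fid A))"
    using is_functorD[OF r(1)] by (intro representation_rrep) simp
  show "representation A B (rcomp R (rrep (fid A)))"
    using representation_rcomp I R by blast
  note [simp] = r(4-7) is_functorD[OF r(1)] profunctorD(1-5)[OF r(2)] ryo_rcomp[OF R I, simplified]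
    prunit_pcls[OF r(2)] hom_iff
  show "csrc (prunit (rpr R)) = rpr (rcomp R (rrep (fid A)))" by simp
  fix y x X assume "y \<in> Obj B" "x \<in> Obj A" "X \<in> El (rpr (rcomp R (rrep (fid A)))) (y, x)"
  then show "cmpt (prunit (rpr R)) (y, x) X \<in> El (rpr R) (y, x) \<and>
      ryo R (y, x) (cmpt (prunit (rpr R)) (y, x) X) = ryo (rcomp R (rrep (fid A))) (y, x) X"
    by (auto elim!: pcls_cases simp: Cmp_assoc pcls_in)
qed (use R in simp_all)

lemma represented_interchange:
  assumes R: "representation B E R" and S: "representation A B S"
    and R': "representation B' E' R'" and S': "representation A' B' S'"
  shows "represented (A \<times>\<^sub>c A') (E \<times>\<^sub>c E') (rcomp (rtens R R') (rtens S S'))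
    (rtens (rcomp R S) (rcomp R' S')) (interchange (rpr R) (rpr R') (rpr S) (rpr S'))
    (\<lambda>x. Idn (E \<times>\<^sub>c E') (fo (rfn (rcomp (rtens R R') (rtens S S'))) x))"
proof (rule represented_identity)
  note r = representationD[OF R] and s = representationD[OF S]
    and r' = representationD[OF R'] and s' = representationD[OF S']
  note RR = representation_rtens[OF R R'] and SS = representation_rtens[OF S S']
  show "representation (A \<times>\<^sub>c A') (E \<times>\<^sub>c E') (rcomp (rtens R R') (rtens S S'))"
    by (rule representation_rcomp[OF RR SS])
  show "representation (A \<times>\<^sub>c A') (E \<times>\<^sub>c E') (rtens (rcomp R S) (rcomp R' S'))"
    by (intro representation_rtens representation_rcomp[OF R S] representation_rcomp[OF R' S'])
  note [simp] = r(4-6) s(4-6) r'(4-6) s'(4-6) is_functorD[OF r(1)] is_functorD[OF s(1)]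
    is_functorD[OF r'(1)] is_functorD[OF s'(1)] profunctorD(1-4)[OF r(2)]
    profunctorD(1-4)[OF s(2)] profunctorD(1-4)[OF r'(2)] profunctorD(1-4)[OF s'(2)]
    ryo_rcomp[OF R S] ryo_rcomp[OF R' S'] ryo_rcomp[OF RR SS, simplified]
    interchange_pcls[OF s(2) r(2) s'(2) r'(2)]
  show "fo (rfn (rtens (rcomp R S) (rcomp R' S'))) x = fo (rfn (rcomp (rtens R R') (rtens S S'))) x"
    for x by (cases x) simp
  show "fa (rfn (rtens (rcomp R S) (rcomp R' S'))) f = fa (rfn (rcomp (rtens R R') (rtens S S'))) f"
    for f by (cases f) simp
  fix y x X assume "y \<in> Obj (E \<times>\<^sub>c E')" "x \<in> Obj (A \<times>\<^sub>c A')"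
    "X \<in> El (rpr (rcomp (rtens R R') (rtens S S'))) (y, x)"
  then show "cmpt (interchange (rpr R) (rpr R') (rpr S) (rpr S')) (y, x) X \<in>
        El (rpr (rtens (rcomp R S) (rcomp R' S'))) (y, x) \<and>
      ryo (rtens (rcomp R S) (rcomp R' S')) (y, x)
        (cmpt (interchange (rpr R) (rpr R') (rpr S) (rpr S')) (y, x) X) =
      ryo (rcomp (rtens R R') (rtens S S')) (y, x) X"
    by (auto elim!: pcls_cases intro!: pcls_in)
qed simp_all

text \<open>Rebracketing does not affect the arrow: on both sides \<open>rfn R\<close> is applied to
  the same three arrows, grouped in the same way once \<open>fassoc\<close> has acted.\<close>

lemma represented_assoc_natural:
  assumes R: "representation (B1 \<times>\<^sub>c (B2 \<times>\<^sub>c B3)) E R" and S1: "representation A1 B1 S1"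
    and S2: "representation A2 B2 S2" and S3: "representation A3 B3 S3"
  shows "represented ((A1 \<times>\<^sub>c A2) \<times>\<^sub>c A3) E
    (rcomp (rsub R (fassoc B1 B2 B3)) (rtens (rtens S1 S2) S3))
    (rsub (rcomp R (rtens S1 (rtens S2 S3))) (fassoc A1 A2 A3))
    (assoc_natural (rpr R) (rpr S1) (rpr S2) (rpr S3))
    (\<lambda>x. Idn E (fo (rfn (rcomp (rsub R (fassoc B1 B2 B3)) (rtens (rtens S1 S2) S3))) x))"
proof (rule represented_identity)
  note r = representationD[OF R] and s1 = representationD[OF S1]
    and s2 = representationD[OF S2] and s3 = representationD[OF S3]
  note [simp] = is_functorD[OF r(1)] is_functorD[OF s1(1)] is_functorD[OF s2(1)] is_functorD[OF s3(1)]
  have R': "representation ((B1 \<times>\<^sub>c B2) \<times>\<^sub>c B3) E (rsub R (fassoc B1 B2 B3))"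
    by (intro representation_rsub[OF R]) simp
  have T: "representation ((A1 \<times>\<^sub>c A2) \<times>\<^sub>c A3) ((B1 \<times>\<^sub>c B2) \<times>\<^sub>c B3) (rtens (rtens S1 S2) S3)"
    "representation (A1 \<times>\<^sub>c (A2 \<times>\<^sub>c A3)) (B1 \<times>\<^sub>c (B2 \<times>\<^sub>c B3)) (rtens S1 (rtens S2 S3))"
    by (intro representation_rtens S1 S2 S3)+
  show "representation ((A1 \<times>\<^sub>c A2) \<times>\<^sub>c A3) E
      (rcomp (rsub R (fassoc B1 B2 B3)) (rtens (rtens S1 S2) S3))"
    by (rule representation_rcomp[OF R' T(1)])
  show "representation ((A1 \<times>\<^sub>c A2) \<times>\<^sub>c A3) E
      (rsub (rcomp R (rtens S1 (rtens S2 S3))) (fassoc A1 A2 A3))"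
    by (rule representation_rsub[OF representation_rcomp[OF R T(2)]]) simp
  note [simp] = r(4-6) s1(4-6) s2(4-6) s3(4-6) profunctorD(1-4)[OF r(2)]
    profunctorD(1-4)[OF s1(2)] profunctorD(1-4)[OF s2(2)] profunctorD(1-4)[OF s3(2)]
    ryo_rcomp[OF R T(2), simplified] ryo_rcomp[OF R' T(1), simplified]
    assoc_natural_pcls[OF s1(2) s2(2) s3(2) r(2)]
  show "fo (rfn (rsub (rcomp R (rtens S1 (rtens S2 S3))) (fassoc A1 A2 A3))) x =
      fo (rfn (rcomp (rsub R (fassoc B1 B2 B3)) (rtens (rtens S1 S2) S3))) x"
    if "x \<in> Obj ((A1 \<times>\<^sub>c A2) \<times>\<^sub>c A3)" for x
    using that by auto
  show "fa (rfn (rsub (rcomp R (rtens S1 (rtens S2 S3))) (fassoc A1 A2 A3))) x =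
      fa (rfn (rcomp (rsub R (fassoc B1 B2 B3)) (rtens (rtens S1 S2) S3))) x"
    if "x \<in> Arr ((A1 \<times>\<^sub>c A2) \<times>\<^sub>c A3)" for x
    using that by auto
  show "csrc (assoc_natural (rpr R) (rpr S1) (rpr S2) (rpr S3)) =
      rpr (rcomp (rsub R (fassoc B1 B2 B3)) (rtens (rtens S1 S2) S3))"
    "ctgt (assoc_natural (rpr R) (rpr S1) (rpr S2) (rpr S3)) =
      rpr (rsub (rcomp R (rtens S1 (rtens S2 S3))) (fassoc A1 A2 A3))"
    by simp_all
  fix y x X assume "y \<in> Obj E" "x \<in> Obj ((A1 \<times>\<^sub>c A2) \<times>\<^sub>c A3)"
    "X \<in> El (rpr (rcomp (rsub R (fassoc B1 B2 B3)) (rtens (rtens S1 S2) S3))) (y, x)"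
  then show "cmpt (assoc_natural (rpr R) (rpr S1) (rpr S2) (rpr S3)) (y, x) X \<in>
        El (rpr (rsub (rcomp R (rtens S1 (rtens S2 S3))) (fassoc A1 A2 A3))) (y, x) \<and>
      ryo (rsub (rcomp R (rtens S1 (rtens S2 S3))) (fassoc A1 A2 A3)) (y, x)
        (cmpt (assoc_natural (rpr R) (rpr S1) (rpr S2) (rpr S3)) (y, x) X) =
      ryo (rcomp (rsub R (fassoc B1 B2 B3)) (rtens (rtens S1 S2) S3)) (y, x) X"
    by (auto elim!: pcls_cases intro!: pcls_in)
qed

text \<open>A map that depends only on the arrow of a representative is well defined, because
  sliding preserves that arrow. This evaluates the three cells of the induced pseudomonoid.\<close>

lemma on_class_ryo:
  assumes R: "representation B E R" and S: "representation A B S"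
    and yx: "y \<in> Obj E" "x \<in> Obj A" "X \<in> El (rpr R \<odot> rpr S) (y, x)"
    and f: "\<And>b u v. b \<in> Obj B \<Longrightarrow> u \<in> El (rpr S) (b, x) \<Longrightarrow> v \<in> El (rpr R) (y, b) \<Longrightarrow>
      f (b, (u, v)) = g (Cmp E (fa (rfn R) (ryo S (b, x) u)) (ryo R (y, b) v))"
  shows "on_class f X = g (ryo (rcomp R S) (y, x) X)"
proof -
  note r = representationD[OF R] and s = representationD[OF S]
  note [simp] = r(4-7) s(4-7) profunctorD(1-5)[OF r(2)] profunctorD(1-5)[OF s(2)]
    is_functorD[OF r(1)] is_functorD[OF s(1)]
  obtain b u v where b: "b \<in> Obj B" "u \<in> El (rpr S) (b, x)" "v \<in> El (rpr R) (y, b)"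
    "X = pcls (rpr R) (rpr S) (y, x) (b, (u, v))"
    using yx by (auto elim!: pcls_cases)
  have "on_class f (pcls (rpr R) (rpr S) (y, x) (b, (u, v))) = f (b, (u, v))"
  proof (rule on_class_pcls[OF s(2) r(2)])
    fix b b' k u v
    assume "k \<in> Arr B" "Dom B k = b" "Cod B k = b'" "u \<in> El (rpr S) (b', x)" "v \<in> El (rpr R) (y, b)"
    then show "f (b, (Act (rpr S) (k, Idn A x) u, v)) = f (b', (u, Act (rpr R) (Idn E y, k) v))"
      using yx by (subst (1 2) f) (auto simp: Cmp_assoc pcls_in)
  qed (use b yx in auto)
  then show ?thesis using b yx by (simp add: f ryo_rcomp[OF R S])
qed

text \<open>The generating relations coincide because \<open>\<phi>\<close> sends the identity of
  \<open>x\<close> to the identity of \<open>fo \<phi> x\<close>; this is where \<open>x\<close> has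
  to be an object.\<close>

lemma pcls_psub:
  assumes "is_functor A B \<phi>" "x \<in> Obj A" "psrc F = B"
  shows "pcls G (F \<triangleleft> \<phi>) (y, x) = pcls G F (y, fo \<phi> x)"
  using is_functorD[OF assms(1)] assms(2,3)
  by (auto simp: pcls_def integrandS_def integrandT_def fun_eq_iff)

lemma El_pcomp_psub:
  assumes "is_functor A B \<phi>" "x \<in> Obj A" "psrc F = B"
  shows "El (G \<odot> (F \<triangleleft> \<phi>)) (y, x) = El (G \<odot> F) (y, fo \<phi> x)"
  by (simp add: El_pcomp pcls_psub[OF assms])

lemma rcomp_rsub: "ryo (rcomp R (rsub S \<phi>)) (y, x) = ryo (rcomp R S) (y, fo \<phi> x)"
  by (simp add: rcomp_def)

text \<open>The type annotation excludes record extensions, so the three fields determine the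
  record.\<close>

lemma repr_eqI: "rpr R = rpr S \<Longrightarrow> rfn R = rfn S \<Longrightarrow> ryo R = ryo S \<Longrightarrow> R = (S :: ('o, 'a, 'p, 'b, 'v) repr)"
  by simp

lemma rtens_rsub: "rtens (rsub R \<phi>) (rsub S \<psi>) = rsub (rtens R S) (\<phi> \<times>\<^sub>f \<psi>)"
  by (rule repr_eqI) (auto simp: rtens_def rsub_def ptens_def psub_def fcomp_def fprod_def fun_eq_iff)

text \<open>An equality of records and not merely an isomorphism, so that tensor products of
  represented profunctors can be rewritten in place.\<close>

lemma rtens_rep: "rtens (rrep F) (rrep G) = rrep (F \<times>\<^sub>f G)"
proof (rule repr_eqI)
  have "El (rep F \<otimes> rep G) = El (rep (F \<times>\<^sub>f G))"
    by (auto simp: rep_def ptens_def fprod_def fun_eq_iff)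
  moreover have "Act (rep F \<otimes> rep G) = Act (rep (F \<times>\<^sub>f G))"
    by (auto simp: rep_def ptens_def fprod_def fun_eq_iff)
  ultimately show "rpr (rtens (rrep F) (rrep G)) = rpr (rrep (F \<times>\<^sub>f G))"
    by simp
qed (auto simp: rtens_def rrep_def fun_eq_iff)

lemma fid_prod: "fid A \<times>\<^sub>f fid B = fid (A \<times>\<^sub>c B)"
  by (auto simp: fid_def fprod_def fun_eq_iff)

text \<open>\<open>exchange\<close> and \<open>prunit\<close> introduce the identity on a product
  category, while their neighbours in the axioms use the tensor product of identities. This
  identifies the two.\<close>

lemma pid_prod: "pid (A \<times>\<^sub>c B) = pid A \<otimes> pid B"
  using arg_cong[OF rtens_rep[of "fid A" "fid B"], of rpr] by (simp add: fid_prod)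

lemma rsub_fid: "rsub (rrep F) (fid (fdom F)) = rrep F"
  by (cases F, rule repr_eqI)
    (auto simp: rsub_def rrep_def psub_def rep_def fid_def fcomp_def fun_eq_iff)

lemma represented_vcomp_same:
  assumes "represented A B S T \<tau> \<theta>'" "represented A B R S \<sigma> \<theta>"
  shows "represented A B R T (\<tau> \<bullet> \<sigma>) (\<lambda>x. Cmp B (\<theta>' x) (\<theta> x))"
  by (rule represented_vcomp[OF assms]) auto

text \<open>Joins a cell that ends in \<open>G \<odot> (F \<triangleleft> \<phi>)\<close> to one
  that starts from \<open>(G \<odot> F) \<triangleleft> \<phi>\<close>. Such a junction follows the
  whiskering of an associator or unitor that has been tensored with an identity.\<close>

lemma represented_vcomp_rsub:
  assumes \<tau>: "represented A B (rsub (rcomp R S) \<phi>) T \<tau> \<theta>'" and \<sigma>: "represented A B Q (rcomp R (rsub S \<phi>)) \<sigma> \<theta>"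
    and \<phi>: "is_functor A A' \<phi>" "psrc (rpr S) = A'"
  shows "represented A B Q T (\<tau> \<bullet> \<sigma>) (\<lambda>x. Cmp B (\<theta>' x) (\<theta> x))"
  by (rule represented_vcomp[OF \<tau> \<sigma>]) (simp_all add: El_pcomp_psub[OF \<phi>(1) _ \<phi>(2)] rcomp_rsub)

lemma csub_vcomp: "(\<tau> \<bullet> \<sigma>) \<lhd> \<phi> = \<tau> \<lhd> \<phi> \<bullet> \<sigma> \<lhd> \<phi>"
  by (auto simp: csub_def vcomp_def fun_eq_iff)

lemma rtens_fid: "rrep (fid (A \<times>\<^sub>c B)) = rtens (rrep (fid A)) (rrep (fid B))"
  by (simp add: rtens_rep fid_prod)

lemma represented_tens_comp_r:
  assumes R: "representation B E R" and S: "representation A B S" and C: "category C"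
  shows "represented (A \<times>\<^sub>c C) (E \<times>\<^sub>c C) (rcomp (rtens R (rrep (fid C))) (rtens S (rrep (fid C))))
    (rtens (rcomp R S) (rrep (fid C))) (tens_comp_r C (rpr R) (rpr S))
    (\<lambda>x. Idn (E \<times>\<^sub>c C) (fo (rfn (rcomp (rtens R (rrep (fid C))) (rtens S (rrep (fid C))))) x))"
proof -
  have I: "representation C C (rrep (fid C))" using C by (intro representation_rrep) simp
  show ?thesis
    using represented_vcomp_identity[OF represented_ctens_identity[OF
        represented_idc[OF representation_rcomp[OF R S]] represented_plunit[OF I]]
        represented_interchange[OF R S I I]]
    by (simp add: tens_comp_r_def)
qed

lemma represented_tens_comp_l:
  assumes R: "representation B E R" and S: "representation A B S" and C: "category C"
  shows "represented (C \<times>\<^sub>c A) (C \<times>\<^sub>c E) (rcomp (rtens (rrep (fid C)) R) (rtens (rrep (fid C)) S))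
    (rtens (rrep (fid C)) (rcomp R S)) (tens_comp_l C (rpr R) (rpr S))
    (\<lambda>x. Idn (C \<times>\<^sub>c E) (fo (rfn (rcomp (rtens (rrep (fid C)) R) (rtens (rrep (fid C)) S))) x))"
proof -
  have I: "representation C C (rrep (fid C))" using C by (intro representation_rrep) simp
  show ?thesis
    using represented_vcomp_identity[OF represented_ctens_identity[OF
        represented_plunit[OF I] represented_idc[OF representation_rcomp[OF R S]]]
        represented_interchange[OF I I R S]]
    by (simp add: tens_comp_l_def)
qed

text \<open>Both composites are compared with \<open>rtens R S\<close>. The two comparison cells
  preserve arrows, and so does the inverse of the second.\<close>

lemma represented_exchange:
  assumes R: "representation A B R" and S: "representation A' B' S"
  shows "represented (A \<times>\<^sub>c A') (B \<times>\<^sub>c B')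
    (rcomp (rtens (rrep (fid B)) S) (rtens R (rrep (fid A'))))
    (rcomp (rtens R (rrep (fid B'))) (rtens (rrep (fid A)) S)) (exchange (rpr R) (rpr S))
    (\<lambda>x. Idn (B \<times>\<^sub>c B') (fo (rfn (rcomp (rtens (rrep (fid B)) S) (rtens R (rrep (fid A'))))) x))"
proof -
  note r = representationD[OF R] and s = representationD[OF S]
  have I: "representation A A (rrep (fid A))" "representation B B (rrep (fid B))"
    "representation A' A' (rrep (fid A'))" "representation B' B' (rrep (fid B'))"
    using is_functorD(1,2)[OF r(1)] is_functorD(1,2)[OF s(1)] by (auto intro!: representation_rrep)
  have 1: "represented (A \<times>\<^sub>c A') (B \<times>\<^sub>c B') (rcomp (rtens (rrep (fid B)) S) (rtens R (rrep (fid A'))))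
     (rtens R S) ((plunit (rpr R) \<boxtimes> prunit (rpr S)) \<bullet> interchange (pid B) (rpr S) (rpr R) (pid A'))
     (\<lambda>x. Idn (B \<times>\<^sub>c B') (fo (rfn (rcomp (rtens (rrep (fid B)) S) (rtens R (rrep (fid A'))))) x))"
    using represented_vcomp_identity[OF represented_ctens_identity[OF represented_plunit[OF R]
      represented_prunit[OF S]] represented_interchange[OF I(2) R S I(3)]] by simp
  have 2: "represented (A \<times>\<^sub>c A') (B \<times>\<^sub>c B') (rcomp (rtens R (rrep (fid B'))) (rtens (rrep (fid A)) S))
     (rtens R S) ((prunit (rpr R) \<boxtimes> plunit (rpr S)) \<bullet> interchange (rpr R) (pid B') (pid A) (rpr S))
     (\<lambda>x. Idn (B \<times>\<^sub>c B') (fo (rfn (rcomp (rtens R (rrep (fid B'))) (rtens (rrep (fid A)) S))) x))"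
    using represented_vcomp_identity[OF represented_ctens_identity[OF represented_prunit[OF R]
      represented_plunit[OF S]] represented_interchange[OF R I(1) I(4) S]] by simp
  show ?thesis
    using represented_vcomp_identity[OF represented_cinv_identity[OF 2] 1]
      profunctorD(3,4)[OF r(2)] profunctorD(3,4)[OF s(2)]
    by (simp add: exchange_def)
qed

section \<open>The pseudomonoid of a monoidal category\<close>

locale monoidal =
  fixes N :: "('o, 'a) moncat"
  assumes monoidal: "monoidal_category N"
begin

abbreviation "C \<equiv> ucat N"
abbreviation "T \<equiv> ten N"
abbreviation "m \<equiv> rrep (ten N)"
abbreviation "i \<equiv> rrep (fid (ucat N))"

lemma category_C [simp]: "category C"
  and functor_T: "is_functor (C \<times>\<^sub>c C) C T"
  and unt_Obj [simp]: "unt N \<in> Obj C"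
  using monoidal by (auto simp: monoidal_category_def Let_def)

lemmas T_simps [simp] = is_functorD[OF functor_T, simplified]

lemma tens_simps [simp]:
  "x \<in> Obj C \<Longrightarrow> y \<in> Obj C \<Longrightarrow> tensA N (Idn C x) (Idn C y) = Idn C (tensO N x y)"
  "f \<in> Arr C \<Longrightarrow> g \<in> Arr C \<Longrightarrow> f' \<in> Arr C \<Longrightarrow> g' \<in> Arr C \<Longrightarrow> Dom C g = Cod C f \<Longrightarrow> Dom C g' = Cod C f' \<Longrightarrow>
    tensA N (Cmp C g f) (Cmp C g' f') = Cmp C (tensA N g g') (tensA N f f')"
  using is_functorD(9)[OF functor_T, of "(x, y)"] is_functorD(10)[OF functor_T, of "(f, f')" "(g, g')"]
  by auto

lemma asc_simps [simp]:
  assumes "x \<in> Obj C" "y \<in> Obj C" "z \<in> Obj C"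
  shows "asc N x y z \<in> Arr C" "Dom C (asc N x y z) = tensO N (tensO N x y) z"
    "Cod C (asc N x y z) = tensO N x (tensO N y z)" "iso_arrow C (asc N x y z)"
  using assms monoidal by (auto simp: monoidal_category_def Let_def nat_iso_def hom_iff)

lemma asc_natural:
  assumes "f \<in> Arr C" "g \<in> Arr C" "h \<in> Arr C"
  shows "Cmp C (asc N (Cod C f) (Cod C g) (Cod C h)) (tensA N (tensA N f g) h) =
    Cmp C (tensA N f (tensA N g h)) (asc N (Dom C f) (Dom C g) (Dom C h))"
  using assms monoidal by (auto simp: monoidal_category_def Let_def nat_iso_def)

lemma lun_simps [simp]:
  assumes "x \<in> Obj C"
  shows "lun N x \<in> Arr C" "Dom C (lun N x) = tensO N (unt N) x" "Cod C (lun N x) = x"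
    "iso_arrow C (lun N x)"
    "run N x \<in> Arr C" "Dom C (run N x) = tensO N x (unt N)" "Cod C (run N x) = x"
    "iso_arrow C (run N x)"
  using assms monoidal by (auto simp: monoidal_category_def Let_def nat_iso_def hom_iff)

lemma lun_natural:
  assumes "f \<in> Arr C"
  shows "Cmp C (lun N (Cod C f)) (tensA N (Idn C (unt N)) f) = Cmp C f (lun N (Dom C f))"
    "Cmp C (run N (Cod C f)) (tensA N f (Idn C (unt N))) = Cmp C f (run N (Dom C f))"
  using assms monoidal by (auto simp: monoidal_category_def Let_def nat_iso_def)

lemma pentagon:
  assumes "w \<in> Obj C" "x \<in> Obj C" "y \<in> Obj C" "z \<in> Obj C"
  shows "Cmp C (tensA N (Idn C w) (asc N x y z))
      (Cmp C (asc N w (tensO N x y) z) (tensA N (asc N w x y) (Idn C z))) =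
    Cmp C (asc N w x (tensO N y z)) (asc N (tensO N w x) y z)"
  using assms monoidal by (auto simp: monoidal_category_def Let_def)

lemma triangle:
  assumes "x \<in> Obj C" "y \<in> Obj C"
  shows "Cmp C (tensA N (Idn C x) (lun N y)) (asc N x (unt N) y) = tensA N (run N x) (Idn C y)"
  using assms monoidal by (auto simp: monoidal_category_def Let_def)

abbreviation "e \<equiv> rrep (fpoint (ucat N) (unt N))"

lemma representation_mult: "representation (C \<times>\<^sub>c C) C m"
  by (rule representation_rrep[OF functor_T])

lemma representation_id: "representation C C i"
  by (rule representation_rrep) simp

lemma representation_unit: "representation unit_cat C e"
  by (rule representation_rrep) simp

lemma represented_ind_assoc:
  "represented ((C \<times>\<^sub>c C) \<times>\<^sub>c C) C (rcomp m (rtens m i)) (rsub (rcomp m (rtens i m)) (fassoc C C C))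
    (ind_assoc N) (\<lambda>((a, b), c). asc N a b c)"
proof -
  note m = representation_mult and i = representation_id
  note mi = representation_rtens[OF m i] and im = representation_rtens[OF i m]
  have rep: "representation ((C \<times>\<^sub>c C) \<times>\<^sub>c C) C (rcomp m (rtens m i))"
    "representation ((C \<times>\<^sub>c C) \<times>\<^sub>c C) C (rsub (rcomp m (rtens i m)) (fassoc C C C))"
    by (rule representation_rcomp[OF m mi],
        rule representation_rsub[OF representation_rcomp[OF m im]]) simp
  have "cmpt (ind_assoc N) (d, ((a, b), c)) X \<in> El (rep T \<odot> (pid C \<otimes> rep T)) (d, (a, (b, c))) \<and>
      ryo (rcomp m (rtens i m)) (d, (a, (b, c))) (cmpt (ind_assoc N) (d, ((a, b), c)) X) =
      Cmp C (asc N a b c) (ryo (rcomp m (rtens m i)) (d, ((a, b), c)) X)"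
    if o: "d \<in> Obj C" "a \<in> Obj C" "b \<in> Obj C" "c \<in> Obj C"
      and X: "X \<in> El (rep T \<odot> (rep T \<otimes> pid C)) (d, ((a, b), c))" for d a b c X
  proof -
    let ?r = "ryo (rcomp m (rtens m i)) (d, ((a, b), c)) X"
    have r: "?r \<in> Arr C" "Dom C ?r = d" "Cod C ?r = tensO N (tensO N a b) c"
      using representationD(4-6)[OF rep(1), of d "((a, b), c)" X] o X by auto
    \<comment> \<open>The class returned by \<open>ind_assoc\<close>, as a function of the arrow of
      \<open>X\<close> alone. The first entries of its representative are identities, which the
      tensor product preserves, so it stands for the arrow in its last entry.\<close>
    let ?g = "\<lambda>r. pcls (rep T) (pid C \<otimes> rep T) (d, (a, (b, c)))
      ((a, tensO N b c), ((Idn C a, Idn C (tensO N b c)), Cmp C (asc N a b c) r))"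
    have "on_class (\<lambda>((x, y), ((p, k), q)). ?g (Cmp C (tensA N p k) q)) X = ?g ?r"
      by (rule on_class_ryo[OF m mi, where g = ?g]) (use o X in auto)
    then have "cmpt (ind_assoc N) (d, ((a, b), c)) X = ?g ?r"
      by (simp add: ind_assoc_def Let_def ind_mult_def)
    then show ?thesis
      using o r ryo_rcomp[OF m im, of d "(a, (b, c))" "(a, tensO N b c)"
          "(Idn C a, Idn C (tensO N b c))" "Cmp C (asc N a b c) ?r"]
      by (auto simp: hom_iff intro!: pcls_in)
  qed
  then show ?thesis
    unfolding represented_def using rep asc_natural
    by (auto simp: hom_iff ind_assoc_def Let_def ind_mult_def)
qed

text \<open>Elements of the target are already arrows, so no representative has to be chosen and the
  cell is postcomposition with \<open>lun\<close>.\<close>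

lemma represented_ind_lunit:
  "represented (unit_cat \<times>\<^sub>c C) C (rcomp m (rtens e i)) (rsub i (flunit C))
    (ind_lunit N) (\<lambda>(_, a). lun N a)"
proof -
  note m = representation_mult and i = representation_id and e = representation_unit
  note ei = representation_rtens[OF e i]
  have rep: "representation (unit_cat \<times>\<^sub>c C) C (rcomp m (rtens e i))"
    "representation (unit_cat \<times>\<^sub>c C) C (rsub i (flunit C))"
    by (rule representation_rcomp[OF m ei], rule representation_rsub[OF i]) simp
  have "ryo (rcomp m (rtens e i)) (d, (p, a)) X \<in> hom C d (tensO N (unt N) a) \<and> cmpt (ind_lunit N) (d, (p, a)) X =
      Cmp C (lun N a) (ryo (rcomp m (rtens e i)) (d, (p, a)) X)"
    if o: "d \<in> Obj C" "a \<in> Obj C"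
      and X: "X \<in> El (rep T \<odot> (rep (fpoint C (unt N)) \<otimes> pid C)) (d, (p, a))" for d p a X
  proof -
    let ?r = "ryo (rcomp m (rtens e i)) (d, (p, a)) X"
    have r: "?r \<in> Arr C" "Dom C ?r = d" "Cod C ?r = tensO N (unt N) a"
      using representationD(4-6)[OF rep(1), of d "(p, a)" X] o X by auto
    have "cmpt (ind_lunit N) (d, (p, a)) X = Cmp C (lun N a) ?r"
    proof -
      have "on_class (\<lambda>((x, y), ((p, k), q)). Cmp C (lun N a) (Cmp C (tensA N p k) q)) X = Cmp C (lun N a) ?r"
        by (rule on_class_ryo[OF m ei, where g = "Cmp C (lun N a)"]) (use o X in auto)
      then show ?thesis by (simp add: ind_lunit_def Let_def ind_mult_def ind_unit_def)
    qed
    then show ?thesis using o r by (auto simp: hom_iff)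
  qed
  then show ?thesis
    unfolding represented_def using rep lun_natural
    by (auto simp: hom_iff ind_lunit_def Let_def ind_mult_def ind_unit_def)
qed

lemma represented_ind_runit:
  "represented (C \<times>\<^sub>c unit_cat) C (rcomp m (rtens i e)) (rsub i (frunit C))
    (ind_runit N) (\<lambda>(a, _). run N a)"
proof -
  note m = representation_mult and i = representation_id and e = representation_unit
  note ie = representation_rtens[OF i e]
  have rep: "representation (C \<times>\<^sub>c unit_cat) C (rcomp m (rtens i e))"
    "representation (C \<times>\<^sub>c unit_cat) C (rsub i (frunit C))"
    by (rule representation_rcomp[OF m ie], rule representation_rsub[OF i]) simp
  have "ryo (rcomp m (rtens i e)) (d, (a, p)) X \<in> hom C d (tensO N a (unt N)) \<and> cmpt (ind_runit N) (d, (a, p)) X =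
      Cmp C (run N a) (ryo (rcomp m (rtens i e)) (d, (a, p)) X)"
    if o: "d \<in> Obj C" "a \<in> Obj C"
      and X: "X \<in> El (rep T \<odot> (pid C \<otimes> rep (fpoint C (unt N)))) (d, (a, p))" for d p a X
  proof -
    let ?r = "ryo (rcomp m (rtens i e)) (d, (a, p)) X"
    have r: "?r \<in> Arr C" "Dom C ?r = d" "Cod C ?r = tensO N a (unt N)"
      using representationD(4-6)[OF rep(1), of d "(a, p)" X] o X by auto
    have "cmpt (ind_runit N) (d, (a, p)) X = Cmp C (run N a) ?r"
    proof -
      have "on_class (\<lambda>((x, y), ((k, p), q)). Cmp C (run N a) (Cmp C (tensA N k p) q)) X = Cmp C (run N a) ?r"
        by (rule on_class_ryo[OF m ie, where g = "Cmp C (run N a)"]) (use o X in auto)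
      then show ?thesis by (simp add: ind_runit_def Let_def ind_mult_def ind_unit_def)
    qed
    then show ?thesis using o r by (auto simp: hom_iff)
  qed
  then show ?thesis
    unfolding represented_def using rep lun_natural
    by (auto simp: hom_iff ind_runit_def Let_def ind_mult_def ind_unit_def)
qed

end

context monoidal
begin

text \<open>To pull a substitution out of one tensor factor, the identity factor \<open>i\<close> is
  viewed as substituted along \<open>fid C\<close>.\<close>

lemma rtens_rsub_i:
  "rtens i (rsub R \<phi>) = rsub (rtens i R) (fid C \<times>\<^sub>f \<phi>)"
  "rtens (rsub R \<phi>) i = rsub (rtens R i) (\<phi> \<times>\<^sub>f fid C)"
  using rtens_rsub[of i "fid C" R \<phi>] rtens_rsub[of R \<phi> i "fid C"] rsub_fid[of "fid C"] by simp_all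

text \<open>The facts \<open>p\<close> and \<open>q\<close> follow the expressions
  \<open>pentagon_2\<close> and \<open>pentagon_3\<close>, with one rule for each operation on
  cells, so that combining the rules computes the transformation of each side. Structural cells
  contribute identities, which leaves two associators on one side and three on the other.\<close>

lemma pentagon_2_eq_pentagon_3: "pentagon_2 C (rep T) (ind_assoc N) \<doteq> pentagon_3 C (rep T) (ind_assoc N)"
proof -
  note m = representation_mult and i = representation_id and \<alpha> = represented_ind_assoc
  note mi = representation_rtens[OF m i] and im = representation_rtens[OF i m]
    and ii = representation_rtens[OF i i]
  note L = representation_rcomp[OF m im]
  note V = represented_vcomp_same and H = represented_hcomp and I = represented_idc
    and S = represented_csub
  have F: "is_functor (((C \<times>\<^sub>c C) \<times>\<^sub>c C) \<times>\<^sub>c C) ((C \<times>\<^sub>c C) \<times>\<^sub>c (C \<times>\<^sub>c C)) (fassoc (C \<times>\<^sub>c C) C C)"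
    "is_functor ((C \<times>\<^sub>c C) \<times>\<^sub>c (C \<times>\<^sub>c C)) (C \<times>\<^sub>c (C \<times>\<^sub>c (C \<times>\<^sub>c C))) (fassoc C C (C \<times>\<^sub>c C))"
    "is_functor (((C \<times>\<^sub>c C) \<times>\<^sub>c C) \<times>\<^sub>c C) ((C \<times>\<^sub>c (C \<times>\<^sub>c C)) \<times>\<^sub>c C) (fassoc C C C \<times>\<^sub>f fid C)"
    "is_functor ((C \<times>\<^sub>c (C \<times>\<^sub>c C)) \<times>\<^sub>c C) (C \<times>\<^sub>c ((C \<times>\<^sub>c C) \<times>\<^sub>c C)) (fassoc C (C \<times>\<^sub>c C) C)"
    by (simp_all add: is_functor_fprod)
  note rt = representation_rtens
  note p = V[OF S[OF S[OF V[OF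
        H[OF I[OF m] represented_tens_comp_l[OF m im category_C]]
        represented_passoc[OF m im rt[OF i im]]]
      F(2)] F(1)]
    V[OF S[OF V[OF represented_assoc_natural[OF L i i m]
        V[OF H[OF \<alpha> I[OF rt[OF ii m]]]
        V[OF represented_cinv_identity[OF represented_passoc[OF m mi rt[OF ii m]]]
        V[OF H[OF I[OF m] represented_exchange[OF m m, unfolded rtens_fid]]
          represented_passoc[OF m im rt[OF m ii]]]]]] F(1)]
    V[OF represented_assoc_natural[OF L m i i]
      H[OF \<alpha> I[OF rt[OF mi i]]]]]]
  \<comment> \<open>Tensoring the associator with an identity leaves the substitution inside the
    tensor factor. \<open>rtens_rsub_i\<close> moves it outside, where
    \<open>represented_vcomp_rsub\<close> can join the result to \<open>q2\<close>.\<close>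
  note q1 = V[OF H[OF I[OF m] represented_ctens[OF \<alpha> I[OF i], unfolded rtens_rsub_i]]
    V[OF H[OF I[OF m] represented_tens_comp_r[OF m mi category_C]]
      represented_passoc[OF m mi rt[OF mi i]]]]
  note q2 = S[OF V[OF represented_assoc_natural[OF L i m i]
    V[OF H[OF \<alpha> I[OF rt[OF im i]]]
    V[OF represented_cinv_identity[OF represented_passoc[OF m mi rt[OF im i]]]
      H[OF I[OF m] represented_cinv_identity[OF represented_tens_comp_r[OF m im category_C]]]]]] F(3)]
  note q3 = S[OF S[OF V[OF H[OF I[OF m] represented_ctens[OF I[OF i] \<alpha>]]
    V[OF H[OF I[OF m] represented_tens_comp_l[OF m mi category_C]]
      represented_passoc[OF m im rt[OF i mi]]]] F(4)] F(3)]
  have src: "psrc (rpr (rtens (rcomp m (rtens i m)) i)) = (C \<times>\<^sub>c (C \<times>\<^sub>c C)) \<times>\<^sub>c C"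
    by simp
  note q = V[OF q3 represented_vcomp_rsub[OF q2 q1 F(3) src]]
  note eq = represented_eq[OF p q, unfolded repr_simps rcomp_simps rtens_simps rsub_simps rep_fid]
  have F': "is_functor (C \<times>\<^sub>c ((C \<times>\<^sub>c C) \<times>\<^sub>c C)) (C \<times>\<^sub>c (C \<times>\<^sub>c (C \<times>\<^sub>c C))) (fid C \<times>\<^sub>f fassoc C C C)"
    by (simp add: is_functor_fprod)
  show ?thesis
    unfolding pentagon_2_def pentagon_3_def pid_prod
  proof (rule eq, goal_cases)
    \<comment> \<open>The sides end in substitutions at different depths: in
      \<open>pentagon_3\<close> one associativity functor sits inside a tensor factor and has to be
      pulled out past the tensor product and then past the composite.\<close>
    case (1 y x)
    then show ?case
      by (auto simp: rtens_rsub_i(1)[of "rcomp m (rtens i m)", THEN arg_cong[of _ _ rpr], simplified]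
          El_pcomp_psub[OF F'])
  next
    case (2 y x)
    then show ?case
      by (auto simp: rtens_rsub_i rcomp_rsub)
  next
    case (3 x)
    then obtain a b c d where "x = (((a, b), c), d)" "a \<in> Obj C" "b \<in> Obj C" "c \<in> Obj C" "d \<in> Obj C"
      by auto
    then show ?case
      by (simp add: pentagon)
  qed
qed

end

context monoidal
begin

lemma triangle_2_eq_triangle_1:
  "triangle_2 C (rep T) (rep (fpoint C (unt N))) (ind_assoc N) (ind_lunit N) \<doteq>
    triangle_1 C (rep T) (rep (fpoint C (unt N))) (ind_runit N)"
proof -
  note m = representation_mult and i = representation_id and e = representation_unit
  note mi = representation_rtens[OF m i] and im = representation_rtens[OF i m]
  note L = representation_rcomp[OF m im]
  note \<alpha> = represented_ind_assoc and l = represented_ind_lunit and r = represented_ind_runit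
  note V = represented_vcomp_same and H = represented_hcomp and I = represented_idc
    and S = represented_csub
  note rt = representation_rtens
  have F: "is_functor ((C \<times>\<^sub>c unit_cat) \<times>\<^sub>c C) (C \<times>\<^sub>c (unit_cat \<times>\<^sub>c C)) (fassoc C unit_cat C)"
    "is_functor (C \<times>\<^sub>c (unit_cat \<times>\<^sub>c C)) (C \<times>\<^sub>c C) (fid C \<times>\<^sub>f flunit C)"
    "is_functor ((C \<times>\<^sub>c unit_cat) \<times>\<^sub>c C) (C \<times>\<^sub>c C) (frunit C \<times>\<^sub>f fid C)"
    by (simp_all add: is_functor_fprod)
  have src: "psrc (rpr (rtens i i)) = C \<times>\<^sub>c C" by simp
  note p1 = V[OF H[OF I[OF m] represented_ctens[OF I[OF i] l], unfolded rtens_rsub_i]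
    V[OF H[OF I[OF m] represented_tens_comp_l[OF m rt[OF e i] category_C]]
      represented_passoc[OF m im rt[OF i rt[OF e i]]]]]
  \<comment> \<open>The unitor is attached before substituting along \<open>fassoc\<close>, since
    the junction concerns only the functor \<open>fid C \<times>\<^sub>f flunit C\<close>.\<close>
  note p2 = S[OF represented_vcomp_rsub[OF S[OF represented_prunit[OF m, unfolded rtens_fid] F(2)] p1
    F(2) src] F(1)]
  note p = V[OF p2 V[OF represented_assoc_natural[OF L i e i] H[OF \<alpha> I[OF rt[OF rt[OF i e] i]]]]]
  note q1 = V[OF H[OF I[OF m] represented_ctens[OF r I[OF i], unfolded rtens_rsub_i]]
    V[OF H[OF I[OF m] represented_tens_comp_r[OF m rt[OF i e] category_C]]
      represented_passoc[OF m mi rt[OF rt[OF i e] i]]]]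
  note q = represented_vcomp_rsub[OF S[OF represented_prunit[OF m, unfolded rtens_fid] F(3)] q1 F(3) src]
  note eq = represented_eq[OF p q, unfolded csub_vcomp repr_simps rcomp_simps rtens_simps rsub_simps rep_fid]
  \<comment> \<open>The order in which \<open>p2\<close> is built groups the cells differently from
    \<open>triangle_2\<close>. Vertical composition is strictly associative and substitution
    distributes over it strictly, so everything can be brought to one bracketing.\<close>
  have vcomp_assoc: "(\<tau> \<bullet> \<sigma>) \<bullet> \<rho> = \<tau> \<bullet> \<sigma> \<bullet> \<rho>" for \<tau> \<sigma> \<rho>
    by (simp add: vcomp_def)
  show ?thesis
    unfolding triangle_2_def triangle_1_def pid_prod csub_vcomp vcomp_assoc
  proof (rule eq[unfolded vcomp_assoc], goal_cases)
    case (1 y x)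
    then show ?case by auto
  next
    case (2 y x)
    then show ?case by auto
  next
    case (3 x)
    then obtain a b where "x = ((a, ()), b)" "a \<in> Obj C" "b \<in> Obj C"
      by auto
    then show ?case
      by (simp add: triangle)
  qed
qed

lemma pseudomonoid_ind:
  "pseudomonoid C (ind_mult N) (ind_unit N) (ind_assoc N) (ind_lunit N) (ind_runit N)"
proof -
  have "invertible_cell (rep T \<odot> (rep T \<otimes> pid C)) ((rep T \<odot> (pid C \<otimes> rep T)) \<triangleleft> fassoc C C C) (ind_assoc N)"
    using represented_invertible[OF represented_ind_assoc] by auto
  moreover have "invertible_cell (rep T \<odot> (rep (fpoint C (unt N)) \<otimes> pid C)) (pid C \<triangleleft> flunit C) (ind_lunit N)"
    using represented_invertible[OF represented_ind_lunit] by auto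
  moreover have "invertible_cell (rep T \<odot> (pid C \<otimes> rep (fpoint C (unt N)))) (pid C \<triangleleft> frunit C) (ind_runit N)"
    using represented_invertible[OF represented_ind_runit] by auto
  ultimately show ?thesis
    unfolding pseudomonoid_def ind_mult_def ind_unit_def
    using profunctor_rep[OF functor_T] pentagon_2_eq_pentagon_3 triangle_2_eq_triangle_1
    by (auto intro: profunctor_rep)
qed

end

section \<open>The opposite monoidal category\<close>

context monoidal
begin

lemma tens_inverse:
  assumes "inverse_arrows C f f'" "inverse_arrows C g g'"
  shows "inverse_arrows C (tensA N f g) (tensA N f' g')"
proof -
  have fg: "f \<in> Arr C" "f' \<in> Arr C" "Dom C f' = Cod C f" "Cod C f' = Dom C f"
    "g \<in> Arr C" "g' \<in> Arr C" "Dom C g' = Cod C g" "Cod C g' = Dom C g"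
    and inv: "Cmp C f' f = Idn C (Dom C f)" "Cmp C f f' = Idn C (Cod C f)"
    "Cmp C g' g = Idn C (Dom C g)" "Cmp C g g' = Idn C (Cod C g)"
    using assms by (auto simp: inverse_arrows_def hom_iff)
  then show ?thesis
    using tens_simps(2)[of f f' g g'] tens_simps(2)[of f' f g' g]
    by (simp add: inverse_arrows_def hom_iff del: tens_simps(2))
qed

lemma Idn_inverse: "x \<in> Obj C \<Longrightarrow> inverse_arrows C (Idn C x) (Idn C x)"
  by (simp add: inverse_arrows_def hom_iff)

lemma asc_inverse:
  "x \<in> Obj C \<Longrightarrow> y \<in> Obj C \<Longrightarrow> z \<in> Obj C \<Longrightarrow> inverse_arrows C (asc N x y z) (inv_arrow C (asc N x y z))"
  by (simp add: inv_arrow_inverse)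

text \<open>The two sides are inverses of the two expressions in the pentagon axiom. Those are the
  same arrow, so uniqueness of inverses applies.\<close>

lemma pentagon_inverse:
  assumes "w \<in> Obj C" "x \<in> Obj C" "y \<in> Obj C" "z \<in> Obj C"
  shows "Cmp C (Cmp C (tensA N (inv_arrow C (asc N w x y)) (Idn C z)) (inv_arrow C (asc N w (tensO N x y) z)))
      (tensA N (Idn C w) (inv_arrow C (asc N x y z))) =
    Cmp C (inv_arrow C (asc N (tensO N w x) y z)) (inv_arrow C (asc N w x (tensO N y z)))"
proof (rule inverse_arrows_unique[OF category_C])
  show "inverse_arrows C (Cmp C (asc N w x (tensO N y z)) (asc N (tensO N w x) y z))
      (Cmp C (inv_arrow C (asc N (tensO N w x) y z)) (inv_arrow C (asc N w x (tensO N y z))))"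
    using assms by (intro inverse_arrows_Cmp asc_inverse) auto
  have "inverse_arrows C (Cmp C (tensA N (Idn C w) (asc N x y z))
      (Cmp C (asc N w (tensO N x y) z) (tensA N (asc N w x y) (Idn C z))))
    (Cmp C (Cmp C (tensA N (inv_arrow C (asc N w x y)) (Idn C z)) (inv_arrow C (asc N w (tensO N x y) z)))
      (tensA N (Idn C w) (inv_arrow C (asc N x y z))))"
    using assms by (intro inverse_arrows_Cmp tens_inverse asc_inverse Idn_inverse) auto
  then show "inverse_arrows C (Cmp C (asc N w x (tensO N y z)) (asc N (tensO N w x) y z))
    (Cmp C (Cmp C (tensA N (inv_arrow C (asc N w x y)) (Idn C z)) (inv_arrow C (asc N w (tensO N x y) z)))
      (tensA N (Idn C w) (inv_arrow C (asc N x y z))))"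
    using assms by (simp add: pentagon)
qed

text \<open>Again by uniqueness of inverses, applied to the two expressions in the triangle
  axiom.\<close>

lemma triangle_inverse:
  assumes "x \<in> Obj C" "y \<in> Obj C"
  shows "Cmp C (inv_arrow C (asc N x (unt N) y)) (tensA N (Idn C x) (inv_arrow C (lun N y))) =
    tensA N (inv_arrow C (run N x)) (Idn C y)"
proof (rule inverse_arrows_unique[OF category_C])
  show "inverse_arrows C (tensA N (run N x) (Idn C y)) (tensA N (inv_arrow C (run N x)) (Idn C y))"
    using assms by (intro tens_inverse Idn_inverse inv_arrow_inverse) auto
  have "inverse_arrows C (Cmp C (tensA N (Idn C x) (lun N y)) (asc N x (unt N) y))
      (Cmp C (inv_arrow C (asc N x (unt N) y)) (tensA N (Idn C x) (inv_arrow C (lun N y))))"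
    using assms by (intro inverse_arrows_Cmp tens_inverse Idn_inverse inv_arrow_inverse) auto
  then show "inverse_arrows C (tensA N (run N x) (Idn C y))
      (Cmp C (inv_arrow C (asc N x (unt N) y)) (tensA N (Idn C x) (inv_arrow C (lun N y))))"
    using assms by (simp add: triangle)
qed

lemma mon_op_simps [simp]:
  "ucat (mon_op N) = op_cat C" "unt (mon_op N) = unt N"
  "fo (ten (mon_op N)) = fo T" "fa (ten (mon_op N)) = fa T"
  "asc (mon_op N) = (\<lambda>x y z. inv_arrow C (asc N x y z))"
  "lun (mon_op N) = (\<lambda>x. inv_arrow C (lun N x))" "run (mon_op N) = (\<lambda>x. inv_arrow C (run N x))"
  by (simp_all add: mon_op_def Let_def)

lemma is_functor_mon_op: "is_functor (op_cat C \<times>\<^sub>c op_cat C) (op_cat C) (ten (mon_op N))"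
  using functor_T unfolding is_functor_def by (auto simp: mon_op_def Let_def hom_iff)

lemma monoidal_mon_op: "monoidal_category (mon_op N)"
proof -
  note T' = is_functor_mon_op
  note inv [simp] = inv_arrowD[OF category_C asc_simps(4)] inv_arrowD[OF category_C lun_simps(4)]
    inv_arrowD[OF category_C lun_simps(8)] iso_arrow_inv
  have cat: "category (op_cat C)" by simp
  have "nat_iso ((op_cat C \<times>\<^sub>c op_cat C) \<times>\<^sub>c op_cat C) (op_cat C)
      (ten (mon_op N) \<circ>\<^sub>f (ten (mon_op N) \<times>\<^sub>f fid (op_cat C)))
      (ten (mon_op N) \<circ>\<^sub>f (fid (op_cat C) \<times>\<^sub>f ten (mon_op N)) \<circ>\<^sub>f fassoc (op_cat C) (op_cat C) (op_cat C))
      (\<lambda>((x, y), z). asc (mon_op N) x y z)"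
  proof -
    have "Cmp C (tensA N (tensA N f g) h) (inv_arrow C (asc N (Dom C f) (Dom C g) (Dom C h))) =
        Cmp C (inv_arrow C (asc N (Cod C f) (Cod C g) (Cod C h))) (tensA N f (tensA N g h))"
      if "f \<in> Arr C" "g \<in> Arr C" "h \<in> Arr C" for f g h
      using that asc_natural[OF that] by (intro inv_arrow_natural[OF category_C]) auto
    moreover have "is_functor ((op_cat C \<times>\<^sub>c op_cat C) \<times>\<^sub>c op_cat C) (op_cat C)
      (ten (mon_op N) \<circ>\<^sub>f (ten (mon_op N) \<times>\<^sub>f fid (op_cat C)))"
      by (rule is_functor_fcomp[OF is_functor_fprod[OF T' is_functor_fid[OF cat]] T'])
    moreover have "is_functor ((op_cat C \<times>\<^sub>c op_cat C) \<times>\<^sub>c op_cat C) (op_cat C)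
      (ten (mon_op N) \<circ>\<^sub>f (fid (op_cat C) \<times>\<^sub>f ten (mon_op N)) \<circ>\<^sub>f fassoc (op_cat C) (op_cat C) (op_cat C))"
      by (rule is_functor_fcomp[OF _ is_functor_fcomp[OF is_functor_fprod[OF is_functor_fid[OF cat] T'] T']]) simp
    ultimately show ?thesis
      unfolding nat_iso_def by (auto simp: hom_iff)
  qed
  moreover have "nat_iso (unit_cat \<times>\<^sub>c op_cat C) (op_cat C)
      (ten (mon_op N) \<circ>\<^sub>f (fpoint (op_cat C) (unt N) \<times>\<^sub>f fid (op_cat C))) (flunit (op_cat C))
      (\<lambda>(_, x). lun (mon_op N) x)"
  proof -
    have "Cmp C (tensA N (Idn C (unt N)) f) (inv_arrow C (lun N (Dom C f))) =
        Cmp C (inv_arrow C (lun N (Cod C f))) f" if "f \<in> Arr C" for f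
      using that lun_natural[OF that] by (intro inv_arrow_natural[OF category_C]) auto
    moreover have "is_functor (unit_cat \<times>\<^sub>c op_cat C) (op_cat C)
      (ten (mon_op N) \<circ>\<^sub>f (fpoint (op_cat C) (unt N) \<times>\<^sub>f fid (op_cat C)))"
      by (rule is_functor_fcomp[OF is_functor_fprod[OF is_functor_fpoint is_functor_fid[OF cat]] T']) auto
    ultimately show ?thesis
      unfolding nat_iso_def by (auto simp: hom_iff)
  qed
  moreover have "nat_iso (op_cat C \<times>\<^sub>c unit_cat) (op_cat C)
      (ten (mon_op N) \<circ>\<^sub>f (fid (op_cat C) \<times>\<^sub>f fpoint (op_cat C) (unt N))) (frunit (op_cat C))
      (\<lambda>(x, _). run (mon_op N) x)"
  proof -
    have "Cmp C (tensA N f (Idn C (unt N))) (inv_arrow C (run N (Dom C f))) =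
        Cmp C (inv_arrow C (run N (Cod C f))) f" if "f \<in> Arr C" for f
      using that lun_natural[OF that] by (intro inv_arrow_natural[OF category_C]) auto
    moreover have "is_functor (op_cat C \<times>\<^sub>c unit_cat) (op_cat C)
      (ten (mon_op N) \<circ>\<^sub>f (fid (op_cat C) \<times>\<^sub>f fpoint (op_cat C) (unt N)))"
      by (rule is_functor_fcomp[OF is_functor_fprod[OF is_functor_fid[OF cat] is_functor_fpoint] T']) auto
    ultimately show ?thesis
      unfolding nat_iso_def by (auto simp: hom_iff)
  qed
  ultimately show ?thesis
    unfolding monoidal_category_def Let_def using T' pentagon_inverse triangle_inverse
    by simp
qed

end

section \<open>Right adjoints of representable profunctors\<close>

text \<open>The right adjoint of \<open>rep F\<close>. Both take values in the arrow type of the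
  codomain, as \<open>has_right_adjoint\<close> demands.\<close>

definition corep :: "('o, 'a, 'p, 'b) functr \<Rightarrow> ('p, 'b, 'o, 'a, 'b) prof" where
  "corep F = \<lparr>psrc = fcod F, ptgt = fdom F,
     El = (\<lambda>(x, y). hom (fcod F) (fo F x) y),
     Act = (\<lambda>(f, h) u. Cmp (fcod F) h (Cmp (fcod F) u (fa F f)))\<rparr>"

lemma corep_simps [simp]:
  "psrc (corep F) = fcod F" "ptgt (corep F) = fdom F"
  "El (corep F) (x, y) = hom (fcod F) (fo F x) y"
  "Act (corep F) (f, h) u = Cmp (fcod F) h (Cmp (fcod F) u (fa F f))"
  by (simp_all add: corep_def)

lemma profunctor_corep:
  assumes "is_functor A B F"
  shows "profunctor B A (corep F)"
  by (rule profunctorI) (use is_functorD[OF assms] in \<open>auto simp: hom_iff Cmp_assoc\<close>)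

text \<open>By co-Yoneda the coend at \<open>(y, x)\<close> is the set of arrows from
  \<open>F y\<close> to \<open>F x\<close>; the arrow \<open>F k\<close> is represented with the
  identity as first entry.\<close>

definition rep_unit :: "('o, 'a, 'p, 'b) functr \<Rightarrow>
   ('o, 'a, 'o, 'a, 'a, ('p \<times> 'b \<times> 'b) set) cell" where
  "rep_unit F = \<lparr>csrc = pid (fdom F), ctgt = corep F \<odot> rep F,
     cmpt = (\<lambda>(y, x) k. pcls (corep F) (rep F) (y, x) (fo F x, (Idn (fcod F) (fo F x), fa F k)))\<rparr>"

text \<open>A representative consists of arrows from \<open>y\<close> to \<open>F a\<close> and from
  \<open>F a\<close> to \<open>x\<close>. Sliding along an arrow between two choices of
  \<open>a\<close> does not change their composite.\<close>

definition rep_counit :: "('o, 'a, 'p, 'b) functr \<Rightarrow>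
   ('p, 'b, 'p, 'b, ('o \<times> 'b \<times> 'b) set, 'b) cell" where
  "rep_counit F = \<lparr>csrc = rep F \<odot> corep F, ctgt = pid (fcod F),
     cmpt = (\<lambda>_. on_class (\<lambda>(a, (u, v)). Cmp (fcod F) u v))\<rparr>"

lemma two_cell_idc: "profunctor A B P \<Longrightarrow> two_cell P P (idc P)"
  by (rule two_cellI) auto

context
  fixes A :: "('o, 'a) cat" and B :: "('p, 'b) cat" and F :: "('o, 'a, 'p, 'b) functr"
  assumes F: "is_functor A B F"
begin

lemma rep_counit_pcls:
  assumes "y \<in> Obj B" "x \<in> Obj B" "a \<in> Obj A" "u \<in> hom B (fo F a) x" "v \<in> hom B y (fo F a)"
  shows "cmpt (rep_counit F) (y, x) (pcls (rep F) (corep F) (y, x) (a, (u, v))) = Cmp B u v"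
proof -
  note [simp] = is_functorD[OF F]
  have "on_class (\<lambda>(a, (u, v)). Cmp B u v) (pcls (rep F) (corep F) (y, x) (a, (u, v))) =
      (\<lambda>(a, (u, v)). Cmp B u v) (a, (u, v))"
    by (rule on_class_pcls[OF profunctor_corep[OF F] profunctor_rep[OF F]])
      (use assms in \<open>auto simp: hom_iff Cmp_assoc\<close>)
  then show ?thesis by (simp add: rep_counit_def)
qed

lemma two_cell_rep_counit: "two_cell (rep F \<odot> corep F) (pid B) (rep_counit F)"
proof -
  note [simp] = is_functorD[OF F]
  note P = profunctor_corep[OF F] profunctor_rep[OF F]
  show ?thesis
  proof (rule two_cellI[OF _ _ profunctor_pcomp[OF P] profunctor_pid])
    fix h f X assume "h \<in> Arr B" "f \<in> Arr B" "X \<in> El (rep F \<odot> corep F) (Cod B h, Dom B f)"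
    then show "cmpt (rep_counit F) (Dom B h, Cod B f) (Act (rep F \<odot> corep F) (h, f) X) =
        Act (pid B) (h, f) (cmpt (rep_counit F) (Cod B h, Dom B f) X)"
      by (auto elim!: pcls_cases simp: Act_pcomp[OF P] rep_counit_pcls hom_iff Cmp_assoc)
  next
    fix y x X assume "y \<in> Obj B" "x \<in> Obj B" "X \<in> El (rep F \<odot> corep F) (y, x)"
    then show "cmpt (rep_counit F) (y, x) X \<in> El (pid B) (y, x)"
      by (auto elim!: pcls_cases simp: rep_counit_pcls hom_iff)
  qed (simp_all add: rep_counit_def)
qed

lemma two_cell_rep_unit: "two_cell (pid A) (corep F \<odot> rep F) (rep_unit F)"
proof -
  note [simp] = is_functorD[OF F]
  note P = profunctor_rep[OF F] profunctor_corep[OF F]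
  show ?thesis
  proof (rule two_cellI[OF _ _ profunctor_pid profunctor_pcomp[OF P]])
    fix h f k assume h: "h \<in> Arr A" "f \<in> Arr A" "k \<in> El (pid A) (Cod A h, Dom A f)"
    then show "cmpt (rep_unit F) (Dom A h, Cod A f) (Act (pid A) (h, f) k) =
        Act (corep F \<odot> rep F) (h, f) (cmpt (rep_unit F) (Cod A h, Dom A f) k)"
      \<comment> \<open>Acting on the class puts \<open>F f\<close> into the first entry; one slide
        moves it to the second and restores the identity in the first.\<close>
      using pcls_gen[OF P, of "Dom A h" "Cod A f" "fa F f" "fo F (Dom A f)" "fo F (Cod A f)"
          "Idn B (fo F (Cod A f))" "Cmp B (fa F k) (fa F h)"]
      by (simp add: rep_unit_def Act_pcomp[OF P] hom_iff Cmp_assoc)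
  next
    fix y x k assume "y \<in> Obj A" "x \<in> Obj A" "k \<in> El (pid A) (y, x)"
    then show "cmpt (rep_unit F) (y, x) k \<in> El (corep F \<odot> rep F) (y, x)"
      by (auto simp: rep_unit_def hom_iff intro!: pcls_in)
  qed (simp_all add: rep_unit_def)
qed

text \<open>Each triangle identity is checked by following one element through the five maps of the
  composite, always with a representative built from that element and identities.\<close>

lemma adjunction_rep: "adjunction (rep F) (corep F) (rep_unit F) (rep_counit F)"
proof -
  note [simp] = is_functorD[OF F]
  note R = profunctor_rep[OF F] and K = profunctor_corep[OF F]
  have unit: "cmpt (rep_unit F) (a, a) (Idn A a) =
      pcls (corep F) (rep F) (a, a) (fo F a, (Idn B (fo F a), Idn B (fo F a)))" if "a \<in> Obj A" for a
    using that by (simp add: rep_unit_def)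
  have 1: "plunit (rep F) \<bullet> (rep_counit F \<star> idc (rep F)) \<bullet> cinv (passoc (rep F) (corep F) (rep F)) \<bullet>
      (idc (rep F) \<star> rep_unit F) \<bullet> cinv (prunit (rep F)) \<doteq> idc (rep F)"
  proof -
    have "cmpt (plunit (rep F)) (b, a) (cmpt (rep_counit F \<star> idc (rep F)) (b, a)
        (cmpt (cinv (passoc (rep F) (corep F) (rep F))) (b, a) (cmpt (idc (rep F) \<star> rep_unit F) (b, a)
        (cmpt (cinv (prunit (rep F))) (b, a) x)))) = x"
      if o: "b \<in> Obj B" "a \<in> Obj A" and x: "x \<in> hom B b (fo F a)" for a b x
    proof -
      let ?i = "Idn B (fo F a)"
      have i: "?i \<in> hom B (fo F a) (fo F a)" using o by (simp add: Idn_hom)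
      have "cmpt (cinv (prunit (rep F))) (b, a) x = pcls (rep F) (pid A) (b, a) (a, (Idn A a, x))"
        using prunit_bij[OF R o] o x
        by (intro cinv_cmpt) (auto simp: bij_betw_def prunit_pcls[OF R] hom_iff intro!: pcls_in)
      moreover have "cmpt (idc (rep F) \<star> rep_unit F) (b, a) (pcls (rep F) (pid A) (b, a) (a, (Idn A a, x))) =
          pcls (rep F) (corep F \<odot> rep F) (b, a) (a, (pcls (corep F) (rep F) (a, a) (fo F a, (?i, ?i)), x))"
        using o x
        by (subst hcomp_pcls[OF profunctor_pid R two_cell_idc[OF R] two_cell_rep_unit])
          (auto simp: unit hom_iff)
      \<comment> \<open>The inverse associator is evaluated by exhibiting a preimage, which
        \<open>passoc_inj\<close> makes unique.\<close>
      moreover have "cmpt (cinv (passoc (rep F) (corep F) (rep F))) (b, a)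
          (pcls (rep F) (corep F \<odot> rep F) (b, a) (a, (pcls (corep F) (rep F) (a, a) (fo F a, (?i, ?i)), x))) =
          pcls (rep F \<odot> corep F) (rep F) (b, a) (fo F a, (?i, pcls (rep F) (corep F) (b, fo F a) (a, (?i, x))))"
        using o x i by (intro cinv_cmpt)
          (auto simp: passoc_pcls[OF R K R] intro!: pcls_in passoc_inj[OF R K R])
      moreover have "cmpt (rep_counit F \<star> idc (rep F)) (b, a)
          (pcls (rep F \<odot> corep F) (rep F) (b, a) (fo F a, (?i, pcls (rep F) (corep F) (b, fo F a) (a, (?i, x))))) =
          pcls (pid B) (rep F) (b, a) (fo F a, (?i, x))"
        using o x i
        by (subst hcomp_pcls[OF R profunctor_pcomp[OF K R] two_cell_rep_counit two_cell_idc[OF R]])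
          (auto simp: rep_counit_pcls hom_iff intro!: pcls_in)
      ultimately show ?thesis
        using o x i by (simp add: plunit_pcls[OF R] hom_iff)
    qed
    then show ?thesis by (auto simp: cell_eq_def prunit_def)
  qed
  have 2: "prunit (corep F) \<bullet> (idc (corep F) \<star> rep_counit F) \<bullet> passoc (corep F) (rep F) (corep F) \<bullet>
      (rep_unit F \<star> idc (corep F)) \<bullet> cinv (plunit (corep F)) \<doteq> idc (corep F)"
  proof -
    have "cmpt (prunit (corep F)) (a, b) (cmpt (idc (corep F) \<star> rep_counit F) (a, b)
        (cmpt (passoc (corep F) (rep F) (corep F)) (a, b) (cmpt (rep_unit F \<star> idc (corep F)) (a, b)
        (cmpt (cinv (plunit (corep F))) (a, b) x)))) = x"
      if o: "b \<in> Obj B" "a \<in> Obj A" and x: "x \<in> hom B (fo F a) b" for a b x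
    proof -
      let ?i = "Idn B (fo F a)"
      have i: "?i \<in> hom B (fo F a) (fo F a)" using o by (simp add: Idn_hom)
      have "cmpt (cinv (plunit (corep F))) (a, b) x = pcls (pid A) (corep F) (a, b) (a, (x, Idn A a))"
        using plunit_bij[OF K o(2,1)] o x
        by (intro cinv_cmpt) (auto simp: bij_betw_def plunit_pcls[OF K] hom_iff intro!: pcls_in)
      moreover have "cmpt (rep_unit F \<star> idc (corep F)) (a, b) (pcls (pid A) (corep F) (a, b) (a, (x, Idn A a))) =
          pcls (corep F \<odot> rep F) (corep F) (a, b) (a, (x, pcls (corep F) (rep F) (a, a) (fo F a, (?i, ?i))))"
        using o x
        by (subst hcomp_pcls[OF K profunctor_pid two_cell_rep_unit two_cell_idc[OF K]])
          (auto simp: unit hom_iff)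
      moreover have "cmpt (passoc (corep F) (rep F) (corep F)) (a, b)
          (pcls (corep F \<odot> rep F) (corep F) (a, b) (a, (x, pcls (corep F) (rep F) (a, a) (fo F a, (?i, ?i))))) =
          pcls (corep F) (rep F \<odot> corep F) (a, b) (fo F a, (pcls (rep F) (corep F) (fo F a, b) (a, (x, ?i)), ?i))"
        using o x i by (simp add: passoc_pcls[OF K R K])
      moreover have "cmpt (idc (corep F) \<star> rep_counit F) (a, b)
          (pcls (corep F) (rep F \<odot> corep F) (a, b) (fo F a, (pcls (rep F) (corep F) (fo F a, b) (a, (x, ?i)), ?i))) =
          pcls (corep F) (pid B) (a, b) (fo F a, (x, ?i))"
        using o x i
        by (subst hcomp_pcls[OF profunctor_pcomp[OF K R] K two_cell_idc[OF K] two_cell_rep_counit])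
          (auto simp: rep_counit_pcls hom_iff intro!: pcls_in)
      ultimately show ?thesis
        using o x i by (simp add: prunit_pcls[OF K] hom_iff)
    qed
    then show ?thesis by (auto simp: cell_eq_def plunit_def)
  qed
  show ?thesis
    unfolding adjunction_def Let_def
    using R K two_cell_rep_unit two_cell_rep_counit 1 2 by simp
qed

lemma has_right_adjoint_rep: "has_right_adjoint (rep F)"
  unfolding has_right_adjoint_def using adjunction_rep by blast

end

text \<open>The co-Yoneda isomorphism \<open>\<integral>\<^sup>b Hom b (\<Phi> x) \<times> P (y, b) \<cong> P (y, \<Phi> x)\<close>.\<close>

definition coyoneda :: "('p, 'b, 'q, 'c, 'v) prof \<Rightarrow> ('o, 'a, 'p, 'b) functr \<Rightarrow>
   ('o, 'a, 'q, 'c, ('p \<times> 'b \<times> 'v) set, 'v) cell" where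
  "coyoneda P \<Phi> = \<lparr>csrc = P \<odot> rep \<Phi>, ctgt = P \<triangleleft> \<Phi>,
     cmpt = (\<lambda>(y, x). on_class (\<lambda>(b, (k, v)). Act P (Idn (ptgt P) y, k) v))\<rparr>"

lemma invertible_coyoneda:
  assumes P: "profunctor B E P" and \<Phi>: "is_functor A B \<Phi>"
  shows "invertible_cell (P \<odot> rep \<Phi>) (P \<triangleleft> \<Phi>) (coyoneda P \<Phi>)"
proof (rule invertible_cellI)
  note R = profunctor_rep[OF \<Phi>]
  note [simp] = profunctorD[OF P] is_functorD[OF \<Phi>] hom_iff
  have c: "cmpt (coyoneda P \<Phi>) (y, x) (pcls P (rep \<Phi>) (y, x) (b, (k, v))) = Act P (Idn E y, k) v"
    if "y \<in> Obj E" "x \<in> Obj A" "b \<in> Obj B" "k \<in> hom B b (fo \<Phi> x)" "v \<in> El P (y, b)" for y x b k v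
  proof -
    have "on_class (\<lambda>(b, (k, v)). Act P (Idn E y, k) v) (pcls P (rep \<Phi>) (y, x) (b, (k, v))) =
        (\<lambda>(b, (k, v)). Act P (Idn E y, k) v) (b, (k, v))"
      by (rule on_class_pcls[OF R P]) (use that in auto)
    then show ?thesis by (simp add: coyoneda_def)
  qed
  show PR: "profunctor A E (P \<odot> rep \<Phi>)" by (rule profunctor_pcomp[OF R P])
  show "two_cell (P \<odot> rep \<Phi>) (P \<triangleleft> \<Phi>) (coyoneda P \<Phi>)"
  proof (rule two_cellI[OF _ _ PR profunctor_psub[OF P \<Phi>]])
    fix h f X assume "h \<in> Arr E" "f \<in> Arr A" "X \<in> El (P \<odot> rep \<Phi>) (Cod E h, Dom A f)"
    then show "cmpt (coyoneda P \<Phi>) (Dom E h, Cod A f) (Act (P \<odot> rep \<Phi>) (h, f) X) =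
        Act (P \<triangleleft> \<Phi>) (h, f) (cmpt (coyoneda P \<Phi>) (Cod E h, Dom A f) X)"
      by (auto elim!: pcls_cases simp: Act_pcomp[OF R P] c)
  next
    fix y x X assume "y \<in> Obj E" "x \<in> Obj A" "X \<in> El (P \<odot> rep \<Phi>) (y, x)"
    then show "cmpt (coyoneda P \<Phi>) (y, x) X \<in> El (P \<triangleleft> \<Phi>) (y, x)"
      by (auto elim!: pcls_cases simp: c)
  qed (simp_all add: coyoneda_def)
  fix y x assume yx: "y \<in> Obj E" "x \<in> Obj A"
  show "bij_betw (cmpt (coyoneda P \<Phi>) (y, x)) (El (P \<odot> rep \<Phi>) (y, x)) (El (P \<triangleleft> \<Phi>) (y, x))"
  \<comment> \<open>The inverse inserts the identity of \<open>fo \<Phi> x\<close>; sliding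
    \<open>k\<close> onto \<open>v\<close> brings every class to this form.\<close>
  proof (rule bij_betw_byWitness[where f' = "\<lambda>v. pcls P (rep \<Phi>) (y, x) (fo \<Phi> x, (Idn B (fo \<Phi> x), v))"])
    have "pcls P (rep \<Phi>) (y, x) (fo \<Phi> x, (Idn B (fo \<Phi> x), Act P (Idn E y, k) v)) =
        pcls P (rep \<Phi>) (y, x) (b, (k, v))"
      if "b \<in> Obj B" "k \<in> hom B b (fo \<Phi> x)" "v \<in> El P (y, b)" for b k v
      using pcls_gen[OF R P, of y x k b "fo \<Phi> x" "Idn B (fo \<Phi> x)" v] that yx by auto
    then show "\<forall>X\<in>El (P \<odot> rep \<Phi>) (y, x).
        pcls P (rep \<Phi>) (y, x) (fo \<Phi> x, (Idn B (fo \<Phi> x), cmpt (coyoneda P \<Phi>) (y, x) X)) = X"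
      using yx by (auto elim!: pcls_cases simp: c)
  qed (use yx in \<open>auto elim!: pcls_cases intro!: pcls_in simp: c\<close>)
qed

section \<open>The Frobenius form of a \<open>\<star>\<close>-autonomous category\<close>

text \<open>Both variables are covariant over \<open>op_cat C\<close>: its arrows are reversed in
  \<open>C\<close>, so they act on \<open>x\<close> by precomposition and on \<open>y\<close> by
  postcomposition with their images under \<open>D\<close>.\<close>

definition dual_form :: "('o, 'a) cat \<Rightarrow> ('o, 'a, 'o, 'a) functr \<Rightarrow>
   ('o \<times> 'o, 'a \<times> 'a, unit, unit, 'a) prof" where
  "dual_form C D = \<lparr>psrc = op_cat C \<times>\<^sub>c op_cat C, ptgt = unit_cat,
     El = (\<lambda>(_, (x, y)). hom C x (fo D y)),
     Act = (\<lambda>(_, (f, g)) u. Cmp C (fa D g) (Cmp C u f))\<rparr>"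

definition dual_coform :: "('o, 'a) cat \<Rightarrow> ('o, 'a, 'o, 'a) functr \<Rightarrow>
   (unit, unit, 'o \<times> 'o, 'a \<times> 'a, 'a) prof" where
  "dual_coform C D = \<lparr>psrc = unit_cat, ptgt = op_cat C \<times>\<^sub>c op_cat C,
     El = (\<lambda>((y, x), _). hom C (fo D y) x),
     Act = (\<lambda>((f, g), _) k. Cmp C g (Cmp C k (fa D f)))\<rparr>"

lemma dual_form_simps [simp]:
  "psrc (dual_form C D) = op_cat C \<times>\<^sub>c op_cat C" "ptgt (dual_form C D) = unit_cat"
  "El (dual_form C D) (t, (x, y)) = hom C x (fo D y)"
  "Act (dual_form C D) (t', (f, g)) u = Cmp C (fa D g) (Cmp C u f)"
  by (simp_all add: dual_form_def)

lemma dual_coform_simps [simp]: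
  "psrc (dual_coform C D) = unit_cat" "ptgt (dual_coform C D) = op_cat C \<times>\<^sub>c op_cat C"
  "El (dual_coform C D) ((y, x), t) = hom C (fo D y) x"
  "Act (dual_coform C D) ((f, g), t') k = Cmp C g (Cmp C k (fa D f))"
  by (simp_all add: dual_coform_def)

context
  fixes C :: "('o, 'a) cat" and D :: "('o, 'a, 'o, 'a) functr"
  assumes equiv: "equivalence (op_cat C) C D"
begin

abbreviation (input) "Cop \<equiv> op_cat C"

lemma functor_D: "is_functor (op_cat C) C D"
  using equiv by (simp add: equivalence_def)

lemmas D_simps = is_functorD[OF functor_D, simplified]

lemma profunctor_dual_form: "profunctor (Cop \<times>\<^sub>c Cop) unit_cat (dual_form C D)"
  by (rule profunctorI) (use D_simps in \<open>auto simp: hom_iff Cmp_assoc\<close>)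

lemma profunctor_dual_coform: "profunctor unit_cat (Cop \<times>\<^sub>c Cop) (dual_coform C D)"
  by (rule profunctorI) (use D_simps in \<open>auto simp: hom_iff Cmp_assoc\<close>)

lemma D_bij: "x \<in> Obj C \<Longrightarrow> y \<in> Obj C \<Longrightarrow> bij_betw (fa D) (hom C y x) (hom C (fo D x) (fo D y))"
  using equivalence_fully_faithful[OF equiv, of x y] by simp

text \<open>
  An element of the snake composite at \<open>(y', y)\<close> consists of arrows \<open>k : D b1 \<rightarrow> b2\<close>, \<open>f : y \<rightarrow> b3\<close>,
  \<open>g : b1 \<rightarrow> y'\<close>, \<open>s : b2 \<rightarrow> D b3\<close> of \<open>C\<close>. It is sent to the arrow \<open>y \<rightarrow> y'\<close> whose image under \<open>D\<close> is
  \<open>D f \<circ> s \<circ> k \<circ> D g\<close>; this needs only that \<open>D\<close> is fully faithful.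
\<close>

lemma snake_1:
  "\<exists>\<zeta>. invertible_cell (((pid Cop \<otimes> dual_form C D) \<triangleleft> fassoc Cop Cop Cop) \<odot> (dual_coform C D \<otimes> pid Cop))
    (frunit Cop \<triangleright> pid Cop \<triangleleft> flunit Cop) \<zeta>"
proof -
  note [simp] = D_simps
  let ?V = "(pid Cop \<otimes> dual_form C D) \<triangleleft> fassoc Cop Cop Cop" and ?U = "dual_coform C D \<otimes> pid Cop"
  have Cop: "category Cop" by simp
  have U: "profunctor (unit_cat \<times>\<^sub>c Cop) ((Cop \<times>\<^sub>c Cop) \<times>\<^sub>c Cop) ?U"
    by (rule profunctor_ptens[OF profunctor_dual_coform profunctor_pid[OF Cop]])
  have V: "profunctor ((Cop \<times>\<^sub>c Cop) \<times>\<^sub>c Cop) (Cop \<times>\<^sub>c unit_cat) ?V"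
    by (rule profunctor_psub[OF profunctor_ptens[OF profunctor_pid[OF Cop] profunctor_dual_form]]) simp
  note P = profunctor_pcomp[OF U V]
  have Q: "profunctor (unit_cat \<times>\<^sub>c Cop) (Cop \<times>\<^sub>c unit_cat) (frunit Cop \<triangleright> pid Cop \<triangleleft> flunit Cop)"
    by (rule profunctor_psubt[OF profunctor_psub[OF profunctor_pid[OF Cop]]]) simp_all
  define \<psi> where "\<psi> = on_class (\<lambda>(((b1::'o, b2::'o), b3::'o), ((k, f), (g, s))).
    Cmp C (fa D f) (Cmp C s (Cmp C k (fa D g))))"
  \<comment> \<open>The arrow \<psi> X is in the image of \<open>D\<close> by fullness, and
    faithfulness makes the preimage chosen by \<open>inv_into\<close> the only one.\<close>
  define \<zeta> where "\<zeta> = \<lparr>csrc = ?V \<odot> ?U, ctgt = frunit Cop \<triangleright> pid Cop \<triangleleft> flunit Cop,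
    cmpt = (\<lambda>((y', _), (_, y)) X. inv_into (hom C y y') (fa D) (\<psi> X))\<rparr>"
  let ?cls = "\<lambda>y' y. pcls ?V ?U ((y', ()), ((), y))"
  have \<psi>: "\<psi> (?cls y' y (((b1, b2), b3), ((k, f), (g, s)))) = Cmp C (fa D f) (Cmp C s (Cmp C k (fa D g)))"
    if "y' \<in> Obj C" "y \<in> Obj C" "b1 \<in> Obj C" "b2 \<in> Obj C" "b3 \<in> Obj C" "k \<in> hom C (fo D b1) b2"
      "f \<in> hom C y b3" "g \<in> hom C b1 y'" "s \<in> hom C b2 (fo D b3)" for y' y b1 b2 b3 k f g s
  proof -
    let ?f = "\<lambda>(((b1, b2), b3), ((k, f), (g, s))). Cmp C (fa D f) (Cmp C s (Cmp C k (fa D g)))"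
    have "on_class ?f (?cls y' y (((b1, b2), b3), ((k, f), (g, s)))) = ?f (((b1, b2), b3), ((k, f), (g, s)))"
      by (rule on_class_pcls[OF U V]) (use that in \<open>auto simp: hom_iff Cmp_assoc\<close>)
    then show ?thesis by (simp add: \<psi>_def)
  qed
  have \<zeta>: "\<psi> X \<in> hom C (fo D y') (fo D y) \<and> cmpt \<zeta> ((y', ()), ((), y)) X \<in> hom C y y' \<and>
      fa D (cmpt \<zeta> ((y', ()), ((), y)) X) = \<psi> X"
    if y: "y' \<in> Obj C" "y \<in> Obj C" and X: "X \<in> El (?V \<odot> ?U) ((y', ()), ((), y))" for y' y X
  proof -
    have *: "\<psi> X \<in> hom C (fo D y') (fo D y)"
      using X y by (auto elim!: pcls_cases simp: \<psi> hom_iff)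
    then have **: "\<psi> X \<in> fa D ` hom C y y'"
      using D_bij[OF y] by (simp add: bij_betw_def)
    show ?thesis
      using * inv_into_into[OF **] f_inv_into_f[OF **] by (simp add: \<zeta>_def)
  qed
  have nf: "?cls y' y (((b1, b2), b3), ((k, f), (g, s))) =
      ?cls y' y (((y', fo D y'), y), ((Idn C (fo D y'), Idn C y),
        (Idn C y', Cmp C (fa D f) (Cmp C s (Cmp C k (fa D g))))))"
    if y: "y' \<in> Obj C" "y \<in> Obj C" "b1 \<in> Obj C" "b2 \<in> Obj C" "b3 \<in> Obj C" and k: "k \<in> hom C (fo D b1) b2"
      "f \<in> hom C y b3" "g \<in> hom C b1 y'" "s \<in> hom C b2 (fo D b3)" for y' y b1 b2 b3 k f g s
  proof -
    \<comment> \<open>Three slides: \<open>k\<close> and \<open>f\<close> are absorbed into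
      \<open>s\<close>, then \<open>g\<close> moves to the coevaluation where it becomes
      \<open>D g\<close>, and finally \<open>D g\<close> is absorbed into the evaluation entry.
      Identities remain everywhere else.\<close>
    let ?s = "Cmp C (fa D f) (Cmp C s k)"
    have "?cls y' y (((b1, b2), b3), ((k, f), (g, s))) =
        ?cls y' y (((b1, fo D b1), y), ((Idn C (fo D b1), Idn C y), (g, ?s)))"
      using pcls_gen[OF U V, of "(y', ())" "((), y)" "((Idn C b1, k), f)" "((b1, b2), b3)"
          "((b1, fo D b1), y)" "(Idn C (fo D b1), Idn C y)" "(g, s)"] y k
      by (simp add: hom_iff Cmp_assoc)
    also have "\<dots> = ?cls y' y (((y', fo D b1), y), ((fa D g, Idn C y), (Idn C y', ?s)))"
      using pcls_gen[OF U V, of "(y', ())" "((), y)" "((g, Idn C (fo D b1)), Idn C y)"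
          "((y', fo D b1), y)" "((b1, fo D b1), y)" "(Idn C (fo D b1), Idn C y)" "(Idn C y', ?s)"] y k
      by (simp add: hom_iff Cmp_assoc)
    also have "\<dots> = ?cls y' y (((y', fo D y'), y), ((Idn C (fo D y'), Idn C y), (Idn C y', Cmp C ?s (fa D g))))"
      using pcls_gen[OF U V, of "(y', ())" "((), y)" "((Idn C y', fa D g), Idn C y)"
          "((y', fo D b1), y)" "((y', fo D y'), y)" "(Idn C (fo D y'), Idn C y)" "(Idn C y', ?s)"] y k
      by (simp add: hom_iff Cmp_assoc)
    finally show ?thesis using y k by (simp add: hom_iff Cmp_assoc)
  qed
  have inj: "z = z'" if "y' \<in> Obj C" "y \<in> Obj C" "z \<in> hom C y y'" "z' \<in> hom C y y'" "fa D z = fa D z'"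
    for y y' z z'
    using D_bij[of y' y] that by (auto simp: bij_betw_def dest: inj_onD)
  have "invertible_cell (?V \<odot> ?U) (frunit Cop \<triangleright> pid Cop \<triangleleft> flunit Cop) \<zeta>"
  proof (rule invertible_cellI[OF _ P])
    show "two_cell (?V \<odot> ?U) (frunit Cop \<triangleright> pid Cop \<triangleleft> flunit Cop) \<zeta>"
    proof (rule two_cellI[OF _ _ P Q])
      fix y x X assume "y \<in> Obj (Cop \<times>\<^sub>c unit_cat)" "x \<in> Obj (unit_cat \<times>\<^sub>c Cop)" "X \<in> El (?V \<odot> ?U) (y, x)"
      then show "cmpt \<zeta> (y, x) X \<in> El (frunit Cop \<triangleright> pid Cop \<triangleleft> flunit Cop) (y, x)"
        using \<zeta> by auto
    next
      fix h f X assume hf: "h \<in> Arr (Cop \<times>\<^sub>c unit_cat)" "f \<in> Arr (unit_cat \<times>\<^sub>c Cop)"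
        and X: "X \<in> El (?V \<odot> ?U) (Cod (Cop \<times>\<^sub>c unit_cat) h, Dom (unit_cat \<times>\<^sub>c Cop) f)"
      obtain h' f' where eq: "h = (h', ())" "f = ((), f')" by (cases h; cases f) auto
      have hf': "h' \<in> Arr C" "f' \<in> Arr C" using hf by (auto simp: eq)
      have X': "X \<in> El (?V \<odot> ?U) ((Dom C h', ()), ((), Cod C f'))" using X by (simp add: eq)
      let ?X = "Act (?V \<odot> ?U) (h, f) X"
      have aX: "?X \<in> El (?V \<odot> ?U) ((Cod C h', ()), ((), Dom C f'))"
        using profunctorD(5)[OF P hf X] hf' by (simp add: eq)
      have "\<psi> ?X = Cmp C (fa D f') (Cmp C (\<psi> X) (fa D h'))"
        using X' hf' by (auto elim!: pcls_cases simp: eq Act_pcomp[OF U V] \<psi> hom_iff Cmp_assoc)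
      note D_X = this
      have o: "Cod C h' \<in> Obj C" "Dom C f' \<in> Obj C" "Dom C h' \<in> Obj C" "Cod C f' \<in> Obj C"
        using hf' by simp_all
      define z where "z = cmpt \<zeta> ((Dom C h', ()), ((), Cod C f')) X"
      have z: "z \<in> hom C (Cod C f') (Dom C h')" "fa D z = \<psi> X"
        using \<zeta>[OF o(3,4) X'] by (auto simp: z_def)
      \<comment> \<open>Faithfulness reduces naturality to an equation after applying
        \<open>D\<close>, where the value of the cell is given by \<psi>.\<close>
      have "cmpt \<zeta> ((Cod C h', ()), ((), Dom C f')) ?X = Cmp C h' (Cmp C z f')"
      proof (rule inj[of "Cod C h'" "Dom C f'"])
        show "cmpt \<zeta> ((Cod C h', ()), ((), Dom C f')) ?X \<in> hom C (Dom C f') (Cod C h')"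
          using \<zeta>[OF o(1,2) aX] by blast
        have "fa D (Cmp C h' (Cmp C z f')) = Cmp C (fa D f') (Cmp C (fa D z) (fa D h'))"
          using z(1) hf' by (simp add: hom_iff Cmp_assoc)
        then show "fa D (cmpt \<zeta> ((Cod C h', ()), ((), Dom C f')) ?X) = fa D (Cmp C h' (Cmp C z f'))"
          using \<zeta>[OF o(1,2) aX] D_X z(2) by simp
      qed (use z(1) hf' in \<open>simp_all add: hom_iff\<close>)
      then show "cmpt \<zeta> (Dom (Cop \<times>\<^sub>c unit_cat) h, Cod (unit_cat \<times>\<^sub>c Cop) f) ?X =
          Act (frunit Cop \<triangleright> pid Cop \<triangleleft> flunit Cop) (h, f)
            (cmpt \<zeta> (Cod (Cop \<times>\<^sub>c unit_cat) h, Dom (unit_cat \<times>\<^sub>c Cop) f) X)"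
        using z(1) hf' by (simp add: eq hom_iff Cmp_assoc flip: z_def)
    qed (simp_all add: \<zeta>_def)
  next
    fix y x assume "y \<in> Obj (Cop \<times>\<^sub>c unit_cat)" "x \<in> Obj (unit_cat \<times>\<^sub>c Cop)"
    then obtain y1 x1 where yx: "y = (y1, ())" "x = ((), x1)" "y1 \<in> Obj C" "x1 \<in> Obj C" by auto
    show "bij_betw (cmpt \<zeta> (y, x)) (El (?V \<odot> ?U) (y, x)) (El (frunit Cop \<triangleright> pid Cop \<triangleleft> flunit Cop) (y, x))"
    \<comment> \<open>The arrow \<open>z\<close> enters as \<open>D z\<close> in the evaluation,
      with identities in the other three entries; by \<open>nf\<close> every class has this
      shape.\<close>
    proof (rule bij_betw_byWitness[where f' = "\<lambda>z. ?cls y1 x1 (((y1, fo D y1), x1),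
          ((Idn C (fo D y1), Idn C x1), (Idn C y1, fa D z)))"])
      show "\<forall>X\<in>El (?V \<odot> ?U) (y, x). ?cls y1 x1 (((y1, fo D y1), x1),
          ((Idn C (fo D y1), Idn C x1), (Idn C y1, fa D (cmpt \<zeta> (y, x) X)))) = X"
      proof
        fix X assume X: "X \<in> El (?V \<odot> ?U) (y, x)"
        then have c: "fa D (cmpt \<zeta> (y, x) X) = \<psi> X" using \<zeta> yx by simp
        from X obtain b1 b2 b3 k f g s where X: "X = ?cls y1 x1 (((b1, b2), b3), ((k, f), (g, s)))"
          and b: "b1 \<in> Obj C" "b2 \<in> Obj C" "b3 \<in> Obj C" "k \<in> hom C (fo D b1) b2"
          "f \<in> hom C x1 b3" "g \<in> hom C b1 y1" "s \<in> hom C b2 (fo D b3)"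
          by (auto elim!: pcls_cases simp: yx)
        have v: "\<psi> X = Cmp C (fa D f) (Cmp C s (Cmp C k (fa D g)))"
          unfolding X by (rule \<psi>) (use b yx in auto)
        show "?cls y1 x1 (((y1, fo D y1), x1),
          ((Idn C (fo D y1), Idn C x1), (Idn C y1, fa D (cmpt \<zeta> (y, x) X)))) = X"
          unfolding c v unfolding X by (rule nf[symmetric]) (use b yx in auto)
      qed
      have in_P: "?cls y1 x1 (((y1, fo D y1), x1), ((Idn C (fo D y1), Idn C x1), (Idn C y1, fa D z)))
          \<in> El (?V \<odot> ?U) (y, x)" if "z \<in> hom C x1 y1" for z
        using that yx by (auto simp: hom_iff intro!: pcls_in)
      show "\<forall>z\<in>El (frunit Cop \<triangleright> pid Cop \<triangleleft> flunit Cop) (y, x). cmpt \<zeta> (y, x) (?cls y1 x1 (((y1, fo D y1), x1),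
          ((Idn C (fo D y1), Idn C x1), (Idn C y1, fa D z)))) = z"
      proof
        fix z assume "z \<in> El (frunit Cop \<triangleright> pid Cop \<triangleleft> flunit Cop) (y, x)"
        then have z: "z \<in> hom C x1 y1" by (simp add: yx)
        let ?Z = "?cls y1 x1 (((y1, fo D y1), x1), ((Idn C (fo D y1), Idn C x1), (Idn C y1, fa D z)))"
        have *: "\<psi> ?Z = fa D z"
          using z yx(3,4) by (subst \<psi>) (auto simp: hom_iff)
        note zZ = \<zeta>[OF yx(3,4) in_P[OF z, unfolded yx(1,2)]]
        show "cmpt \<zeta> (y, x) ?Z = z"
          unfolding yx(1,2)
        proof (rule inj[OF yx(3,4)])
          show "cmpt \<zeta> ((y1, ()), ((), x1)) ?Z \<in> hom C x1 y1" using zZ by blast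
          show "fa D (cmpt \<zeta> ((y1, ()), ((), x1)) ?Z) = fa D z" using zZ * by metis
        qed (rule z)
      qed
      show "cmpt \<zeta> (y, x) ` El (?V \<odot> ?U) (y, x) \<subseteq> El (frunit Cop \<triangleright> pid Cop \<triangleleft> flunit Cop) (y, x)"
        using \<zeta> yx by auto
      show "(\<lambda>z. ?cls y1 x1 (((y1, fo D y1), x1), ((Idn C (fo D y1), Idn C x1), (Idn C y1, fa D z)))) `
          El (frunit Cop \<triangleright> pid Cop \<triangleleft> flunit Cop) (y, x) \<subseteq> El (?V \<odot> ?U) (y, x)"
        using in_P yx by auto
    qed
  qed
  then show ?thesis by blast
qed

text \<open>Here the composite \<open>g \<circ> k \<circ> s \<circ> f\<close> is inverted by factoring through some \<open>D w \<cong> x\<close>.\<close>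

lemma snake_2:
  "\<exists>\<zeta>. invertible_cell (((dual_form C D \<otimes> pid Cop) \<triangleleft> fassoc_inv Cop Cop Cop) \<odot> (pid Cop \<otimes> dual_coform C D))
    (flunit Cop \<triangleright> pid Cop \<triangleleft> frunit Cop) \<zeta>"
proof -
  note [simp] = D_simps
  let ?V = "(dual_form C D \<otimes> pid Cop) \<triangleleft> fassoc_inv Cop Cop Cop" and ?U = "pid Cop \<otimes> dual_coform C D"
  have Cop: "category Cop" by simp
  have U: "profunctor (Cop \<times>\<^sub>c unit_cat) (Cop \<times>\<^sub>c (Cop \<times>\<^sub>c Cop)) ?U"
    by (rule profunctor_ptens[OF profunctor_pid[OF Cop] profunctor_dual_coform])
  have V: "profunctor (Cop \<times>\<^sub>c (Cop \<times>\<^sub>c Cop)) (unit_cat \<times>\<^sub>c Cop) ?V"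
    by (rule profunctor_psub[OF profunctor_ptens[OF profunctor_dual_form profunctor_pid[OF Cop]]]) simp
  note P = profunctor_pcomp[OF U V]
  have Q: "profunctor (Cop \<times>\<^sub>c unit_cat) (unit_cat \<times>\<^sub>c Cop) (flunit Cop \<triangleright> pid Cop \<triangleleft> frunit Cop)"
    by (rule profunctor_psubt[OF profunctor_psub[OF profunctor_pid[OF Cop]]]) simp_all
  let ?f = "\<lambda>((b1, (b2, b3)), ((f, k), (s, g))). Cmp C g (Cmp C k (Cmp C s f))"
  define \<zeta> where "\<zeta> = \<lparr>csrc = ?V \<odot> ?U, ctgt = flunit Cop \<triangleright> pid Cop \<triangleleft> frunit Cop, cmpt = (\<lambda>_. on_class ?f)\<rparr>"
  let ?cls = "\<lambda>x' x. pcls ?V ?U (((), x'), (x, ()))"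
  have \<zeta>: "cmpt \<zeta> (((), x'), (x, ())) (?cls x' x ((b1, (b2, b3)), ((f, k), (s, g)))) = Cmp C g (Cmp C k (Cmp C s f))"
    if "x' \<in> Obj C" "x \<in> Obj C" "b1 \<in> Obj C" "b2 \<in> Obj C" "b3 \<in> Obj C" "f \<in> hom C x b1"
      "k \<in> hom C (fo D b2) b3" "s \<in> hom C b1 (fo D b2)" "g \<in> hom C b3 x'" for x' x b1 b2 b3 f k s g
  proof -
    have "on_class ?f (?cls x' x ((b1, (b2, b3)), ((f, k), (s, g)))) = ?f ((b1, (b2, b3)), ((f, k), (s, g)))"
      by (rule on_class_pcls[OF U V]) (use that in \<open>auto simp: hom_iff Cmp_assoc\<close>)
    then show ?thesis by (simp add: \<zeta>_def)
  qed
  have nf: "?cls x' x ((b1, (b2, b3)), ((f, k), (s, g))) =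
      ?cls x' x ((x, (w, x')), ((Idn C x, Cmp C (Cmp C g (Cmp C k (Cmp C s f))) p), (q, Idn C x')))"
    if o: "x' \<in> Obj C" "x \<in> Obj C" "b1 \<in> Obj C" "b2 \<in> Obj C" "b3 \<in> Obj C" and f: "f \<in> hom C x b1"
      "k \<in> hom C (fo D b2) b3" "s \<in> hom C b1 (fo D b2)" "g \<in> hom C b3 x'"
      and w: "w \<in> Obj C" "p \<in> hom C (fo D w) x" "q \<in> hom C x (fo D w)" and pq: "Cmp C p q = Idn C x"
    for x' x b1 b2 b3 f k s g w p q
  proof -
    have "Cmp C (Cmp C s f) p \<in> hom C (fo D w) (fo D b2)"
      using o f w by (simp add: hom_iff)
    \<comment> \<open>Fullness of \<open>D\<close> gives \<open>n\<close>. Since \<open>p\<close>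
      after \<open>q\<close> is the identity, \<open>D n\<close> after \<open>q\<close> equals
      \<open>s\<close> after \<open>f\<close>. So the evaluation entry factors through
      \<open>D w\<close>, and \<open>n\<close> can slide to the coevaluation.\<close>
    then obtain n where n: "n \<in> hom C b2 w" "fa D n = Cmp C (Cmp C s f) p"
      using D_bij[OF w(1) o(4)] by (metis bij_betw_imp_surj_on imageE)
    have nq: "Cmp C (fa D n) q = Cmp C s f"
      using o f w pq by (simp add: n hom_iff Cmp_assoc)
    have "?cls x' x ((b1, (b2, b3)), ((f, k), (s, g))) =
        ?cls x' x ((x, (b2, b3)), ((Idn C x, k), (Cmp C s f, g)))"
      using pcls_gen[OF U V, of "((), x')" "(x, ())" "(f, (Idn C b2, Idn C b3))" "(b1, (b2, b3))"
          "(x, (b2, b3))" "(Idn C x, k)" "(s, g)"] o f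
      by (simp add: hom_iff Cmp_assoc)
    also have "\<dots> = ?cls x' x ((x, (b2, x')), ((Idn C x, Cmp C g k), (Cmp C s f, Idn C x')))"
      using pcls_gen[OF U V, of "((), x')" "(x, ())" "(Idn C x, (Idn C b2, g))" "(x, (b2, x'))"
          "(x, (b2, b3))" "(Idn C x, k)" "(Cmp C s f, Idn C x')"] o f
      by (simp add: hom_iff Cmp_assoc)
    also have "\<dots> = ?cls x' x ((x, (w, x')), ((Idn C x, Cmp C (Cmp C g k) (fa D n)), (q, Idn C x')))"
      using pcls_gen[OF U V, of "((), x')" "(x, ())" "(Idn C x, (n, Idn C x'))" "(x, (w, x'))"
          "(x, (b2, x'))" "(Idn C x, Cmp C g k)" "(q, Idn C x')"] o f w n(1) nq
      by (simp add: hom_iff Cmp_assoc)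
    finally show ?thesis using o f w by (simp add: n(2) hom_iff Cmp_assoc)
  qed
  have "invertible_cell (?V \<odot> ?U) (flunit Cop \<triangleright> pid Cop \<triangleleft> frunit Cop) \<zeta>"
  proof (rule invertible_cellI[OF _ P])
    show "two_cell (?V \<odot> ?U) (flunit Cop \<triangleright> pid Cop \<triangleleft> frunit Cop) \<zeta>"
    proof (rule two_cellI[OF _ _ P Q])
      fix y x X assume "y \<in> Obj (unit_cat \<times>\<^sub>c Cop)" "x \<in> Obj (Cop \<times>\<^sub>c unit_cat)" "X \<in> El (?V \<odot> ?U) (y, x)"
      then show "cmpt \<zeta> (y, x) X \<in> El (flunit Cop \<triangleright> pid Cop \<triangleleft> frunit Cop) (y, x)"
        by (auto elim!: pcls_cases simp: \<zeta> hom_iff)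
    next
      fix h f X assume "h \<in> Arr (unit_cat \<times>\<^sub>c Cop)" "f \<in> Arr (Cop \<times>\<^sub>c unit_cat)"
        "X \<in> El (?V \<odot> ?U) (Cod (unit_cat \<times>\<^sub>c Cop) h, Dom (Cop \<times>\<^sub>c unit_cat) f)"
      then show "cmpt \<zeta> (Dom (unit_cat \<times>\<^sub>c Cop) h, Cod (Cop \<times>\<^sub>c unit_cat) f) (Act (?V \<odot> ?U) (h, f) X) =
          Act (flunit Cop \<triangleright> pid Cop \<triangleleft> frunit Cop) (h, f)
            (cmpt \<zeta> (Cod (unit_cat \<times>\<^sub>c Cop) h, Dom (Cop \<times>\<^sub>c unit_cat) f) X)"
        by (auto elim!: pcls_cases simp: Act_pcomp[OF U V] \<zeta> hom_iff Cmp_assoc)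
    qed (simp_all add: \<zeta>_def)
  next
    fix y x assume "y \<in> Obj (unit_cat \<times>\<^sub>c Cop)" "x \<in> Obj (Cop \<times>\<^sub>c unit_cat)"
    then obtain x' x1 where yx: "y = ((), x')" "x = (x1, ())" "x' \<in> Obj C" "x1 \<in> Obj C" by auto
    obtain w p q where w: "w \<in> Obj C" "p \<in> hom C (fo D w) x1" "q \<in> hom C x1 (fo D w)"
      "Cmp C p q = Idn C x1"
      using equivalence_essentially_surjective[OF equiv yx(4)] by (metis op_cat_simps(1))
    show "bij_betw (cmpt \<zeta> (y, x)) (El (?V \<odot> ?U) (y, x)) (El (flunit Cop \<triangleright> pid Cop \<triangleleft> frunit Cop) (y, x))"
    \<comment> \<open>An arrow \<open>z\<close> out of \<open>x1\<close> is split at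
      \<open>D w\<close>: the evaluation receives \<open>q\<close> into \<open>D w\<close>, and the
      coevaluation receives \<open>z\<close> after \<open>p\<close> out of
      \<open>D w\<close>.\<close>
    proof (rule bij_betw_byWitness[where f' = "\<lambda>z. ?cls x' x1 ((x1, (w, x')),
          ((Idn C x1, Cmp C z p), (q, Idn C x')))"])
      show "\<forall>X\<in>El (?V \<odot> ?U) (y, x). ?cls x' x1 ((x1, (w, x')),
          ((Idn C x1, Cmp C (cmpt \<zeta> (y, x) X) p), (q, Idn C x'))) = X"
      proof
        fix X assume "X \<in> El (?V \<odot> ?U) (y, x)"
        then obtain b1 b2 b3 f k s g where X: "X = ?cls x' x1 ((b1, (b2, b3)), ((f, k), (s, g)))"
          and b: "b1 \<in> Obj C" "b2 \<in> Obj C" "b3 \<in> Obj C" "f \<in> hom C x1 b1"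
          "k \<in> hom C (fo D b2) b3" "s \<in> hom C b1 (fo D b2)" "g \<in> hom C b3 x'"
          by (auto elim!: pcls_cases simp: yx)
        have c: "cmpt \<zeta> (y, x) X = Cmp C g (Cmp C k (Cmp C s f))"
          unfolding X yx by (rule \<zeta>) (use b yx in auto)
        show "?cls x' x1 ((x1, (w, x')), ((Idn C x1, Cmp C (cmpt \<zeta> (y, x) X) p), (q, Idn C x'))) = X"
          unfolding c unfolding X by (rule nf[symmetric]) (use b yx w in auto)
      qed
      show "\<forall>z\<in>El (flunit Cop \<triangleright> pid Cop \<triangleleft> frunit Cop) (y, x). cmpt \<zeta> (y, x) (?cls x' x1 ((x1, (w, x')),
          ((Idn C x1, Cmp C z p), (q, Idn C x')))) = z"
        using yx w by (auto simp: \<zeta> hom_iff Cmp_assoc)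
      show "cmpt \<zeta> (y, x) ` El (?V \<odot> ?U) (y, x) \<subseteq> El (flunit Cop \<triangleright> pid Cop \<triangleleft> frunit Cop) (y, x)"
        using yx by (auto elim!: pcls_cases simp: \<zeta> hom_iff)
      show "(\<lambda>z. ?cls x' x1 ((x1, (w, x')), ((Idn C x1, Cmp C z p), (q, Idn C x')))) `
          El (flunit Cop \<triangleright> pid Cop \<triangleleft> frunit Cop) (y, x) \<subseteq> El (?V \<odot> ?U) (y, x)"
        using yx w by (auto simp: hom_iff intro!: pcls_in)
    qed
  qed
  then show ?thesis by blast
qed

text \<open>\<open>snake_2\<close> goes from the composite to the identity, whereas the second
  condition on a pairing runs the other way; \<open>invertible_cell_sym\<close> reverses it.\<close>

lemma biexact_pairing_dual: "biexact_pairing Cop Cop (dual_form C D) (dual_coform C D)"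
  unfolding biexact_pairing_def
  using profunctor_dual_form profunctor_dual_coform snake_1 snake_2 invertible_cell_sym D_simps(1) by auto

end

lemma frobenius_form_dual:
  assumes star: "star_autonomous M D \<phi>"
  shows "frobenius_form (op_cat (ucat M)) (rep (ten (mon_op M))) (dual_form (ucat M) D)"
proof -
  interpret monoidal M
    by unfold_locales (use star in \<open>simp add: star_autonomous_def Let_def\<close>)
  let ?A = "op_cat C" and ?T = "ten (mon_op M)" and ?\<sigma> = "dual_form C D"
  have equiv: "equivalence ?A C D"
    and bij: "\<And>x y z. x \<in> Obj C \<Longrightarrow> y \<in> Obj C \<Longrightarrow> z \<in> Obj C \<Longrightarrow>
      bij_betw (\<phi> x y z) (hom C (tensO M x y) (fo D z)) (hom C x (fo D (tensO M y z)))"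
    and nat: "\<And>f g h u. f \<in> Arr C \<Longrightarrow> g \<in> Arr C \<Longrightarrow> h \<in> Arr C \<Longrightarrow>
      u \<in> hom C (tensO M (Cod C f) (Cod C g)) (fo D (Cod C h)) \<Longrightarrow>
      \<phi> (Dom C f) (Dom C g) (Dom C h) (Cmp C (fa D h) (Cmp C u (tensA M f g))) =
      Cmp C (fa D (tensA M g h)) (Cmp C (\<phi> (Cod C f) (Cod C g) (Cod C h) u) f)"
    using star by (simp_all add: star_autonomous_def Let_def)
  note [simp] = D_simps[OF equiv]
  have I: "is_functor ?A ?A (fid ?A)" by simp
  note TI = is_functor_fprod[OF is_functor_mon_op I] and IT = is_functor_fprod[OF I is_functor_mon_op]
  have a: "is_functor ((?A \<times>\<^sub>c ?A) \<times>\<^sub>c ?A) (?A \<times>\<^sub>c (?A \<times>\<^sub>c ?A)) (fassoc ?A ?A ?A)" by simp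
  note \<sigma> = profunctor_dual_form[OF equiv]
  \<comment> \<open>The tensor products are literally represented by product functors, so co-Yoneda
    applies to their composites with \<open>?\<sigma>\<close>.\<close>
  have tens: "rep ?T \<otimes> pid ?A = rep (?T \<times>\<^sub>f fid ?A)" "pid ?A \<otimes> rep ?T = rep (fid ?A \<times>\<^sub>f ?T)"
    using arg_cong[OF rtens_rep[of ?T "fid ?A"], of rpr] arg_cong[OF rtens_rep[of "fid ?A" ?T], of rpr]
    by simp_all
  let ?P = "?\<sigma> \<triangleleft> (?T \<times>\<^sub>f fid ?A)" and ?Q = "?\<sigma> \<triangleleft> (fid ?A \<times>\<^sub>f ?T) \<triangleleft> fassoc ?A ?A ?A"
  note P = profunctor_psub[OF \<sigma> TI] and Q = profunctor_psub[OF profunctor_psub[OF \<sigma> IT] a]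
  define \<theta> where "\<theta> = \<lparr>csrc = ?P, ctgt = ?Q, cmpt = (\<lambda>(_, ((x, y), z)). \<phi> x y z)\<rparr>"
  have "invertible_cell ?P ?Q \<theta>"
  proof (rule invertible_cellI[OF two_cellI[OF _ _ P Q] P])
    fix h F u assume F: "F \<in> Arr ((?A \<times>\<^sub>c ?A) \<times>\<^sub>c ?A)" and u: "u \<in> El ?P (Cod unit_cat h, Dom ((?A \<times>\<^sub>c ?A) \<times>\<^sub>c ?A) F)"
    obtain f g k where eq: "F = ((f, g), k)" by (metis surj_pair)
    \<comment> \<open>Domain and codomain are exchanged in \<open>?A\<close>, so naturality over
      \<open>?A\<close> is exactly the contravariant naturality \<open>nat\<close> of
      \<phi>.\<close>
    show "cmpt \<theta> (Dom unit_cat h, Cod ((?A \<times>\<^sub>c ?A) \<times>\<^sub>c ?A) F) (Act ?P (h, F) u) =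
        Act ?Q (h, F) (cmpt \<theta> (Cod unit_cat h, Dom ((?A \<times>\<^sub>c ?A) \<times>\<^sub>c ?A) F) u)"
      using F u nat[of f g k u] by (simp add: eq \<theta>_def)
  next
    fix t w u assume "w \<in> Obj ((?A \<times>\<^sub>c ?A) \<times>\<^sub>c ?A)" "u \<in> El ?P (t, w)"
    then show "cmpt \<theta> (t, w) u \<in> El ?Q (t, w)"
      by (auto simp: \<theta>_def intro: bij_betw_apply[OF bij])
  next
    fix t w assume "w \<in> Obj ((?A \<times>\<^sub>c ?A) \<times>\<^sub>c ?A)"
    then show "bij_betw (cmpt \<theta> (t, w)) (El ?P (t, w)) (El ?Q (t, w))"
      using bij by (auto simp: \<theta>_def)
  qed (simp_all add: \<theta>_def)
  moreover have "invertible_cell (?\<sigma> \<odot> (rep ?T \<otimes> pid ?A)) ?P (coyoneda ?\<sigma> (?T \<times>\<^sub>f fid ?A))"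
    unfolding tens by (rule invertible_coyoneda[OF \<sigma> TI])
  \<comment> \<open>The last leg is co-Yoneda substituted along \<open>fassoc\<close> and then
    reversed.\<close>
  moreover obtain \<zeta> where "invertible_cell ?Q ((?\<sigma> \<odot> (pid ?A \<otimes> rep ?T)) \<triangleleft> fassoc ?A ?A ?A) \<zeta>"
    unfolding tens using invertible_cell_sym[OF invertible_cell_csub[OF invertible_coyoneda[OF \<sigma> IT] _ a]]
      profunctor_pcomp[OF profunctor_rep[OF IT] \<sigma>] by blast
  ultimately show ?thesis
    unfolding frobenius_form_def using biexact_pairing_dual[OF equiv]
    by (blast intro: invertible_cell_vcomp)
qed

theorem theorem3p3p3:
  fixes M :: "('o, 'a) moncat"
    and D :: "('o, 'a, 'o, 'a) functr"
    and \<phi> :: "'o \<Rightarrow> 'o \<Rightarrow> 'o \<Rightarrow> 'a \<Rightarrow> 'a"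
  assumes "star_autonomous M D \<phi>"
  shows "dagger_frobenius_pseudomonoid (op_cat (ucat M))
    (ind_mult (mon_op M)) (ind_unit (mon_op M))
    (ind_assoc (mon_op M)) (ind_lunit (mon_op M)) (ind_runit (mon_op M))"
proof -
  interpret monoidal M
    by unfold_locales (use assms in \<open>simp add: star_autonomous_def Let_def\<close>)
  \<comment> \<open>The general construction is instantiated a second time, at the opposite monoidal
    category, because the pseudomonoid has \<open>op_cat C\<close> as its object.\<close>
  interpret op: monoidal "mon_op M"
    by unfold_locales (rule monoidal_mon_op)
  have "pseudomonoid (op_cat (ucat M)) (ind_mult (mon_op M)) (ind_unit (mon_op M))
      (ind_assoc (mon_op M)) (ind_lunit (mon_op M)) (ind_runit (mon_op M))"
    using op.pseudomonoid_ind by simp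
  moreover have "has_right_adjoint (ind_mult (mon_op M))"
    unfolding ind_mult_def by (rule has_right_adjoint_rep[OF op.functor_T])
  moreover have "has_right_adjoint (ind_unit (mon_op M))"
    unfolding ind_unit_def by (rule has_right_adjoint_rep[OF is_functor_fpoint]) auto
  ultimately show ?thesis
    unfolding dagger_frobenius_pseudomonoid_def frobenius_pseudomonoid_def
    using frobenius_form_dual[OF assms] by (auto simp: ind_mult_def)
qed

end
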